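(* (Continuity of the limiting traffic distribution in the band width.) Let $I$ be an index set and let $\beta_i\in\mathbb{R}$, $i\in I$. For a test graph $T=(V,E,\gamma)$ with labels in $I$, put $\sigma(T)=\prod_{i\in I}\beta_i^{\mathrm{cong}_i(T)}$ if $T$ is a colored double tree and $\sigma(T)=0$ otherwise. (i) For $\mathbf{c}=(c_i)_{i\in I}\in(0,1)^I$, let $L_T(\mathbf{c})=\lim_{n\to\infty}\tau^0[T(\mathcal{O}_n)]$, where $\mathcal{O}_n=(\mathbf{\Theta}_n^{(i)})_{i\in I}$ are normalized random band matrices of proportional growth with proper proportions $c_i$, built from independent Wigner matrices with uniformly controlled moments and parameters $\beta_i$ (the limit exists and depends on the band widths only through $\mathbf{c}$). Then for every test graph $T$ with $E\ne\emptyset$, $$\lim_{\max_{e\in E}c_{\gamma(e)}\to0^+}L_T(\mathbf{c})=\sigma(T)=\lim_{\min_{e\in E}c_{\gamma(e)}\to1^-}L_T(\mathbf{c}).$$ (ii) For nonnegative integers $\mathbf{b}=(b_i)_{i\in I}$, let $L'_T(\mathbf{b})=\lim_{n\to\infty}\tau^0[T(\mathcal{O}_n)]$, where now $\mathcal{O}_n=(\mathbf{\Theta}_n^{(i)})_{i\in I}$ are normalized random band matrices of fixed band widths $b_i$ built from independent Wigner matrices with parameters $\beta_i$ whose strictly upper triangular entries (respectively diagonal entries) are i.i.d. with a fixed law $\mu_i$ (respectively $\nu_i$), independent of $n$ and of $\mathbf b$, with finite moments of all orders. Then for every test graph $T$ with $E\neq\emptyset$, $$\lim_{\min_{e\in 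E}b_{\gamma(e)}\to\infty}L'_T(\mathbf{b})=\sigma(T).$$
   Context: Wigner matrices with uniformly controlled moments: for each $n$, $(\mathbf{X}_n^{(i)})_{i\in I}$ are random Hermitian $n\times n$ matrices such that the entries $(\mathbf{X}_n^{(i)}(j,k):1\le j\le k\le n,\ i\in I)$ are independent; diagonal entries are real-valued; for $j<k$, $\mathbb{E}\mathbf{X}_n^{(i)}(j,k)=0$, $\mathbb{E}|\mathbf{X}_n^{(i)}(j,k)|^2=1$, $\mathbb{E}[\mathbf{X}_n^{(i)}(j,k)^2]=\beta_i$; and for every finite $I_0\subset I$ and $\ell\in\mathbb{N}$, $\sup_n\sup_{i\in I_0}\sup_{1\le j\le k\le n}\mathbb{E}|\mathbf{X}_n^{(i)}(j,k)|^\ell<\infty$. Random band matrices: for nonnegative integers $b_n$, $\mathbf{\Xi}_n(j,k)=\mathbf{1}\{|j-k|\le b_n\}\mathbf{X}_n(j,k)$. Proportional growth with proper proportion $c$: $b_n/n\to c\in(0,1)$ and $\mathbf{\Theta}_n=(2c-c^2)^{-1/2}n^{-1/2}\mathbf{\Xi}_n$. Fixed band width $b_n\equiv b$: $\mathbf{\Theta}_n=(2b+1)^{-1/2}\mathbf{\Xi}_n$. A test graph $T=(V,E,\mathrm{src},\mathrm{tar},\gamma)$ with labels in $I$ is a finite, connected directed multigraph (loops and multiple edges allowed, $V\ne\emptyset$) with $\gamma:E\to I$; $\tau^0[T(\mathcal{O}_n)]=\mathbb{E}[\frac1n\sum_{\phi:V\hookrightarrow[n]}\prod_{e\in E}\mathbf{\Theta}_n^{(\gamma(e))}(\phi(\mathrm{tar}(e)),\phi(\mathrm{src}(e)))]$,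 sum over injective maps. $T$ is a colored double tree if, forgetting orientation and multiplicity of edges, it becomes a tree, there are exactly two edges between adjacent vertices, and the two edges of each such pair (twin edges) share the same label; twin edges are congruent if they have the same orientation. $\mathrm{cong}_i(T)$ is the number of pairs of congruent twin edges with label $i$ ($0^0=1$). *)

theory Defs
  imports "HOL-Probability.Probability" "Graph_Theory.Digraph_Component"
begin

section \<open>Test graphs and colored double trees\<close>

text \<open>
  A test graph is a directed multigraph (vertices \<open>verts T\<close>, edges \<open>arcs T\<close>, source \<open>tail T\<close>,
  target \<open>head T\<close>) together with a labelling \<open>\<gamma>\<close> of its edges, which is kept as a separate
  argument. The index set \<open>I\<close> is the type \<open>'i\<close>. The library predicate \<open>connected\<close> symmetrizes
  the graph and requires a nonempty vertex set.
\<close>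

definition test_graph :: "('v, 'e) pre_digraph \<Rightarrow> bool" where
  "test_graph T \<longleftrightarrow> fin_digraph T \<and> connected T"

definition ends :: "('v, 'e) pre_digraph \<Rightarrow> 'e \<Rightarrow> 'v set" where
  "ends T e = {tail T e, head T e}"

text \<open>
  The undirected tree notion is needed here. The predicate \<open>tree\<close> of the digraph library only
  excludes directed cycles, so it is not the right one, neither for \<open>T\<close> nor for its symmetrization.
\<close>

definition undirected_cycle :: "'v set set \<Rightarrow> 'v list \<Rightarrow> bool" where
  "undirected_cycle U xs \<longleftrightarrow> 3 \<le> length xs \<and> distinct xs \<and>
     (\<forall>k<length xs. {xs ! k, xs ! (Suc k mod length xs)} \<in> U)"

definition undirected_tree :: "'v set \<Rightarrow> 'v set set \<Rightarrow> bool" where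
  "undirected_tree V U \<longleftrightarrow> V \<noteq> {} \<and> (\<forall>u\<in>U. u \<subseteq> V \<and> card u = 2) \<and>
     (\<forall>x\<in>V. \<forall>y\<in>V. (x, y) \<in> {(a, b). {a, b} \<in> U}\<^sup>*) \<and>
     (\<nexists>xs. undirected_cycle U xs)"

definition colored_double_tree :: "('v, 'e) pre_digraph \<Rightarrow> ('e \<Rightarrow> 'i) \<Rightarrow> bool" where
  "colored_double_tree T \<gamma> \<longleftrightarrow>
     undirected_tree (verts T) (ends T ` arcs T) \<and>
     (\<forall>u \<in> ends T ` arcs T. card {e \<in> arcs T. ends T e = u} = 2) \<and>
     (\<forall>e\<in>arcs T. \<forall>e'\<in>arcs T. ends T e = ends T e' \<longrightarrow> \<gamma> e = \<gamma> e')"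

definition cong :: "('v, 'e) pre_digraph \<Rightarrow> ('e \<Rightarrow> 'i) \<Rightarrow> 'i \<Rightarrow> nat" where
  "cong T \<gamma> i = card {{e, e'} | e e'. e \<in> arcs T \<and> e' \<in> arcs T \<and> e \<noteq> e' \<and>
     tail T e = tail T e' \<and> head T e = head T e' \<and> \<gamma> e = i \<and> \<gamma> e' = i}"

text \<open>
  The product over all of \<open>I\<close> is restricted to the labels that occur in \<open>T\<close>: all other factors
  are \<open>\<beta> i ^ 0 = 1\<close>, but \<open>I\<close> may be infinite.
\<close>

definition \<sigma> :: "('i \<Rightarrow> real) \<Rightarrow> ('v, 'e) pre_digraph \<Rightarrow> ('e \<Rightarrow> 'i) \<Rightarrow> complex" where
  "\<sigma> \<beta> T \<gamma> = (if colored_double_tree T \<gamma>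
     then of_real (\<Prod>i\<in>\<gamma> ` arcs T. \<beta> i ^ cong T \<gamma> i) else 0)"


section \<open>Random matrices\<close>

text \<open>
  A family of random matrices of size \<open>n\<close>, indexed by \<open>'i\<close>, on a sample space \<open>'w\<close>; matrix
  indices run through \<open>{1..n}\<close>.
\<close>

type_synonym ('i, 'w) rmatrices = "'i \<Rightarrow> nat \<Rightarrow> nat \<Rightarrow> 'w \<Rightarrow> complex"

definition injective_traffic_state ::
  "'w measure \<Rightarrow> nat \<Rightarrow> ('i, 'w) rmatrices \<Rightarrow> ('v, 'e) pre_digraph \<Rightarrow> ('e \<Rightarrow> 'i) \<Rightarrow> complex" where
  "injective_traffic_state P n A T \<gamma> =
     (\<integral>\<omega>. 1 / of_nat n *
        (\<Sum>\<phi> | \<phi> \<in> verts T \<rightarrow>\<^sub>E {1..n} \<and> inj_on \<phi> (verts T).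
           \<Prod>e\<in>arcs T. A (\<gamma> e) (\<phi> (head T e)) (\<phi> (tail T e)) \<omega>) \<partial>P)"

text \<open>
  \<open>P n\<close> is the probability space carrying the matrices of size \<open>n\<close>. That the diagonal entries
  are real is the case \<open>j = k\<close> of the Hermitian condition.
\<close>

definition wigner ::
  "('i \<Rightarrow> real) \<Rightarrow> (nat \<Rightarrow> 'w measure) \<Rightarrow> (nat \<Rightarrow> ('i, 'w) rmatrices) \<Rightarrow> bool" where
  "wigner \<beta> P X \<longleftrightarrow> (\<forall>n.
     prob_space (P n) \<and>
     (\<forall>i. \<forall>j\<in>{1..n}. \<forall>k\<in>{1..n}. \<forall>\<omega>\<in>space (P n). X n i k j \<omega> = cnj (X n i j k \<omega>)) \<and>
     prob_space.indep_vars (P n) (\<lambda>_. borel) (\<lambda>(i, j, k). X n i j k)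
       {(i, j, k). 1 \<le> j \<and> j \<le> k \<and> k \<le> n} \<and>
     (\<forall>i j k. 1 \<le> j \<and> j < k \<and> k \<le> n \<longrightarrow>
        integrable (P n) (X n i j k) \<and>
        integrable (P n) (\<lambda>\<omega>. (cmod (X n i j k \<omega>))\<^sup>2) \<and>
        (\<integral>\<omega>. X n i j k \<omega> \<partial>P n) = 0 \<and>
        (\<integral>\<omega>. (cmod (X n i j k \<omega>))\<^sup>2 \<partial>P n) = 1 \<and>
        (\<integral>\<omega>. (X n i j k \<omega>)\<^sup>2 \<partial>P n) = of_real (\<beta> i)))"

definition uniformly_controlled_moments ::
  "(nat \<Rightarrow> 'w measure) \<Rightarrow> (nat \<Rightarrow> ('i, 'w) rmatrices) \<Rightarrow> bool" where
  "uniformly_controlled_moments P X \<longleftrightarrow> (\<forall>I\<^sub>0 l. finite I\<^sub>0 \<longrightarrow>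
     (SUP n. SUP i\<in>I\<^sub>0. SUP (j, k)\<in>{(j, k). 1 \<le> j \<and> j \<le> k \<and> k \<le> n}.
        \<integral>\<^sup>+\<omega>. ennreal (cmod (X n i j k \<omega>) ^ l) \<partial>P n) < \<infinity>)"

text \<open>
  Strictly upper triangular entries with law \<open>\<mu> i\<close> and diagonal entries with law \<open>\<nu> i\<close>, for
  all \<open>n\<close>. Both are measures on the complex numbers.
\<close>

definition entry_laws ::
  "(nat \<Rightarrow> 'w measure) \<Rightarrow> (nat \<Rightarrow> ('i, 'w) rmatrices) \<Rightarrow>
   ('i \<Rightarrow> complex measure) \<Rightarrow> ('i \<Rightarrow> complex measure) \<Rightarrow> bool" where
  "entry_laws P X \<mu> \<nu> \<longleftrightarrow> (\<forall>n i.
     (\<forall>j k. 1 \<le> j \<and> j < k \<and> k \<le> n \<longrightarrow> distr (P n) borel (X n i j k) = \<mu> i) \<and>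
     (\<forall>j. 1 \<le> j \<and> j \<le> n \<longrightarrow> distr (P n) borel (X n i j j) = \<nu> i))"

definition finite_moments :: "complex measure \<Rightarrow> bool" where
  "finite_moments \<mu> \<longleftrightarrow> (\<forall>l::nat. (\<integral>\<^sup>+z. ennreal (cmod z ^ l) \<partial>\<mu>) < \<infinity>)"

definition band :: "('i \<Rightarrow> nat) \<Rightarrow> ('i, 'w) rmatrices \<Rightarrow> ('i, 'w) rmatrices" where
  "band b X i j k \<omega> = (if \<bar>int j - int k\<bar> \<le> int (b i) then X i j k \<omega> else 0)"

definition theta_proportional ::
  "('i \<Rightarrow> real) \<Rightarrow> ('i \<Rightarrow> nat) \<Rightarrow> nat \<Rightarrow> ('i, 'w) rmatrices \<Rightarrow> ('i, 'w) rmatrices" where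
  "theta_proportional c b n X i j k \<omega> =
     of_real ((2 * c i - (c i)\<^sup>2) powr (- 1 / 2) * real n powr (- 1 / 2)) * band b X i j k \<omega>"

definition theta_fixed :: "('i \<Rightarrow> nat) \<Rightarrow> ('i, 'w) rmatrices \<Rightarrow> ('i, 'w) rmatrices" where
  "theta_fixed b X i j k \<omega> =
     of_real ((2 * real (b i) + 1) powr (- 1 / 2)) * band b X i j k \<omega>"

end

(*
  By independence and centring, the expectation of a product of entries along an injective map
  vanishes as soon as some edge that is not a loop is the only one with its label and its end
  points. Otherwise a spanning tree F of T, together with a twin for each of its edges, uses up
  exactly the powers of the normalization that compensate the number of injective maps respecting
  the bands, which is at most n times the product of the band widths over F. Every further edge
  contributes a factor that tends to 0, and there is no further edge precisely if T is a colored
  double tree.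

  For a colored double tree the expectation is the constant \<sigma>(T), so only the number of maps
  matters. For proportional growth it converges, after division by n^|V|, to the volume of a region
  in the unit cube (dominated convergence for x |-> ceiling (n x)), and attaching the leaves of F one
  after the other bounds that volume between (1 - 2 sum c) prod (2 c) and prod (2 c). For fixed
  widths all expectations are translation invariant, so the limit is a finite sum over the shapes
  of the maps seen from a root, and the same leaf argument counts the shapes.
*)
theory Submission
  imports Defs
begin

section \<open>Spanning trees of test graphs\<close>

text \<open>Injectivity makes the moments computable: two edges then read the same independent entry
  exactly if they agree in label and end points, so the expectation is a product over classes of
  edges that depend on \<open>T\<close> and \<open>\<gamma>\<close> only. The limit functions have
  to be named before the widths and the model are known, hence the explicit witnesses. For
  proportional growth a surplus edge costs a factor n^(-1/2), so the limit is exactly 0 off the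
  double trees. For fixed widths it costs only (2b+1)^(-1/2); the limit need not vanish, and
  convergence in n has to be shown for every test graph, which is why shapes carry a weight. The
  delicate limit is c to 0: the volume vanishes while the normalization 1/(2c-c^2) per pair of twins
  blows up, so the volume is needed up to a factor tending to 1. Counting leaf by leaf gives 2c per
  tree edge, and 2c/(2c-c^2) = 2/(2-c) tends to 1. For c to 1, normalization and volume tend to 1
  separately.\<close>

text \<open>A subtree with vertices \<open>W\<close> and edges \<open>F\<close>, given by the order
  in which leaves are attached to the root; orientation is ignored through \<open>ends\<close>. The
  counting arguments below are inductions along this order.\<close>

inductive grown_tree :: "('v, 'e) pre_digraph \<Rightarrow> 'v \<Rightarrow> 'v set \<Rightarrow> 'e set \<Rightarrow> bool"
  for T :: "('v, 'e) pre_digraph" and r :: 'v where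
  root: "grown_tree T r {r} {}"
| leaf: "grown_tree T r W F \<Longrightarrow> e \<in> arcs T \<Longrightarrow> ends T e = {v, w} \<Longrightarrow> v \<in> W \<Longrightarrow> w \<notin> W \<Longrightarrow>
    grown_tree T r (insert w W) (insert e F)"

text \<open>The equation \<open>card W = Suc (card F)\<close> is what balances normalization against
  counting: one free factor for the root and one per tree edge. Injectivity of \<open>ends T\<close>
  on \<open>F\<close> lets a tree edge stand for its pair of end points.\<close>

lemma grown_tree_basic:
  assumes "grown_tree T r W F"
  shows "finite W \<and> finite F \<and> r \<in> W \<and> F \<subseteq> arcs T \<and> (\<forall>f\<in>F. ends T f \<subseteq> W \<and> card (ends T f) = 2)
    \<and> card W = Suc (card F) \<and> inj_on (ends T) F"
  using assms
proof induction
  case root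
  show ?case by simp
next
  case (leaf W F e v w)
  have "ends T e \<noteq> ends T f" if "f \<in> F" for f
  proof -
    have "ends T f \<subseteq> W" using leaf.IH that by blast
    then show ?thesis using leaf.hyps(3,5) by blast
  qed
  moreover have "e \<notin> F" using leaf by auto
  moreover have "v \<noteq> w" using leaf by auto
  ultimately show ?case using leaf by (auto simp: card_insert_if)
qed

lemma grown_tree_reach:
  assumes "grown_tree T r W F" "x \<in> W"
  shows "(r, x) \<in> {(a, b). {a, b} \<in> ends T ` F}\<^sup>*"
  using assms
proof (induction arbitrary: x)
  case root
  then show ?case by simp
next
  case (leaf W F e v w)
  have mono: "{(a, b). {a, b} \<in> ends T ` F}\<^sup>* \<subseteq> {(a, b). {a, b} \<in> ends T ` insert e F}\<^sup>*"
    by (rule rtrancl_mono) auto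
  show ?case
  proof (cases "x = w")
    case True
    have "(r, v) \<in> {(a, b). {a, b} \<in> ends T ` insert e F}\<^sup>*"
      using leaf.IH[of v] leaf.hyps mono by auto
    moreover have "(v, w) \<in> {(a, b). {a, b} \<in> ends T ` insert e F}"
      using leaf.hyps by auto
    ultimately show ?thesis using True by (meson rtrancl.rtrancl_into_rtrancl)
  next
    case False
    then show ?thesis using leaf mono by auto
  qed
qed

text \<open>The two neighbours are the cyclic predecessor and successor; they differ because a cycle
  has length at least 3.\<close>

lemma undirected_cycle_neighbours:
  assumes c: "undirected_cycle U xs" and x: "x \<in> set xs"
  obtains y z where "y \<noteq> z" "y \<noteq> x" "z \<noteq> x" "{x, y} \<in> U" "{x, z} \<in> U" "y \<in> set xs" "z \<in> set xs"
proof -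
  define m where "m = length xs"
  from c have m: "3 \<le> m" "distinct xs" and e: "\<And>k. k < m \<Longrightarrow> {xs ! k, xs ! (Suc k mod m)} \<in> U"
    by (auto simp: undirected_cycle_def m_def)
  from x obtain k where k: "k < m" "xs ! k = x" by (auto simp: in_set_conv_nth m_def)
  \<comment> \<open>The predecessor index; adding \<open>m\<close> first keeps the subtraction from
    truncating at \<open>k = 0\<close>.\<close>
  define j where "j = (k + m - 1) mod m"
  define l where "l = Suc k mod m"
  have j: "j < m" "l < m" using m by (auto simp: j_def l_def)
  have sj: "Suc j mod m = k"
    using k m by (cases k) (auto simp: j_def mod_Suc)
  have ne: "j \<noteq> l \<and> j \<noteq> k \<and> l \<noteq> k"
    using k m by (cases "Suc k = m"; cases k) (auto simp: j_def l_def mod_Suc)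
  show ?thesis
  proof (rule that[of "xs ! j" "xs ! l"])
    show "xs ! j \<noteq> xs ! l" "xs ! j \<noteq> x" "xs ! l \<noteq> x"
      using ne j k m by (auto simp: nth_eq_iff_index_eq m_def)
    show "{x, xs ! j} \<in> U" using e[OF j(1)] sj k by (simp add: insert_commute)
    show "{x, xs ! l} \<in> U" using e[OF k(1)] k by (simp add: l_def)
    show "xs ! j \<in> set xs" "xs ! l \<in> set xs" using j by (auto simp: m_def)
  qed
qed

text \<open>A cycle through the newest leaf \<open>w\<close> would give \<open>w\<close> two
  different neighbours, but \<open>e\<close> is the only edge at \<open>w\<close>. A cycle avoiding
  \<open>w\<close> does not use \<open>e\<close>, so it already lies in the smaller tree.\<close>

lemma grown_tree_acyclic:
  assumes "grown_tree T r W F"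
  shows "\<not> undirected_cycle (ends T ` F) xs"
  using assms
proof induction
  case root
  show ?case
  proof
    assume "undirected_cycle (ends T ` {}) xs"
    then have "3 \<le> length xs" "\<forall>k<length xs. False" by (simp_all add: undirected_cycle_def)
    then show False by (metis le_zero_eq neq0_conv numeral_eq_iff zero_neq_numeral)
  qed
next
  case (leaf W F e v w)
  have sub: "ends T f \<subseteq> W" if "f \<in> F" for f
    using grown_tree_basic[OF leaf.hyps(1)] that by auto
  show ?case
  proof
    assume c: "undirected_cycle (ends T ` insert e F) xs"
    show False
    proof (cases "w \<in> set xs")
      case True
      from undirected_cycle_neighbours[OF c this] obtain y z where
        yz: "y \<noteq> z" "y \<noteq> w" "z \<noteq> w" "{w, y} \<in> ends T ` insert e F" "{w, z} \<in> ends T ` insert e F"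
        by metis
      have "{w, y} = ends T e" "{w, z} = ends T e"
      proof -
        have "u = ends T e" if u: "u \<in> ends T ` insert e F" "w \<in> u" for u
        proof (rule ccontr)
          assume "u \<noteq> ends T e"
          then obtain f where "f \<in> F" "u = ends T f" using u(1) by blast
          then show False using sub[of f] u leaf.hyps(5) by blast
        qed
        from this[OF yz(4)] this[OF yz(5)] show "{w, y} = ends T e" "{w, z} = ends T e" by blast+
      qed
      then have "{w, y} = {w, z}" by simp
      then show False using yz by (auto simp: doubleton_eq_iff)
    next
      case False
      have "undirected_cycle (ends T ` F) xs"
        unfolding undirected_cycle_def
      proof (intro conjI allI impI)
        show "3 \<le> length xs" "distinct xs" using c by (auto simp: undirected_cycle_def)
        fix k assume k: "k < length xs"
        then have "Suc k mod length xs < length xs" by (intro mod_less_divisor) linarith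
        then have "{xs ! k, xs ! (Suc k mod length xs)} \<noteq> ends T e"
          using False k leaf.hyps by (metis insert_iff nth_mem singletonD)
        moreover have "{xs ! k, xs ! (Suc k mod length xs)} \<in> ends T ` insert e F"
          using c k by (auto simp: undirected_cycle_def)
        ultimately show "{xs ! k, xs ! (Suc k mod length xs)} \<in> ends T ` F" by auto
      qed
      with leaf.IH show False by simp
    qed
  qed
qed

text \<open>A walk in the symmetrized graph from a vertex inside \<open>W\<close> to one outside has
  to cross the boundary of \<open>W\<close> somewhere.\<close>

lemma connected_edge_leaving:
  assumes T: "test_graph T" and W: "W \<subseteq> verts T" "W \<noteq> {}" "W \<noteq> verts T"
  obtains e v w where "e \<in> arcs T" "ends T e = {v, w}" "v \<in> W" "w \<notin> W" "w \<in> verts T"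
proof -
  interpret fin_digraph T using T by (simp add: test_graph_def)
  interpret S: pair_wf_digraph "mk_symmetric T" by (rule wellformed_mk_symmetric)
  from W obtain x y where x: "x \<in> W" and y: "y \<in> verts T" "y \<notin> W" by auto
  have "strongly_connected (mk_symmetric T)" using T by (simp add: test_graph_def connected_def)
  then have "x \<rightarrow>\<^sup>*\<^bsub>mk_symmetric T\<^esub> y"
    using x y W by (auto simp: strongly_connected_def)
  then have "y \<notin> W \<longrightarrow> (\<exists>v w. (v, w) \<in> parcs (mk_symmetric T) \<and> v \<in> W \<and> w \<notin> W)"
    by (induction rule: S.reachable_induct) (use x in auto)
  then obtain v w where vw: "(v, w) \<in> parcs (mk_symmetric T)" "v \<in> W" "w \<notin> W" using y by auto
  then obtain e where e: "e \<in> arcs T" "ends T e = {v, w}"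
    by (auto simp: parcs_mk_symmetric ends_def insert_commute)
  then have "w \<in> verts T" using wellformed by (auto simp: ends_def doubleton_eq_iff)
  with e vw that show ?thesis by auto
qed

lemma spanning_grown_tree:
  assumes T: "test_graph T" and r: "r \<in> verts T"
  obtains F where "grown_tree T r (verts T) F"
proof -
  interpret fin_digraph T using T by (simp add: test_graph_def)
  have "\<exists>F. grown_tree T r (verts T) F" if "grown_tree T r W F" "W \<subseteq> verts T" for W F
    using that
  proof (induction "card (verts T - W)" arbitrary: W F rule: less_induct)
    case less
    show ?case
    proof (cases "W = verts T")
      case True
      with less show ?thesis by auto
    next
      case False
      have "W \<noteq> {}" using grown_tree_basic[OF less.prems(1)] by auto
      from connected_edge_leaving[OF T less.prems(2) this False] obtain e v w where
        e: "e \<in> arcs T" "ends T e = {v, w}" "v \<in> W" "w \<notin> W" "w \<in> verts T" by blast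
      have "card (verts T - insert w W) < card (verts T - W)"
        using e by (intro psubset_card_mono) auto
      from less.hyps[OF this grown_tree.leaf[OF less.prems(1) e(1-4)]] show ?thesis
        using e less.prems by auto
    qed
  qed
  from this[OF grown_tree.root] r that show ?thesis by auto
qed

section \<open>Double trees seen from a spanning tree\<close>

text \<open>Whenever the walk returns to a vertex it has visited, everything after the first visit
  is cut off. Distinctness is needed to close such a path to an
  \<open>undirected_cycle\<close>.\<close>

lemma rtrancl_distinct_path:
  assumes "(x, y) \<in> {(a, b). {a, b} \<in> U}\<^sup>*"
  obtains xs where "xs \<noteq> []" "hd xs = x" "last xs = y" "distinct xs"
    "\<And>k. Suc k < length xs \<Longrightarrow> {xs ! k, xs ! Suc k} \<in> U"
proof -
  have "\<exists>xs. xs \<noteq> [] \<and> hd xs = x \<and> last xs = y \<and> distinct xs \<and>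
    (\<forall>k. Suc k < length xs \<longrightarrow> {xs ! k, xs ! Suc k} \<in> U)"
    using assms
  proof (induction rule: rtrancl_induct)
    case base
    show ?case by (rule exI[of _ "[x]"]) auto
  next
    case (step y z)
    then obtain xs where xs: "xs \<noteq> []" "hd xs = x" "last xs = y" "distinct xs"
      "\<forall>k. Suc k < length xs \<longrightarrow> {xs ! k, xs ! Suc k} \<in> U" by auto
    show ?case
    proof (cases "z \<in> set xs")
      case True
      then obtain k where k: "k < length xs" "xs ! k = z" by (auto simp: in_set_conv_nth)
      have "last (take (Suc k) xs) = z" using k by (simp add: take_Suc_conv_app_nth)
      then show ?thesis
        by (intro exI[of _ "take (Suc k) xs"]) (use xs k in simp)
    next
      case False
      have "{(xs @ [z]) ! k, (xs @ [z]) ! Suc k} \<in> U" if "Suc k < length (xs @ [z])" for k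
      proof (cases "Suc k = length xs")
        case True
        then have "(xs @ [z]) ! k = y"
          using xs(1,3) by (auto simp: nth_append last_conv_nth simp flip: True)
        then show ?thesis using True step.hyps(2) by (simp add: nth_append)
      next
        case False
        then show ?thesis using that xs(5) by (simp add: nth_append)
      qed
      then show ?thesis using xs False by (intro exI[of _ "xs @ [z]"]) auto
    qed
  qed
  with that show ?thesis by metis
qed

text \<open>An adjacency \<open>u\<close> outside the spanning tree would close the tree path
  between its two end points to a cycle. The path has at least 3 vertices: one vertex contradicts
  \<open>card u = 2\<close>, and two would make \<open>u\<close> an adjacency of the tree.\<close>

lemma double_tree_ends_covered:
  assumes T: "undirected_tree (verts T) (ends T ` arcs T)" and g: "grown_tree T r (verts T) F"
  shows "ends T ` arcs T = ends T ` F"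
proof
  note b = grown_tree_basic[OF g]
  show "ends T ` F \<subseteq> ends T ` arcs T" using b by auto
  show "ends T ` arcs T \<subseteq> ends T ` F"
  proof (rule ccontr)
    assume "\<not> ?thesis"
    then obtain u where u: "u \<in> ends T ` arcs T" "u \<notin> ends T ` F" by auto
    then have "u \<subseteq> verts T" "card u = 2" using T by (auto simp: undirected_tree_def)
    then obtain x y where xy: "u = {x, y}" "x \<noteq> y" "x \<in> verts T" "y \<in> verts T"
      by (auto simp: card_2_iff)
    have sym: "sym ({(a, b). {a, b} \<in> ends T ` F}\<^sup>*)"
      by (intro sym_rtrancl) (auto simp: sym_def insert_commute)
    have "(x, y) \<in> {(a, b). {a, b} \<in> ends T ` F}\<^sup>*"
      using grown_tree_reach[OF g xy(3)] grown_tree_reach[OF g xy(4)] symD[OF sym]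
      by (meson rtrancl_trans)
    from rtrancl_distinct_path[OF this] obtain xs where xs: "xs \<noteq> []" "hd xs = x" "last xs = y"
      "distinct xs" "\<And>k. Suc k < length xs \<Longrightarrow> {xs ! k, xs ! Suc k} \<in> ends T ` F" by blast
    have l: "xs ! 0 = x" "xs ! (length xs - 1) = y" using xs by (auto simp: hd_conv_nth last_conv_nth)
    have "length xs \<noteq> 1" using l xy by auto
    moreover have "length xs \<noteq> 2" using l xs(5)[of 0] u xy by (auto simp: numeral_2_eq_2)
    moreover have "length xs \<noteq> 0" using xs by auto
    ultimately have len: "3 \<le> length xs" by linarith
    have "undirected_cycle (ends T ` arcs T) xs"
      unfolding undirected_cycle_def
    proof (intro conjI allI impI len xs(4))
      fix k assume k: "k < length xs"
      show "{xs ! k, xs ! (Suc k mod length xs)} \<in> ends T ` arcs T"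
      proof (cases "Suc k = length xs")
        case True
        then have "k = length xs - 1" by simp
        then show ?thesis using True l u xy by (simp add: insert_commute)
      next
        case False
        then show ?thesis using k xs(5)[of k] b by auto
      qed
    qed
    then show False using T by (auto simp: undirected_tree_def)
  qed
qed

text \<open>The map \<open>p\<close> chooses a twin for each tree edge. Tree edges have pairwise
  different end points, so the twins are new and distinct. If they and \<open>F\<close> exhausted
  the arcs, every class of parallel arcs would be \<open>{f, p f}\<close>, and \<open>T\<close>
  would be a colored double tree after all.\<close>

lemma double_tree_leftover:
  assumes T: "test_graph T" and g: "grown_tree T r (verts T) F"
    and nd: "\<not> colored_double_tree T \<gamma>"
    and p: "\<And>f. f \<in> F \<Longrightarrow> p f \<in> arcs T \<and> p f \<noteq> f \<and> ends T (p f) = ends T f \<and> \<gamma> (p f) = \<gamma> f"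
  shows "p ` F \<inter> F = {} \<and> inj_on p F \<and> arcs T - (F \<union> p ` F) \<noteq> {}"
proof (intro conjI)
  interpret fin_digraph T using T by (simp add: test_graph_def)
  note b = grown_tree_basic[OF g]
  have inj: "f = f'" if "f \<in> F" "f' \<in> F" "ends T f = ends T f'" for f f'
    using b that by (auto dest: inj_onD)
  show "p ` F \<inter> F = {}" using p inj by fastforce
  show "inj_on p F" using p inj by (metis inj_onI)
  show "arcs T - (F \<union> p ` F) \<noteq> {}"
  proof
    assume "arcs T - (F \<union> p ` F) = {}"
    then have A: "arcs T = F \<union> p ` F" using b p by auto
    have pe: "ends T ` arcs T = ends T ` F" unfolding A image_Un image_image using p by auto
    have cls: "{e \<in> arcs T. ends T e = ends T f} = {f, p f}" if "f \<in> F" for f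
    proof (intro equalityI subsetI)
      fix x assume "x \<in> {e \<in> arcs T. ends T e = ends T f}"
      then have x: "x \<in> F \<union> p ` F" "ends T x = ends T f" using A by auto
      then obtain g where g: "g \<in> F" "x = g \<or> x = p g" by blast
      then have "ends T g = ends T f" using x(2) p[OF g(1)] by metis
      then have "g = f" using inj[OF g(1) that] by simp
      then show "x \<in> {f, p f}" using g(2) by blast
    next
      fix x assume "x \<in> {f, p f}"
      then show "x \<in> {e \<in> arcs T. ends T e = ends T f}" using b p[OF that] that by auto
    qed
    have "colored_double_tree T \<gamma>"
      unfolding colored_double_tree_def pe
    proof (intro conjI ballI impI)
      show "undirected_tree (verts T) (ends T ` F)"
        unfolding undirected_tree_def
      proof (intro conjI ballI)
        show "verts T \<noteq> {}" using b by auto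
        show "u \<subseteq> verts T" "card u = 2" if "u \<in> ends T ` F" for u using b that by auto
        have sym: "sym ({(a, b). {a, b} \<in> ends T ` F}\<^sup>*)"
          by (intro sym_rtrancl) (auto simp: sym_def insert_commute)
        show "(x, y) \<in> {(a, b). {a, b} \<in> ends T ` F}\<^sup>*" if "x \<in> verts T" "y \<in> verts T" for x y
          using grown_tree_reach[OF g that(1)] grown_tree_reach[OF g that(2)] symD[OF sym]
          by (meson rtrancl_trans)
        show "\<nexists>xs. undirected_cycle (ends T ` F) xs" using grown_tree_acyclic[OF g] by auto
      qed
      show "card {e \<in> arcs T. ends T e = u} = 2" if "u \<in> ends T ` F" for u
      proof -
        from that obtain f where "f \<in> F" "u = ends T f" by auto
        then show ?thesis using cls[of f] p[of f] by (metis card_2_iff)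
      qed
      show "\<gamma> e = \<gamma> e'" if "e \<in> arcs T" "e' \<in> arcs T" "ends T e = ends T e'" for e e'
      proof -
        from that(1) pe have "ends T e \<in> ends T ` F" by blast
        then obtain f where f: "f \<in> F" "ends T e = ends T f" by blast
        then have "e \<in> {f, p f}" "e' \<in> {f, p f}" using cls that by auto
        then show ?thesis using p f by auto
      qed
    qed
    with nd show False by simp
  qed
qed

section \<open>Counting injective maps that respect the bands\<close>

text \<open>Translation classes of injective maps into the integers, each represented by the map
  with the root at 0. The constraints run over a parameter \<open>F\<close>, so that both a growing
  tree and the whole of \<open>arcs T\<close> can be inserted.\<close>

definition shapes :: "('v, 'e) pre_digraph \<Rightarrow> 'v \<Rightarrow> ('e \<Rightarrow> nat) \<Rightarrow> 'v set \<Rightarrow> 'e set \<Rightarrow> ('v \<Rightarrow> int) set" where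
  "shapes T r b W F = {\<psi> \<in> W \<rightarrow>\<^sub>E UNIV. \<psi> r = 0 \<and> inj_on \<psi> W \<and>
     (\<forall>f\<in>F. \<bar>\<psi> (head T f) - \<psi> (tail T f)\<bar> \<le> int (b f))}"

lemma shapes_mono: "F \<subseteq> F' \<Longrightarrow> shapes T r b W F' \<subseteq> shapes T r b W F"
  by (auto simp: shapes_def)

text \<open>Extending a shape by a leaf \<open>w\<close> means choosing its position in the window
  around the position of \<open>v\<close>, off the positions already taken. Restriction to
  \<open>W\<close> together with the value at \<open>w\<close> is the inverse.\<close>

lemma bij_betw_shapes_leaf:
  assumes g: "grown_tree T r W F" and e: "e \<in> arcs T" "ends T e = {v, w}" "v \<in> W" "w \<notin> W"
  shows "bij_betw (\<lambda>(\<psi>, k). \<psi>(w := k))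
    (SIGMA \<psi>:shapes T r b W F. {\<psi> v - int (b e)..\<psi> v + int (b e)} - \<psi> ` W)
    (shapes T r b (insert w W) (insert e F))"
proof (rule bij_betwI[where g = "\<lambda>\<psi>. (restrict \<psi> W, \<psi> w)"])
  have r: "r \<in> W" using grown_tree_basic[OF g] by simp
  have sub: "head T f \<in> W \<and> tail T f \<in> W" if "f \<in> F" for f
    using grown_tree_basic[OF g] that by (auto simp: ends_def)
  have ht: "(head T e = v \<and> tail T e = w) \<or> (head T e = w \<and> tail T e = v)"
    using e by (auto simp: ends_def doubleton_eq_iff)
  show "(\<lambda>(\<psi>, k). \<psi>(w := k)) \<in>
    (SIGMA \<psi>:shapes T r b W F. {\<psi> v - int (b e)..\<psi> v + int (b e)} - \<psi> ` W) \<rightarrow>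
    shapes T r b (insert w W) (insert e F)"
  proof (intro funcsetI, clarify)
    fix \<psi> k assume \<psi>: "\<psi> \<in> shapes T r b W F"
      and k: "k \<in> {\<psi> v - int (b e)..\<psi> v + int (b e)}" "k \<notin> \<psi> ` W"
    have "inj_on (\<psi>(w := k)) (insert w W)"
      using \<psi> k e by (auto simp: shapes_def inj_on_def)
    moreover have "\<bar>(\<psi>(w := k)) (head T f) - (\<psi>(w := k)) (tail T f)\<bar> \<le> int (b f)" if "f \<in> insert e F" for f
    proof (cases "f = e")
      case True
      have "v \<noteq> w" using e by auto
      then show ?thesis using ht k True by auto
    next
      case False
      then have "f \<in> F" using that by auto
      then show ?thesis using sub[of f] \<psi> e by (auto simp: shapes_def)
    qed
    ultimately show "\<psi>(w := k) \<in> shapes T r b (insert w W) (insert e F)"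
      using \<psi> r e unfolding shapes_def by (auto simp: PiE_def extensional_def)
  qed
  show "(\<lambda>\<psi>. (restrict \<psi> W, \<psi> w)) \<in> shapes T r b (insert w W) (insert e F) \<rightarrow>
    (SIGMA \<psi>:shapes T r b W F. {\<psi> v - int (b e)..\<psi> v + int (b e)} - \<psi> ` W)"
  proof (intro funcsetI)
    fix \<psi> assume \<psi>: "\<psi> \<in> shapes T r b (insert w W) (insert e F)"
    have "\<bar>\<psi> (head T e) - \<psi> (tail T e)\<bar> \<le> int (b e)" using \<psi> by (simp add: shapes_def)
    then have "\<bar>\<psi> v - \<psi> w\<bar> \<le> int (b e)" using ht by (auto simp: abs_minus_commute)
    moreover have "\<psi> w \<notin> \<psi> ` W" using \<psi> e by (auto simp: shapes_def inj_on_def)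
    moreover have "restrict \<psi> W \<in> shapes T r b W F"
      using \<psi> r sub by (auto simp: shapes_def inj_on_def)
    ultimately show "(restrict \<psi> W, \<psi> w) \<in>
      (SIGMA \<psi>:shapes T r b W F. {\<psi> v - int (b e)..\<psi> v + int (b e)} - \<psi> ` W)"
      using e by (auto simp: abs_le_iff)
  qed
  show "(restrict (case x of (\<psi>, k) \<Rightarrow> \<psi>(w := k)) W, (case x of (\<psi>, k) \<Rightarrow> \<psi>(w := k)) w) = x"
    if "x \<in> (SIGMA \<psi>:shapes T r b W F. {\<psi> v - int (b e)..\<psi> v + int (b e)} - \<psi> ` W)" for x
    using that e by (auto simp: shapes_def PiE_def extensional_def restrict_def fun_eq_iff)
  show "(case (restrict \<psi> W, \<psi> w) of (\<psi>, k) \<Rightarrow> \<psi>(w := k)) = \<psi>"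
    if "\<psi> \<in> shapes T r b (insert w W) (insert e F)" for \<psi>
    using that by (auto simp: shapes_def PiE_def extensional_def restrict_def fun_eq_iff)
qed

lemma card_int_window_diff:
  fixes x :: int
  assumes "finite A"
  shows "card ({x - int m..x + int m} - A) \<le> 2 * m + 1"
    and "2 * m + 1 - card A \<le> card ({x - int m..x + int m} - A)"
proof -
  have c: "card {x - int m..x + int m} = 2 * m + 1" by simp
  show "card ({x - int m..x + int m} - A) \<le> 2 * m + 1"
    using card_mono[of "{x - int m..x + int m}" "{x - int m..x + int m} - A"] c by simp
  show "2 * m + 1 - card A \<le> card ({x - int m..x + int m} - A)"
    using diff_card_le_card_Diff[OF assms, of "{x - int m..x + int m}"] c by simp
qed

text \<open>A new leaf has at most \<open>2 * b e + 1\<close> places, of which at most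
  \<open>card W\<close> are taken. Bounding \<open>card W\<close> by one \<open>N\<close> for all
  steps keeps the lower bound a plain product; where \<open>N\<close> exceeds the window, truncated
  subtraction makes that bound 0.\<close>

lemma card_shapes:
  assumes "grown_tree T r W F"
  shows "finite (shapes T r b W F) \<and> card (shapes T r b W F) \<le> (\<Prod>f\<in>F. 2 * b f + 1) \<and>
    (card W \<le> N \<longrightarrow> (\<Prod>f\<in>F. 2 * b f + 1 - N) \<le> card (shapes T r b W F))"
  using assms
proof induction
  case root
  have "shapes T r b {r} {} = {\<lambda>x\<in>{r}. 0}"
    by (auto simp: shapes_def fun_eq_iff PiE_def extensional_def)
  then show ?case by simp
next
  case (leaf W F e v w)
  note b = grown_tree_basic[OF leaf.hyps(1)]
  have eF: "e \<notin> F" using b leaf.hyps by auto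
  let ?A = "\<lambda>\<psi>. {\<psi> v - int (b e)..\<psi> v + int (b e)} - \<psi> ` W"
  note bij = bij_betw_shapes_leaf[OF leaf.hyps(1-5), of b]
  have fin: "finite (shapes T r b W F)" using leaf.IH by simp
  have fin': "finite (SIGMA \<psi>:shapes T r b W F. ?A \<psi>)" using fin by auto
  have card: "card (shapes T r b (insert w W) (insert e F)) = (\<Sum>\<psi>\<in>shapes T r b W F. card (?A \<psi>))"
    using bij_betw_same_card[OF bij] fin by (simp add: card_SigmaI)
  have A: "card (?A \<psi>) \<le> 2 * b e + 1" "2 * b e + 1 - card W \<le> card (?A \<psi>)"
    if "\<psi> \<in> shapes T r b W F" for \<psi>
  proof -
    have "card (\<psi> ` W) \<le> card W" by (rule card_image_le) (use b in simp)
    then show "card (?A \<psi>) \<le> 2 * b e + 1" "2 * b e + 1 - card W \<le> card (?A \<psi>)"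
      using card_int_window_diff[where A = "\<psi> ` W" and x = "\<psi> v" and m = "b e"] b by auto
  qed
  have "(\<Sum>\<psi>\<in>shapes T r b W F. card (?A \<psi>)) \<le> card (shapes T r b W F) * (2 * b e + 1)"
    using sum_bounded_above[of "shapes T r b W F" "\<lambda>\<psi>. card (?A \<psi>)" "2 * b e + 1", OF A(1)] by simp
  also have "\<dots> \<le> (\<Prod>f\<in>insert e F. 2 * b f + 1)"
  proof -
    have "card (shapes T r b W F) * (2 * b e + 1) \<le> (\<Prod>f\<in>F. 2 * b f + 1) * (2 * b e + 1)"
      using leaf.IH by (intro mult_le_mono1) auto
    moreover have "(\<Prod>f\<in>insert e F. 2 * b f + 1) = (\<Prod>f\<in>F. 2 * b f + 1) * (2 * b e + 1)"
      using b eF by (simp add: mult.commute)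
    ultimately show ?thesis by (simp only:)
  qed
  finally have up: "card (shapes T r b (insert w W) (insert e F)) \<le> (\<Prod>f\<in>insert e F. 2 * b f + 1)"
    using card by simp
  have low: "(\<Prod>f\<in>insert e F. 2 * b f + 1 - N) \<le> card (shapes T r b (insert w W) (insert e F))"
    if N: "card (insert w W) \<le> N"
  proof -
    have cW: "card W \<le> N" using N b leaf.hyps by auto
    have "(\<Prod>f\<in>insert e F. 2 * b f + 1 - N) \<le> card (shapes T r b W F) * (2 * b e + 1 - N)"
    proof -
      have "(\<Prod>f\<in>F. 2 * b f + 1 - N) * (2 * b e + 1 - N) \<le> card (shapes T r b W F) * (2 * b e + 1 - N)"
        using leaf.IH cW by (intro mult_le_mono1) auto
      moreover have "(\<Prod>f\<in>insert e F. 2 * b f + 1 - N) = (\<Prod>f\<in>F. 2 * b f + 1 - N) * (2 * b e + 1 - N)"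
        using b eF by (simp add: mult.commute)
      ultimately show ?thesis by (simp only:)
    qed
    also have "\<dots> \<le> (\<Sum>\<psi>\<in>shapes T r b W F. card (?A \<psi>))"
      using sum_bounded_below[of "shapes T r b W F" "2 * b e + 1 - N" "\<lambda>\<psi>. card (?A \<psi>)",
        OF order_trans[OF diff_le_mono2[OF cW] A(2)]] by simp
    finally show ?thesis using card by simp
  qed
  show ?case using up low bij_betw_finite[OF bij] fin' by auto
qed

text \<open>The tree path from the root uses each tree edge at most once and each step is at most
  its width. This keeps translates of a shape inside \<open>{1..n}\<close> when the root is far from
  both ends.\<close>

lemma shape_bounded:
  assumes "grown_tree T r W F" "\<psi> \<in> shapes T r b W F" "u \<in> W"
  shows "\<bar>\<psi> u\<bar> \<le> int (\<Sum>f\<in>F. b f)"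
  using assms
proof (induction arbitrary: \<psi> u)
  case root
  then show ?case by (auto simp: shapes_def)
next
  case (leaf W F e v w)
  note b = grown_tree_basic[OF leaf.hyps(1)]
  have eF: "e \<notin> F" using b leaf.hyps by auto
  have "\<psi> \<in> (\<lambda>(\<psi>, k). \<psi>(w := k)) `
    (SIGMA \<psi>:shapes T r b W F. {\<psi> v - int (b e)..\<psi> v + int (b e)} - \<psi> ` W)"
    using bij_betw_imp_surj_on[OF bij_betw_shapes_leaf[OF leaf.hyps(1-5), of b]] leaf.prems by simp
  then obtain \<psi>' k where \<psi>': "\<psi>' \<in> shapes T r b W F" "\<psi> = \<psi>'(w := k)"
    "k \<in> {\<psi>' v - int (b e)..\<psi>' v + int (b e)}" by auto
  have "\<bar>\<psi>' x\<bar> \<le> int (\<Sum>f\<in>F. b f)" if "x \<in> W" for x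
    using leaf.IH[OF \<psi>'(1) that] .
  note IH = this
  have s: "int (\<Sum>f\<in>insert e F. b f) = int (b e) + int (\<Sum>f\<in>F. b f)" using eF b by simp
  show ?case
  proof (cases "u = w")
    case True
    then have "\<psi> u = k" using \<psi>' by simp
    then show ?thesis using IH[OF leaf.hyps(4)] \<psi>'(3) s
      by (simp only: abs_le_iff atLeastAtMost_iff) linarith
  next
    case False
    then have "\<psi> u = \<psi>' u" "u \<in> W" using \<psi>' leaf.prems by auto
    then show ?thesis using IH[of u] s by linarith
  qed
qed

section \<open>Maps into the matrix indices, grouped by shape\<close>

definition band_embs :: "('v, 'e) pre_digraph \<Rightarrow> ('e \<Rightarrow> nat) \<Rightarrow> nat \<Rightarrow> ('v \<Rightarrow> nat) set" where
  "band_embs T b n = {\<phi> \<in> verts T \<rightarrow>\<^sub>E {1..n}. inj_on \<phi> (verts T) \<and>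
     (\<forall>e\<in>arcs T. \<bar>int (\<phi> (head T e)) - int (\<phi> (tail T e))\<bar> \<le> int (b e))}"

definition shape_of :: "('v, 'e) pre_digraph \<Rightarrow> 'v \<Rightarrow> ('v \<Rightarrow> nat) \<Rightarrow> 'v \<Rightarrow> int" where
  "shape_of T r \<phi> = (\<lambda>v\<in>verts T. int (\<phi> v) - int (\<phi> r))"

lemma finite_band_embs: "finite (verts T) \<Longrightarrow> finite (band_embs T b n)"
  unfolding band_embs_def by (rule finite_subset[OF _ finite_PiE[of "verts T" "\<lambda>_. {1..n}"]]) auto

lemma shape_of_in_shapes:
  assumes "wf_digraph T" "r \<in> verts T" "\<phi> \<in> band_embs T b n"
  shows "shape_of T r \<phi> \<in> shapes T r b (verts T) (arcs T)"
  using assms wf_digraph.tail_in_verts[OF assms(1)] wf_digraph.head_in_verts[OF assms(1)]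
  by (auto simp: shapes_def shape_of_def band_embs_def inj_on_def)

text \<open>A map is determined by its shape and the position of the root, which gives the upper
  bound. Conversely every root position at distance more than \<open>?D\<close> from 0 and at least
  \<open>?D\<close> from \<open>n\<close> admits the shape.\<close>

lemma card_shape_fibre:
  assumes T: "fin_digraph T" and g: "grown_tree T r (verts T) F"
    and \<psi>: "\<psi> \<in> shapes T r b (verts T) (arcs T)"
  shows "card {\<phi> \<in> band_embs T b n. shape_of T r \<phi> = \<psi>} \<le> n"
    and "n - 2 * (\<Sum>f\<in>F. b f) \<le> card {\<phi> \<in> band_embs T b n. shape_of T r \<phi> = \<psi>}"
proof -
  interpret fin_digraph T by fact
  let ?S = "{\<phi> \<in> band_embs T b n. shape_of T r \<phi> = \<psi>}"
  let ?D = "\<Sum>f\<in>F. b f"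
  have r: "r \<in> verts T" and F: "F \<subseteq> arcs T" using grown_tree_basic[OF g] by auto
  have fin: "finite ?S" using finite_band_embs[of T b n] by simp
  have "inj_on (\<lambda>\<phi>. \<phi> r) ?S"
  proof (rule inj_onI)
    fix \<phi> \<phi>' assume \<phi>: "\<phi> \<in> ?S" "\<phi>' \<in> ?S" "\<phi> r = \<phi>' r"
    then have eq: "shape_of T r \<phi> = shape_of T r \<phi>'" by simp
    show "\<phi> = \<phi>'"
    proof (rule PiE_ext[of _ "verts T" "\<lambda>_. {1..n}"])
      show "\<phi> x = \<phi>' x" if "x \<in> verts T" for x
        using fun_cong[OF eq, of x] that \<phi>(3) by (simp add: shape_of_def)
    qed (use \<phi> in \<open>auto simp: band_embs_def\<close>)
  qed
  moreover have "(\<lambda>\<phi>. \<phi> r) ` ?S \<subseteq> {1..n}" using r by (auto simp: band_embs_def PiE_def Pi_def)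
  ultimately show "card ?S \<le> n" using card_inj_on_le[of "\<lambda>\<phi>. \<phi> r" ?S "{1..n}"] by simp
  have bd: "\<bar>\<psi> u\<bar> \<le> int ?D" if "u \<in> verts T" for u
    by (rule shape_bounded[OF g subsetD[OF shapes_mono[OF F] \<psi>] that])
  have \<psi>0: "\<psi> r = 0" "inj_on \<psi> (verts T)" "\<psi> \<in> extensional (verts T)"
    "\<And>e. e \<in> arcs T \<Longrightarrow> \<bar>\<psi> (head T e) - \<psi> (tail T e)\<bar> \<le> int (b e)"
    using \<psi> by (auto simp: shapes_def PiE_def)
  \<comment> \<open>The translate of \<psi> with its root at \<open>k\<close>. By \<open>bd\<close>
    its values stay in \<open>{1..n}\<close> for \<open>k\<close> between \<open>?D + 1\<close> and
    \<open>n - ?D\<close>.\<close>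
  let ?h = "\<lambda>k::nat. \<lambda>v\<in>verts T. nat (int k + \<psi> v)"
  have nn: "0 < int k + \<psi> v" "int k + \<psi> v \<le> int n" if "k \<in> {?D+1..n - ?D}" "v \<in> verts T" for k v
  proof -
    have "?D + 1 \<le> k" "k + ?D \<le> n" using that(1) by auto
    then have "int ?D + 1 \<le> int k" "int k + int ?D \<le> int n" by linarith+
    then show "0 < int k + \<psi> v" "int k + \<psi> v \<le> int n" using bd[OF that(2)] by linarith+
  qed
  have "?h k \<in> ?S" if k: "k \<in> {?D+1..n - ?D}" for k
  proof -
    have "inj_on (?h k) (verts T)"
    proof (rule inj_onI)
      fix x y assume xy: "x \<in> verts T" "y \<in> verts T" "?h k x = ?h k y"
      then have "\<psi> x = \<psi> y" using nn[OF k xy(1)] nn[OF k xy(2)] by simp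
      then show "x = y" using \<psi>0 xy by (auto dest: inj_onD)
    qed
    moreover have "?h k \<in> verts T \<rightarrow>\<^sub>E {1..n}"
      using nn[OF k] by (auto simp: nat_le_iff Suc_le_eq)
    moreover have "\<bar>int (?h k (head T e)) - int (?h k (tail T e))\<bar> \<le> int (b e)" if "e \<in> arcs T" for e
      using \<psi>0(4)[OF that] nn[OF k] that by (simp add: less_imp_le)
    moreover have "shape_of T r (?h k) = \<psi>"
    proof
      fix x show "shape_of T r (?h k) x = \<psi> x"
        using \<psi>0 r nn[OF k] by (auto simp: shape_of_def extensional_def less_imp_le)
    qed
    ultimately show ?thesis by (simp add: band_embs_def)
  qed
  then have "?h ` {?D+1..n - ?D} \<subseteq> ?S" by blast
  moreover have "inj_on ?h {?D+1..n - ?D}"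
  proof (rule inj_onI)
    fix x y assume "?h x = ?h y"
    then have "?h x r = ?h y r" by simp
    then show "x = y" using r \<psi>0 by simp
  qed
  ultimately have "card {?D+1..n - ?D} \<le> card ?S" using fin card_inj_on_le by blast
  then show "n - 2 * ?D \<le> card ?S" by simp
qed

lemma finite_shapes:
  assumes "grown_tree T r (verts T) F"
  shows "finite (shapes T r b (verts T) (arcs T))"
    and "card (shapes T r b (verts T) (arcs T)) \<le> (\<Prod>f\<in>F. 2 * b f + 1)"
proof -
  have "shapes T r b (verts T) (arcs T) \<subseteq> shapes T r b (verts T) F"
    using grown_tree_basic[OF assms] by (intro shapes_mono) auto
  note sub = this
  have c: "finite (shapes T r b (verts T) F)" "card (shapes T r b (verts T) F) \<le> (\<Prod>f\<in>F. 2 * b f + 1)"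
    using card_shapes[OF assms, of b] by auto
  show "finite (shapes T r b (verts T) (arcs T))" by (rule finite_subset[OF sub c(1)])
  show "card (shapes T r b (verts T) (arcs T)) \<le> (\<Prod>f\<in>F. 2 * b f + 1)"
    by (rule order_trans[OF card_mono[OF c(1) sub] c(2)])
qed

lemma sum_band_embs:
  fixes w :: "('v \<Rightarrow> int) \<Rightarrow> 'a::real_normed_field"
  assumes T: "fin_digraph T" and g: "grown_tree T r (verts T) F"
    and w: "\<And>\<phi>. \<phi> \<in> band_embs T b n \<Longrightarrow> u \<phi> = w (shape_of T r \<phi>)"
  shows "(\<Sum>\<phi>\<in>band_embs T b n. u \<phi>) = (\<Sum>\<psi>\<in>shapes T r b (verts T) (arcs T).
    of_nat (card {\<phi> \<in> band_embs T b n. shape_of T r \<phi> = \<psi>}) * w \<psi>)"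
proof -
  interpret fin_digraph T by fact
  let ?S = "shapes T r b (verts T) (arcs T)"
  have r: "r \<in> verts T" using grown_tree_basic[OF g] by auto
  have "(\<Sum>\<phi>\<in>band_embs T b n. u \<phi>) = (\<Sum>\<psi>\<in>?S. \<Sum>\<phi>\<in>{\<phi> \<in> band_embs T b n. shape_of T r \<phi> = \<psi>}. u \<phi>)"
    using shape_of_in_shapes[OF wf_digraph_axioms r] finite_band_embs[of T b n] finite_shapes[OF g]
    by (intro sum.group[symmetric]) auto
  also have "\<dots> = (\<Sum>\<psi>\<in>?S. \<Sum>\<phi>\<in>{\<phi> \<in> band_embs T b n. shape_of T r \<phi> = \<psi>}. w \<psi>)"
    using w by (intro sum.cong refl) auto
  finally show ?thesis by simp
qed

text \<open>Since \<open>b\<close> does not vary with \<open>n\<close>, the finite set of shapes is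
  fixed, and each shape has between \<open>n - 2 * ?D\<close> and \<open>n\<close> translates; only
  the boundary is lost.\<close>

lemma sum_band_embs_tendsto:
  fixes w :: "('v \<Rightarrow> int) \<Rightarrow> 'a::real_normed_field"
  assumes T: "fin_digraph T" and g: "grown_tree T r (verts T) F"
    and w: "\<And>\<phi> n. \<phi> \<in> band_embs T b n \<Longrightarrow> u n \<phi> = w (shape_of T r \<phi>)"
  shows "(\<lambda>n. (\<Sum>\<phi>\<in>band_embs T b n. u n \<phi>) / of_nat n) \<longlonglongrightarrow> (\<Sum>\<psi>\<in>shapes T r b (verts T) (arcs T). w \<psi>)"
proof -
  let ?D = "\<Sum>f\<in>F. b f"
  have "(\<lambda>n. real (card {\<phi> \<in> band_embs T b n. shape_of T r \<phi> = \<psi>}) / real n) \<longlonglongrightarrow> 1"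
    if \<psi>: "\<psi> \<in> shapes T r b (verts T) (arcs T)" for \<psi>
  proof (rule tendsto_sandwich)
    show "\<forall>\<^sub>F n in sequentially. 1 - 2 * real ?D / real n \<le>
        real (card {\<phi> \<in> band_embs T b n. shape_of T r \<phi> = \<psi>}) / real n"
      using eventually_gt_at_top[of 0]
    proof eventually_elim
      case (elim n)
      have "n \<le> card {\<phi> \<in> band_embs T b n. shape_of T r \<phi> = \<psi>} + 2 * ?D"
        using card_shape_fibre(2)[OF T g \<psi>, of n] by linarith
      then have "real n \<le> real (card {\<phi> \<in> band_embs T b n. shape_of T r \<phi> = \<psi>}) + 2 * real ?D"
        by (metis (mono_tags, lifting) of_nat_add of_nat_le_iff of_nat_mult of_nat_numeral)
      from divide_right_mono[OF this, of "real n"] show ?case using elim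
        by (simp add: add_divide_distrib)
    qed
    show "\<forall>\<^sub>F n in sequentially. real (card {\<phi> \<in> band_embs T b n. shape_of T r \<phi> = \<psi>}) / real n \<le> 1"
      using eventually_gt_at_top[of 0]
      by eventually_elim (use card_shape_fibre(1)[OF T g \<psi>] in simp)
    show "(\<lambda>n. 1 - 2 * real ?D / real n) \<longlonglongrightarrow> 1"
      using tendsto_diff[OF tendsto_const lim_const_over_n[of "2 * real ?D"], of 1] by simp
  qed simp
  then have *: "(\<lambda>n. of_real (real (card {\<phi> \<in> band_embs T b n. shape_of T r \<phi> = \<psi>}) / real n) * w \<psi>)
      \<longlonglongrightarrow> of_real 1 * w \<psi>" if "\<psi> \<in> shapes T r b (verts T) (arcs T)" for \<psi>
    using that by (intro tendsto_intros)
  have "(\<lambda>n. \<Sum>\<psi>\<in>shapes T r b (verts T) (arcs T).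
      of_real (real (card {\<phi> \<in> band_embs T b n. shape_of T r \<phi> = \<psi>}) / real n) * w \<psi>)
    \<longlonglongrightarrow> (\<Sum>\<psi>\<in>shapes T r b (verts T) (arcs T). of_real 1 * w \<psi>)"
    by (intro tendsto_sum *)
  moreover have "(\<Sum>\<phi>\<in>band_embs T b n. u n \<phi>) = (\<Sum>\<psi>\<in>shapes T r b (verts T) (arcs T).
    of_nat (card {\<phi> \<in> band_embs T b n. shape_of T r \<phi> = \<psi>}) * w \<psi>)" for n
    by (rule sum_band_embs[OF T g]) (rule w)
  ultimately show ?thesis
    by (simp add: sum_divide_distrib)
qed

lemma card_band_embs:
  assumes T: "fin_digraph T" and g: "grown_tree T r (verts T) F"
  shows "card (band_embs T b n) \<le> n * card (shapes T r b (verts T) (arcs T))"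
    and "(n - 2 * (\<Sum>f\<in>F. b f)) * card (shapes T r b (verts T) (arcs T)) \<le> card (band_embs T b n)"
proof -
  let ?S = "shapes T r b (verts T) (arcs T)" and ?c = "\<lambda>\<psi>. card {\<phi> \<in> band_embs T b n. shape_of T r \<phi> = \<psi>}"
  have "real (card (band_embs T b n)) = real (\<Sum>\<psi>\<in>?S. ?c \<psi>)"
    using sum_band_embs[OF T g, where u = "\<lambda>_. 1::real" and w = "\<lambda>_. 1" and b = b and n = n] by simp
  then have *: "card (band_embs T b n) = (\<Sum>\<psi>\<in>?S. ?c \<psi>)" by linarith
  show "card (band_embs T b n) \<le> n * card ?S"
    unfolding * using sum_bounded_above[of ?S ?c n] card_shape_fibre(1)[OF T g] by (simp add: mult.commute)
  show "(n - 2 * (\<Sum>f\<in>F. b f)) * card ?S \<le> card (band_embs T b n)"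
    unfolding * using sum_bounded_below[of ?S "n - 2 * (\<Sum>f\<in>F. b f)" ?c] card_shape_fibre(2)[OF T g]
    by (simp add: mult.commute)
qed

section \<open>Moments of products of entries\<close>

text \<open>Independence is given for the upper triangle only. An edge whose image lies below the
  diagonal reads the conjugate of an upper entry, and the flag records which case occurs.\<close>

definition twist :: "bool \<Rightarrow> complex \<Rightarrow> complex" where
  "twist d z = (if d then z else cnj z)"

lemma measurable_twist_prod: "(\<lambda>z. \<Prod>e\<in>A. twist (d e) z) \<in> borel_measurable borel"
proof (intro borel_measurable_continuous_onI continuous_on_prod)
  fix e show "continuous_on UNIV (twist (d e))"
    unfolding twist_def by (cases "d e") (auto intro!: continuous_intros)
qed

text \<open>The product is at most the power of its largest factor; the summand 1 accounts for the
  empty product. This replaces the Hoelder inequality in bounding mixed moments by moments of single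
  entries.\<close>

lemma prod_le_one_plus_sum_powers:
  fixes a :: "'a \<Rightarrow> real"
  assumes "finite A" "\<And>x. x \<in> A \<Longrightarrow> 0 \<le> a x"
  shows "(\<Prod>x\<in>A. a x) \<le> 1 + (\<Sum>x\<in>A. a x ^ card A)"
proof (cases "A = {}")
  case False
  define m where "m = Max (a ` A)"
  have "m \<in> a ` A" unfolding m_def using assms False by (intro Max_in) auto
  then obtain x where x: "x \<in> A" "m = a x" by auto
  have "(\<Prod>x\<in>A. a x) \<le> (\<Prod>x\<in>A. m)"
    using assms by (intro prod_mono) (auto simp: m_def)
  also have "\<dots> = a x ^ card A" using x by simp
  also have "\<dots> \<le> (\<Sum>x\<in>A. a x ^ card A)"
    using assms x by (intro member_le_sum) auto
  finally show ?thesis by simp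
qed simp

section \<open>Factorization of expectations over classes of edges\<close>

definition edge_class :: "('v, 'e) pre_digraph \<Rightarrow> ('e \<Rightarrow> 'i) \<Rightarrow> 'e \<Rightarrow> 'i \<times> 'v set" where
  "edge_class T \<gamma> e = (\<gamma> e, ends T e)"

definition class_arcs :: "('v, 'e) pre_digraph \<Rightarrow> ('e \<Rightarrow> 'i) \<Rightarrow> 'i \<times> 'v set \<Rightarrow> 'e set" where
  "class_arcs T \<gamma> c = {e \<in> arcs T. edge_class T \<gamma> e = c}"

text \<open>One matrix size \<open>n\<close> at a time. The bound \<open>K\<close> is asked only of
  labels occurring in \<open>T\<close>; both settings of the theorem supply one \<open>K\<close>
  that serves all \<open>n\<close>.\<close>

locale wigner_matrix = prob_space M + fin_digraph T
  for M :: "'w measure" and T :: "('v, 'e) pre_digraph" +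
  fixes \<beta> :: "'i \<Rightarrow> real" and X :: "('i, 'w) rmatrices" and n :: nat
    and \<gamma> :: "'e \<Rightarrow> 'i" and K :: "nat \<Rightarrow> real"
  assumes hermitian: "j \<in> {1..n} \<Longrightarrow> k \<in> {1..n} \<Longrightarrow> \<omega> \<in> space M \<Longrightarrow> X i k j \<omega> = cnj (X i j k \<omega>)"
    and indep: "indep_vars (\<lambda>_. borel) (\<lambda>(i, j, k). X i j k) {(i, j, k). 1 \<le> j \<and> j \<le> k \<and> k \<le> n}"
    and centred: "1 \<le> j \<Longrightarrow> j < k \<Longrightarrow> k \<le> n \<Longrightarrow> (\<integral>\<omega>. X i j k \<omega> \<partial>M) = 0"
    and variance_one: "1 \<le> j \<Longrightarrow> j < k \<Longrightarrow> k \<le> n \<Longrightarrow> (\<integral>\<omega>. (cmod (X i j k \<omega>))\<^sup>2 \<partial>M) = 1"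
    and pseudo_variance: "1 \<le> j \<Longrightarrow> j < k \<Longrightarrow> k \<le> n \<Longrightarrow> (\<integral>\<omega>. (X i j k \<omega>)\<^sup>2 \<partial>M) = of_real (\<beta> i)"
    and moments: "e \<in> arcs T \<Longrightarrow> 1 \<le> j \<Longrightarrow> j \<le> k \<Longrightarrow> k \<le> n \<Longrightarrow>
      (\<integral>\<^sup>+\<omega>. ennreal (cmod (X (\<gamma> e) j k \<omega>) ^ l) \<partial>M) \<le> ennreal (K l)"
    and K_nonneg: "0 \<le> K l"
begin

text \<open>The index, in the independent upper triangular family, of the entry that the edge reads
  up to conjugation.\<close>

definition key :: "('v \<Rightarrow> nat) \<Rightarrow> 'e \<Rightarrow> 'i \<times> nat \<times> nat" where
  "key \<phi> e = (\<gamma> e, min (\<phi> (head T e)) (\<phi> (tail T e)), max (\<phi> (head T e)) (\<phi> (tail T e)))"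

definition entry :: "('v \<Rightarrow> nat) \<Rightarrow> 'e \<Rightarrow> 'w \<Rightarrow> complex" where
  "entry \<phi> e \<omega> = X (\<gamma> e) (\<phi> (head T e)) (\<phi> (tail T e)) \<omega>"

lemma measurable_upper:
  assumes "1 \<le> j" "j \<le> k" "k \<le> n"
  shows "X i j k \<in> borel_measurable M"
  using indep assms unfolding indep_vars_def by fastforce

lemma measurable_all:
  assumes "j \<in> {1..n}" "k \<in> {1..n}"
  shows "X i j k \<in> borel_measurable M"
proof (cases "j \<le> k")
  case True
  then show ?thesis using assms by (intro measurable_upper) auto
next
  case False
  then have "X i k j \<in> borel_measurable M" using assms by (intro measurable_upper) auto
  then have "(\<lambda>\<omega>. cnj (X i k j \<omega>)) \<in> borel_measurable M"
    by (rule borel_measurable_continuous_on[rotated]) (auto intro!: continuous_intros)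
  moreover have "X i j k \<omega> = cnj (X i k j \<omega>)" if "\<omega> \<in> space M" for \<omega>
    using hermitian[OF assms(2,1) that] .
  ultimately show ?thesis
    by (simp cong: measurable_cong)
qed

lemma moments_all:
  assumes e: "e \<in> arcs T" and jk: "j \<in> {1..n}" "k \<in> {1..n}"
  shows "(\<integral>\<^sup>+\<omega>. ennreal (cmod (X (\<gamma> e) j k \<omega>) ^ l) \<partial>M) \<le> ennreal (K l)"
proof (cases "j \<le> k")
  case True
  then show ?thesis using moments[OF e] jk by auto
next
  case False
  have "(\<integral>\<^sup>+\<omega>. ennreal (cmod (X (\<gamma> e) j k \<omega>) ^ l) \<partial>M) = (\<integral>\<^sup>+\<omega>. ennreal (cmod (X (\<gamma> e) k j \<omega>) ^ l) \<partial>M)"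
    using hermitian[OF jk(2,1)] by (intro nn_integral_cong) simp
  also have "\<dots> \<le> ennreal (K l)" using moments[OF e] False jk by auto
  finally show ?thesis .
qed

context
  fixes \<phi> :: "'v \<Rightarrow> nat"
  assumes \<phi>: "\<phi> \<in> verts T \<rightarrow> {1..n}"
begin

lemma \<phi>_ends: "e \<in> arcs T \<Longrightarrow> \<phi> (head T e) \<in> {1..n}" "e \<in> arcs T \<Longrightarrow> \<phi> (tail T e) \<in> {1..n}"
  using \<phi> by (auto simp: Pi_iff)

lemma measurable_entry_prod: "A \<subseteq> arcs T \<Longrightarrow> (\<lambda>\<omega>. \<Prod>e\<in>A. entry \<phi> e \<omega>) \<in> borel_measurable M"
  unfolding entry_def by (intro borel_measurable_prod measurable_all \<phi>_ends) auto

text \<open>Only the moment of order \<open>card A\<close> of single entries enters, so the bound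
  depends neither on \<phi> nor on the position of the entries.\<close>

lemma nn_integral_entry_prod:
  assumes A: "A \<subseteq> arcs T"
  shows "(\<integral>\<^sup>+\<omega>. ennreal (cmod (\<Prod>e\<in>A. entry \<phi> e \<omega>)) \<partial>M) \<le> ennreal (1 + real (card A) * K (card A))"
proof -
  have fin: "finite A" using A finite_arcs finite_subset by blast
  have [measurable]: "entry \<phi> e \<in> borel_measurable M" if "e \<in> A" for e
    unfolding entry_def using that A by (intro measurable_all \<phi>_ends) auto
  have "(\<integral>\<^sup>+\<omega>. ennreal (cmod (\<Prod>e\<in>A. entry \<phi> e \<omega>)) \<partial>M) \<le>
    (\<integral>\<^sup>+\<omega>. 1 + (\<Sum>e\<in>A. ennreal (cmod (entry \<phi> e \<omega>) ^ card A)) \<partial>M)"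
  proof (intro nn_integral_mono)
    fix \<omega>
    have "cmod (\<Prod>e\<in>A. entry \<phi> e \<omega>) \<le> 1 + (\<Sum>e\<in>A. cmod (entry \<phi> e \<omega>) ^ card A)"
      unfolding prod_norm[symmetric] by (intro prod_le_one_plus_sum_powers fin) auto
    then have "ennreal (cmod (\<Prod>e\<in>A. entry \<phi> e \<omega>)) \<le> ennreal (1 + (\<Sum>e\<in>A. cmod (entry \<phi> e \<omega>) ^ card A))"
      by (intro ennreal_leI)
    also have "\<dots> = 1 + (\<Sum>e\<in>A. ennreal (cmod (entry \<phi> e \<omega>) ^ card A))"
      by (subst ennreal_plus) (auto intro: sum_nonneg)
    finally show "ennreal (cmod (\<Prod>e\<in>A. entry \<phi> e \<omega>)) \<le> 1 + (\<Sum>e\<in>A. ennreal (cmod (entry \<phi> e \<omega>) ^ card A))" .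
  qed
  also have "\<dots> = 1 + (\<Sum>e\<in>A. \<integral>\<^sup>+\<omega>. ennreal (cmod (entry \<phi> e \<omega>) ^ card A) \<partial>M)"
    by (subst nn_integral_add) (auto simp: nn_integral_sum emeasure_space_1 simp del: sum_ennreal)
  also have "\<dots> \<le> 1 + (\<Sum>e\<in>A. ennreal (K (card A)))"
    using A by (intro add_left_mono sum_mono) (auto simp: entry_def intro!: moments_all \<phi>_ends)
  also have "\<dots> = ennreal (1 + real (card A) * K (card A))"
    using K_nonneg by (subst ennreal_plus) (auto simp: ennreal_mult ennreal_of_nat_eq_real_of_nat)
  finally show ?thesis .
qed

lemma integrable_entry_prod:
  assumes "A \<subseteq> arcs T"
  shows "integrable M (\<lambda>\<omega>. \<Prod>e\<in>A. entry \<phi> e \<omega>)"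
  unfolding integrable_iff_bounded using measurable_entry_prod[OF assms] nn_integral_entry_prod[OF assms]
  by (auto intro: le_less_trans)

lemma norm_entry_prod:
  assumes "A \<subseteq> arcs T"
  shows "cmod (\<integral>\<omega>. (\<Prod>e\<in>A. entry \<phi> e \<omega>) \<partial>M) \<le> 1 + real (card A) * K (card A)"
proof -
  have "ennreal (cmod (\<integral>\<omega>. (\<Prod>e\<in>A. entry \<phi> e \<omega>) \<partial>M)) \<le> ennreal (1 + real (card A) * K (card A))"
    using integral_norm_bound_ennreal[OF integrable_entry_prod[OF assms]] nn_integral_entry_prod[OF assms]
    by (rule order_trans)
  then show ?thesis using K_nonneg by (subst (asm) ennreal_le_iff) auto
qed

lemma entry_eq_twist:
  assumes "e \<in> arcs T" "\<omega> \<in> space M"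
  shows "entry \<phi> e \<omega> = twist (\<phi> (head T e) \<le> \<phi> (tail T e)) ((\<lambda>(i, j, k). X i j k) (key \<phi> e) \<omega>)"
  using hermitian[OF \<phi>_ends(2)[OF assms(1)] \<phi>_ends(1)[OF assms(1)] assms(2)]
  by (auto simp: entry_def twist_def key_def min_def max_def)

text \<open>Minimum and maximum determine the image of the set of end points, and an injective
  \<phi> recovers that set from its image.\<close>

lemma key_eq_iff:
  assumes inj: "inj_on \<phi> (verts T)" and e: "e \<in> arcs T" "e' \<in> arcs T"
  shows "key \<phi> e = key \<phi> e' \<longleftrightarrow> edge_class T \<gamma> e = edge_class T \<gamma> e'"
proof -
  have "\<phi> ` ends T x = {min (\<phi> (head T x)) (\<phi> (tail T x)), max (\<phi> (head T x)) (\<phi> (tail T x))}" for x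
    by (auto simp: ends_def min_def max_def)
  moreover have "ends T e \<subseteq> verts T" "ends T e' \<subseteq> verts T" using e by (auto simp: ends_def)
  moreover have "min (\<phi> (head T x)) (\<phi> (tail T x)) = Min (\<phi> ` ends T x)"
    "max (\<phi> (head T x)) (\<phi> (tail T x)) = Max (\<phi> ` ends T x)" for x
    by (auto simp: ends_def min.commute max.commute)
  ultimately show ?thesis
    using inj_on_image_eq_iff[OF inj, of "ends T e" "ends T e'"]
    unfolding key_def edge_class_def by (metis prod.inject)
qed

text \<open>Edges are grouped by the entry they read; each group is a measurable function of one
  member of the independent family. Re-indexing by edge classes makes the index set of the product
  independent of \<phi>.\<close>

lemma expectation_factorizes:
  assumes inj: "inj_on \<phi> (verts T)"
  shows "(\<integral>\<omega>. (\<Prod>e\<in>arcs T. entry \<phi> e \<omega>) \<partial>M) =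
    (\<Prod>c\<in>edge_class T \<gamma> ` arcs T. \<integral>\<omega>. (\<Prod>e\<in>class_arcs T \<gamma> c. entry \<phi> e \<omega>) \<partial>M)"
proof -
  let ?Y = "\<lambda>j z. \<Prod>e\<in>{e \<in> arcs T. key \<phi> e = j}. twist (\<phi> (head T e) \<le> \<phi> (tail T e)) z"
  let ?X = "\<lambda>(i, j, k). X i j k"
  let ?J = "key \<phi> ` arcs T"
  have "?J \<subseteq> {(i, j, k). 1 \<le> j \<and> j \<le> k \<and> k \<le> n}"
    using \<phi>_ends by (auto simp: key_def)
  then have "indep_vars (\<lambda>_. borel) ?X ?J" by (rule indep_vars_subset[OF indep])
  then have ind: "indep_vars (\<lambda>_. borel) (\<lambda>j \<omega>. ?Y j (?X j \<omega>)) ?J"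
    by (rule indep_vars_compose2) (rule measurable_twist_prod)
  have Y: "?Y j (?X j \<omega>) = (\<Prod>e\<in>{e \<in> arcs T. key \<phi> e = j}. entry \<phi> e \<omega>)" if "\<omega> \<in> space M" for j \<omega>
    using that by (intro prod.cong refl) (auto simp: entry_eq_twist)
  have int: "integrable M (\<lambda>\<omega>. ?Y j (?X j \<omega>))" for j
    using integrable_entry_prod[of "{e \<in> arcs T. key \<phi> e = j}"] Y
    by (subst Bochner_Integration.integrable_cong[OF refl]) auto
  \<comment> \<open>Recovers the key from the edge class: the entry indices are the extreme values
    of \<phi> on the end points.\<close>
  define h where "h c = (fst c, Min (\<phi> ` snd c), Max (\<phi> ` snd c))" for c :: "'i \<times> 'v set"
  have h: "key \<phi> e = h (edge_class T \<gamma> e)" for e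
    by (auto simp: h_def key_def edge_class_def ends_def min.commute max.commute)
  have injh: "inj_on h (edge_class T \<gamma> ` arcs T)"
  proof (rule inj_onI)
    fix c c' assume "c \<in> edge_class T \<gamma> ` arcs T" "c' \<in> edge_class T \<gamma> ` arcs T" "h c = h c'"
    then show "c = c'" using key_eq_iff[OF inj] unfolding h by blast
  qed
  have J: "?J = h ` edge_class T \<gamma> ` arcs T" by (auto simp: h)
  have cls: "{e \<in> arcs T. key \<phi> e = h c} = class_arcs T \<gamma> c" if "c \<in> edge_class T \<gamma> ` arcs T" for c
    using that injh unfolding class_arcs_def h by (auto dest: inj_onD)
  have "(\<integral>\<omega>. (\<Prod>e\<in>arcs T. entry \<phi> e \<omega>) \<partial>M) = (\<integral>\<omega>. (\<Prod>j\<in>?J. ?Y j (?X j \<omega>)) \<partial>M)"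
    by (intro Bochner_Integration.integral_cong refl) (simp add: Y prod.image_gen[symmetric])
  also have "\<dots> = (\<Prod>j\<in>?J. \<integral>\<omega>. ?Y j (?X j \<omega>) \<partial>M)"
    using int by (intro indep_vars_lebesgue_integral ind) auto
  also have "\<dots> = (\<Prod>j\<in>?J. \<integral>\<omega>. (\<Prod>e\<in>{e \<in> arcs T. key \<phi> e = j}. entry \<phi> e \<omega>) \<partial>M)"
    by (intro prod.cong Bochner_Integration.integral_cong refl Y)
  also have "\<dots> = (\<Prod>c\<in>edge_class T \<gamma> ` arcs T. \<integral>\<omega>. (\<Prod>e\<in>{e \<in> arcs T. key \<phi> e = h c}. entry \<phi> e \<omega>) \<partial>M)"
    unfolding J by (subst prod.reindex[OF injh]) simp
  also have "\<dots> = (\<Prod>c\<in>edge_class T \<gamma> ` arcs T. \<integral>\<omega>. (\<Prod>e\<in>class_arcs T \<gamma> c. entry \<phi> e \<omega>) \<partial>M)"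
    by (intro prod.cong refl) (simp only: cls)
  finally show ?thesis .
qed

text \<open>Below the diagonal the integrals are conjugated. The three values 0, \<beta> and 1 are
  real, so they do not depend on the side of the diagonal.\<close>

lemma integral_entry_nonloop:
  assumes inj: "inj_on \<phi> (verts T)" and e: "e \<in> arcs T" "head T e \<noteq> tail T e"
  shows "(\<integral>\<omega>. entry \<phi> e \<omega> \<partial>M) = 0"
    and "(\<integral>\<omega>. entry \<phi> e \<omega> * entry \<phi> e \<omega> \<partial>M) = of_real (\<beta> (\<gamma> e))"
    and "(\<integral>\<omega>. entry \<phi> e \<omega> * cnj (entry \<phi> e \<omega>) \<partial>M) = 1"
proof -
  let ?j = "\<phi> (head T e)" and ?k = "\<phi> (tail T e)"
  have jk: "?j \<in> {1..n}" "?k \<in> {1..n}" "?j \<noteq> ?k"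
    using \<phi>_ends[OF e(1)] e inj by (auto dest: inj_onD)
  have [simp]: "entry \<phi> e \<omega> = X (\<gamma> e) ?j ?k \<omega>" for \<omega> by (simp add: entry_def)
  have lt: "(\<integral>\<omega>. X i j k \<omega> \<partial>M) = 0 \<and> (\<integral>\<omega>. X i j k \<omega> * X i j k \<omega> \<partial>M) = of_real (\<beta> i) \<and>
      (\<integral>\<omega>. X i j k \<omega> * cnj (X i j k \<omega>) \<partial>M) = 1" if "1 \<le> j" "j < k" "k \<le> n" for i j k
  proof -
    have "(\<integral>\<omega>. X i j k \<omega> * cnj (X i j k \<omega>) \<partial>M) = of_real (\<integral>\<omega>. (cmod (X i j k \<omega>))\<^sup>2 \<partial>M)"
      by (subst integral_complex_of_real[symmetric]) (simp only: complex_norm_square)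
    then show ?thesis
      using centred[OF that, of i] pseudo_variance[OF that, of i] variance_one[OF that, of i]
      by (simp add: power2_eq_square)
  qed
  show "(\<integral>\<omega>. entry \<phi> e \<omega> \<partial>M) = 0"
    "(\<integral>\<omega>. entry \<phi> e \<omega> * entry \<phi> e \<omega> \<partial>M) = of_real (\<beta> (\<gamma> e))"
    "(\<integral>\<omega>. entry \<phi> e \<omega> * cnj (entry \<phi> e \<omega>) \<partial>M) = 1"
  proof (atomize (full), cases "?j < ?k")
    case True
    then show "(\<integral>\<omega>. entry \<phi> e \<omega> \<partial>M) = 0 \<and>
      (\<integral>\<omega>. entry \<phi> e \<omega> * entry \<phi> e \<omega> \<partial>M) = of_real (\<beta> (\<gamma> e)) \<and>
      (\<integral>\<omega>. entry \<phi> e \<omega> * cnj (entry \<phi> e \<omega>) \<partial>M) = 1" using lt[of ?j ?k "\<gamma> e"] jk by simp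
  next
    case False
    then have kj: "?k < ?j" using jk by simp
    have x: "entry \<phi> e \<omega> = cnj (X (\<gamma> e) ?k ?j \<omega>)" if "\<omega> \<in> space M" for \<omega>
      using hermitian[OF jk(2,1) that] by simp
    have "(\<integral>\<omega>. entry \<phi> e \<omega> \<partial>M) = (\<integral>\<omega>. cnj (X (\<gamma> e) ?k ?j \<omega>) \<partial>M)"
      by (intro Bochner_Integration.integral_cong refl x)
    moreover have "(\<integral>\<omega>. entry \<phi> e \<omega> * entry \<phi> e \<omega> \<partial>M) = (\<integral>\<omega>. cnj (X (\<gamma> e) ?k ?j \<omega> * X (\<gamma> e) ?k ?j \<omega>) \<partial>M)"
      by (intro Bochner_Integration.integral_cong refl) (simp only: x complex_cnj_mult)
    moreover have "(\<integral>\<omega>. entry \<phi> e \<omega> * cnj (entry \<phi> e \<omega>) \<partial>M) =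
        (\<integral>\<omega>. X (\<gamma> e) ?k ?j \<omega> * cnj (X (\<gamma> e) ?k ?j \<omega>) \<partial>M)"
      by (intro Bochner_Integration.integral_cong refl) (simp only: x complex_cnj_cnj mult.commute)
    ultimately show "(\<integral>\<omega>. entry \<phi> e \<omega> \<partial>M) = 0 \<and>
      (\<integral>\<omega>. entry \<phi> e \<omega> * entry \<phi> e \<omega> \<partial>M) = of_real (\<beta> (\<gamma> e)) \<and>
      (\<integral>\<omega>. entry \<phi> e \<omega> * cnj (entry \<phi> e \<omega>) \<partial>M) = 1"
      using lt[of ?k ?j "\<gamma> e"] jk kj by (simp del: complex_cnj_mult)
  qed
qed

text \<open>The class \<open>{e}\<close> contributes the mean of an off-diagonal entry as a factor.
  Loops are excluded because diagonal entries need not be centred.\<close>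

lemma expectation_zero_if_single:
  assumes inj: "inj_on \<phi> (verts T)" and e: "e \<in> arcs T" "head T e \<noteq> tail T e"
    and single: "\<And>e'. e' \<in> arcs T \<Longrightarrow> edge_class T \<gamma> e' = edge_class T \<gamma> e \<Longrightarrow> e' = e"
  shows "(\<integral>\<omega>. (\<Prod>e\<in>arcs T. entry \<phi> e \<omega>) \<partial>M) = 0"
proof -
  have "class_arcs T \<gamma> (edge_class T \<gamma> e) = {e}"
    using single e by (auto simp: class_arcs_def)
  then have "(\<integral>\<omega>. (\<Prod>e\<in>class_arcs T \<gamma> (edge_class T \<gamma> e). entry \<phi> e \<omega>) \<partial>M) = 0"
    using integral_entry_nonloop(1)[OF inj e] by simp
  then show ?thesis
    unfolding expectation_factorizes[OF inj] using e by (intro prod_zero) auto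
qed

end

text \<open>An arbitrary scaling \<open>s\<close> covers both normalizations at once. A map that
  violates a band at some edge contributes a vanishing product, so only \<open>band_embs\<close>
  remain.\<close>

lemma state_eq:
  "injective_traffic_state M n (\<lambda>i j k \<omega>. of_real (s i) * band b X i j k \<omega>) T \<gamma> =
    of_real (\<Prod>e\<in>arcs T. s (\<gamma> e)) / of_nat n *
    (\<Sum>\<phi>\<in>band_embs T (\<lambda>e. b (\<gamma> e)) n. \<integral>\<omega>. (\<Prod>e\<in>arcs T. entry \<phi> e \<omega>) \<partial>M)"
proof -
  let ?S = "{\<phi>. \<phi> \<in> verts T \<rightarrow>\<^sub>E {1..n} \<and> inj_on \<phi> (verts T)}"
  let ?B = "band_embs T (\<lambda>e. b (\<gamma> e)) n" and ?c = "complex_of_real (\<Prod>e\<in>arcs T. s (\<gamma> e))"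
  have fS: "finite ?S" by (rule finite_subset[OF _ finite_PiE[of "verts T" "\<lambda>_. {1..n}"]]) auto
  have BS: "?B \<subseteq> ?S" by (auto simp: band_embs_def)
  have summand: "(\<Prod>e\<in>arcs T. of_real (s (\<gamma> e)) * band b X (\<gamma> e) (\<phi> (head T e)) (\<phi> (tail T e)) \<omega>) =
      (if \<phi> \<in> ?B then ?c * (\<Prod>e\<in>arcs T. entry \<phi> e \<omega>) else 0)" if \<phi>S: "\<phi> \<in> ?S" for \<phi> \<omega>
  proof (cases "\<phi> \<in> ?B")
    case True
    then have "band b X (\<gamma> e) (\<phi> (head T e)) (\<phi> (tail T e)) \<omega> = entry \<phi> e \<omega>" if "e \<in> arcs T" for e
      using that by (auto simp: band_embs_def band_def entry_def)
    then show ?thesis using True by (simp add: prod.distrib)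
  next
    case False
    then obtain e where "e \<in> arcs T" "\<not> \<bar>int (\<phi> (head T e)) - int (\<phi> (tail T e))\<bar> \<le> int (b (\<gamma> e))"
      using \<phi>S by (auto simp: band_embs_def)
    then have "\<exists>e\<in>arcs T. of_real (s (\<gamma> e)) * band b X (\<gamma> e) (\<phi> (head T e)) (\<phi> (tail T e)) \<omega> = 0"
      by (auto simp: band_def)
    then show ?thesis using False by (auto intro: prod_zero)
  qed
  have "injective_traffic_state M n (\<lambda>i j k \<omega>. of_real (s i) * band b X i j k \<omega>) T \<gamma> =
    (\<integral>\<omega>. 1 / of_nat n * (\<Sum>\<phi>\<in>?S. if \<phi> \<in> ?B then ?c * (\<Prod>e\<in>arcs T. entry \<phi> e \<omega>) else 0) \<partial>M)"
    unfolding injective_traffic_state_def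
    by (intro Bochner_Integration.integral_cong arg_cong2[where f = times] sum.cong refl) (rule summand)
  also have "\<dots> = (\<integral>\<omega>. ?c / of_nat n * (\<Sum>\<phi>\<in>?B. \<Prod>e\<in>arcs T. entry \<phi> e \<omega>) \<partial>M)"
  proof -
    have "(\<Sum>\<phi>\<in>?S. if \<phi> \<in> ?B then ?c * (\<Prod>e\<in>arcs T. entry \<phi> e \<omega>) else 0) =
      ?c * (\<Sum>\<phi>\<in>?B. \<Prod>e\<in>arcs T. entry \<phi> e \<omega>)" for \<omega>
      unfolding sum_distrib_left by (rule sum.mono_neutral_cong_right[OF fS BS]) auto
    then show ?thesis by (simp only: mult.assoc[symmetric]) simp
  qed
  also have "\<dots> = ?c / of_nat n * (\<Sum>\<phi>\<in>?B. \<integral>\<omega>. (\<Prod>e\<in>arcs T. entry \<phi> e \<omega>) \<partial>M)"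
    by (subst integral_mult_right_zero, subst Bochner_Integration.integral_sum)
      (auto intro!: integrable_entry_prod simp: band_embs_def PiE_iff simp del: of_real_prod)
  finally show ?thesis .
qed

lemma norm_state_le:
  "cmod (injective_traffic_state M n (\<lambda>i j k \<omega>. of_real (s i) * band b X i j k \<omega>) T \<gamma>) \<le>
    \<bar>\<Prod>e\<in>arcs T. s (\<gamma> e)\<bar> * (real (card (band_embs T (\<lambda>e. b (\<gamma> e)) n)) / real n) *
    (1 + real (card (arcs T)) * K (card (arcs T)))"
proof -
  let ?B = "band_embs T (\<lambda>e. b (\<gamma> e)) n" and ?C = "1 + real (card (arcs T)) * K (card (arcs T))"
  have "cmod (\<Sum>\<phi>\<in>?B. \<integral>\<omega>. (\<Prod>e\<in>arcs T. entry \<phi> e \<omega>) \<partial>M) \<le> (\<Sum>\<phi>\<in>?B. ?C)"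
    by (intro order_trans[OF norm_sum] sum_mono norm_entry_prod) (auto simp: band_embs_def)
  then have "\<bar>\<Prod>e\<in>arcs T. s (\<gamma> e)\<bar> / real n * cmod (\<Sum>\<phi>\<in>?B. \<integral>\<omega>. (\<Prod>e\<in>arcs T. entry \<phi> e \<omega>) \<partial>M)
    \<le> \<bar>\<Prod>e\<in>arcs T. s (\<gamma> e)\<bar> / real n * (real (card ?B) * ?C)"
    by (intro mult_left_mono) auto
  then show ?thesis
    unfolding state_eq by (simp add: norm_mult norm_divide mult_ac del: of_real_prod)
qed

lemma state_zero_if_single:
  assumes "e \<in> arcs T" "head T e \<noteq> tail T e"
    and "\<And>e'. e' \<in> arcs T \<Longrightarrow> edge_class T \<gamma> e' = edge_class T \<gamma> e \<Longrightarrow> e' = e"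
  shows "injective_traffic_state M n (\<lambda>i j k \<omega>. of_real (s i) * band b X i j k \<omega>) T \<gamma> = 0"
proof -
  have "(\<integral>\<omega>. (\<Prod>e\<in>arcs T. entry \<phi> e \<omega>) \<partial>M) = 0" if "\<phi> \<in> band_embs T (\<lambda>e. b (\<gamma> e)) n" for \<phi>
    using that by (intro expectation_zero_if_single[OF _ _ assms]) (auto simp: band_embs_def)
  then show ?thesis unfolding state_eq by simp
qed

end

section \<open>Twin edges and the exponents in \<sigma>\<close>

definition congruent_class :: "('v, 'e) pre_digraph \<Rightarrow> ('e \<Rightarrow> 'i) \<Rightarrow> 'i \<times> 'v set \<Rightarrow> bool" where
  "congruent_class T \<gamma> c \<longleftrightarrow>
    (\<forall>e\<in>class_arcs T \<gamma> c. \<forall>e'\<in>class_arcs T \<gamma> c. tail T e = tail T e' \<and> head T e = head T e')"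

text \<open>Parallel arcs of a colored double tree share their label, so classes by label and end
  points are the same as classes by end points, and each is a pair of twins.\<close>

lemma double_tree_class:
  assumes T: "colored_double_tree T \<gamma>" and e: "e \<in> arcs T"
  obtains e' where "e' \<in> arcs T" "e' \<noteq> e" "ends T e' = ends T e" "\<gamma> e' = \<gamma> e"
    "class_arcs T \<gamma> (edge_class T \<gamma> e) = {e, e'}"
proof -
  let ?A = "{x \<in> arcs T. ends T x = ends T e}"
  have "card ?A = 2" "e \<in> ?A" using assms by (auto simp: colored_double_tree_def)
  then have "card (?A - {e}) = 1" by simp
  then obtain e' where "?A - {e} = {e'}" by (rule card_1_singletonE)
  then have e': "?A = {e, e'}" "e' \<noteq> e" using \<open>e \<in> ?A\<close> by blast+
  then have "e' \<in> ?A" by blast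
  then have "e' \<in> arcs T" "ends T e' = ends T e" by auto
  moreover have lab: "\<gamma> x = \<gamma> e" if "x \<in> ?A" for x
    using T e that unfolding colored_double_tree_def by blast
  moreover have "class_arcs T \<gamma> (edge_class T \<gamma> e) = ?A"
    unfolding class_arcs_def edge_class_def using lab by blast
  moreover note e'
  ultimately show ?thesis using that[of e'] lab[OF \<open>e' \<in> ?A\<close>] by (simp only: simp_thms)
qed

text \<open>The map \<open>class_arcs\<close> sends a class to its unordered pair of twins,
  bijectively onto the pairs counted by \<open>cong\<close>. This turns the exponents of \<sigma>
  into a product over the index set of \<open>expectation_factorizes\<close>.\<close>

lemma cong_eq_card_classes:
  assumes T: "colored_double_tree T \<gamma>"
  shows "cong T \<gamma> i = card {c \<in> edge_class T \<gamma> ` arcs T. fst c = i \<and> congruent_class T \<gamma> c}"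
proof -
  let ?C = "{c \<in> edge_class T \<gamma> ` arcs T. fst c = i \<and> congruent_class T \<gamma> c}"
  let ?P = "{{e, e'} | e e'. e \<in> arcs T \<and> e' \<in> arcs T \<and> e \<noteq> e' \<and>
     tail T e = tail T e' \<and> head T e = head T e' \<and> \<gamma> e = i \<and> \<gamma> e' = i}"
  have "inj_on (class_arcs T \<gamma>) ?C"
  proof (rule inj_onI)
    fix c c' assume "c \<in> ?C" "class_arcs T \<gamma> c = class_arcs T \<gamma> c'"
    then obtain e where "e \<in> class_arcs T \<gamma> c'" "c = edge_class T \<gamma> e"
      unfolding class_arcs_def by blast
    then show "c = c'" by (simp add: class_arcs_def)
  qed
  then have "card (class_arcs T \<gamma> ` ?C) = card ?C" by (rule card_image)
  moreover have "class_arcs T \<gamma> ` ?C = ?P"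
  proof (intro equalityI subsetI)
    fix p assume "p \<in> class_arcs T \<gamma> ` ?C"
    then obtain e where e: "e \<in> arcs T" "\<gamma> e = i" "congruent_class T \<gamma> (edge_class T \<gamma> e)"
      "p = class_arcs T \<gamma> (edge_class T \<gamma> e)" by (auto simp: edge_class_def)
    from double_tree_class[OF T e(1)] obtain e' where
      e': "e' \<in> arcs T" "e' \<noteq> e" "\<gamma> e' = \<gamma> e" "p = {e, e'}" using e(4) by metis
    have "tail T e = tail T e'" "head T e = head T e'"
      using e(3,4) e'(4) by (auto simp: congruent_class_def)
    then show "p \<in> ?P" unfolding mem_Collect_eq using e(1,2) e' by (intro exI[of _ e] exI[of _ e']) simp
  next
    fix p assume "p \<in> ?P"
    then obtain e e' where e: "p = {e, e'}" "e \<in> arcs T" "e' \<in> arcs T" "e \<noteq> e'"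
      "tail T e = tail T e'" "head T e = head T e'" "\<gamma> e = i" "\<gamma> e' = i" by blast
    from double_tree_class[OF T e(2)] obtain e'' where
      "class_arcs T \<gamma> (edge_class T \<gamma> e) = {e, e''}" by metis
    moreover have "e' \<in> class_arcs T \<gamma> (edge_class T \<gamma> e)"
      using e by (auto simp: class_arcs_def edge_class_def ends_def)
    ultimately have p: "class_arcs T \<gamma> (edge_class T \<gamma> e) = p" using e by auto
    then have "congruent_class T \<gamma> (edge_class T \<gamma> e)" using e by (auto simp: congruent_class_def)
    then have "edge_class T \<gamma> e \<in> ?C" using e by (auto simp: edge_class_def)
    then show "p \<in> class_arcs T \<gamma> ` ?C" using p by blast
  qed
  ultimately show ?thesis unfolding cong_def by (simp only:)
qed

lemma \<sigma>_eq_prod_classes: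
  assumes fin: "finite (arcs T)" and T: "colored_double_tree T \<gamma>"
  shows "\<sigma> \<beta> T \<gamma> = (\<Prod>c\<in>edge_class T \<gamma> ` arcs T.
    if congruent_class T \<gamma> c then of_real (\<beta> (fst c)) else 1)"
proof -
  let ?C = "edge_class T \<gamma> ` arcs T"
  let ?g = "\<lambda>c. if congruent_class T \<gamma> c then complex_of_real (\<beta> (fst c)) else 1"
  have "fst ` ?C = \<gamma> ` arcs T" by (auto simp: edge_class_def image_image)
  then have "(\<Prod>c\<in>?C. ?g c) = (\<Prod>i\<in>\<gamma> ` arcs T. \<Prod>c\<in>{c \<in> ?C. fst c = i}. ?g c)"
    using prod.image_gen[of ?C ?g fst] fin by simp
  also have "\<dots> = (\<Prod>i\<in>\<gamma> ` arcs T. of_real (\<beta> i) ^ cong T \<gamma> i)"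
  proof (intro prod.cong refl)
    fix i
    have "(\<Prod>c\<in>{c \<in> ?C. fst c = i}. ?g c) = (\<Prod>c\<in>{c \<in> ?C. fst c = i}.
        if congruent_class T \<gamma> c then complex_of_real (\<beta> i) else 1)"
      by (intro prod.cong refl) auto
    also have "\<dots> = (\<Prod>c\<in>{c \<in> {c \<in> ?C. fst c = i}. congruent_class T \<gamma> c}. complex_of_real (\<beta> i))"
      using fin by (intro prod.inter_filter[symmetric]) auto
    also have "{c \<in> {c \<in> ?C. fst c = i}. congruent_class T \<gamma> c} = {c \<in> ?C. fst c = i \<and> congruent_class T \<gamma> c}"
      by auto
    also have "(\<Prod>c\<in>\<dots>. complex_of_real (\<beta> i)) = of_real (\<beta> i) ^ cong T \<gamma> i"
      using cong_eq_card_classes[OF T, of i] by simp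
    finally show "(\<Prod>c\<in>{c \<in> ?C. fst c = i}. ?g c) = of_real (\<beta> i) ^ cong T \<gamma> i" .
  qed
  finally show ?thesis using T by (simp add: \<sigma>_def)
qed

text \<open>\<open>\<mu>\<close> is the law of the entries above the diagonal and \<open>\<nu>\<close> that of the diagonal entries: the
  classes of loops are those with a single end point.\<close>

definition shape_weight ::
  "('v, 'e) pre_digraph \<Rightarrow> ('e \<Rightarrow> 'i) \<Rightarrow> ('i \<Rightarrow> complex measure) \<Rightarrow> ('i \<Rightarrow> complex measure) \<Rightarrow>
    ('v \<Rightarrow> int) \<Rightarrow> complex" where
  "shape_weight T \<gamma> \<mu> \<nu> \<psi> = (\<Prod>c\<in>edge_class T \<gamma> ` arcs T.
    \<integral>z. (\<Prod>e\<in>class_arcs T \<gamma> c. twist (\<psi> (head T e) \<le> \<psi> (tail T e)) z)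
      \<partial>(if card (snd c) = 1 then \<nu> (fst c) else \<mu> (fst c)))"

context wigner_matrix
begin

text \<open>Each class is a pair of twins: congruent twins read the same entry and give the second
  moment \<beta>, opposite twins read conjugate entries and give the variance 1.\<close>

lemma expectation_double_tree:
  assumes \<phi>: "\<phi> \<in> verts T \<rightarrow> {1..n}" and inj: "inj_on \<phi> (verts T)" and T: "colored_double_tree T \<gamma>"
  shows "(\<integral>\<omega>. (\<Prod>e\<in>arcs T. entry \<phi> e \<omega>) \<partial>M) = \<sigma> \<beta> T \<gamma>"
  unfolding expectation_factorizes[OF \<phi> inj] \<sigma>_eq_prod_classes[OF finite_arcs T]
proof (intro prod.cong refl)
  fix c assume "c \<in> edge_class T \<gamma> ` arcs T"
  then obtain e where e: "e \<in> arcs T" "c = edge_class T \<gamma> e" by auto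
  from double_tree_class[OF T e(1)] obtain e' where e': "e' \<in> arcs T" "e' \<noteq> e"
    "ends T e' = ends T e" "\<gamma> e' = \<gamma> e" "class_arcs T \<gamma> c = {e, e'}" using e(2) by metis
  have "card (ends T e) = 2" using T e by (auto simp: colored_double_tree_def undirected_tree_def)
  then have nl: "head T e \<noteq> tail T e" by (auto simp: ends_def)
  have fst: "fst c = \<gamma> e" using e by (simp add: edge_class_def)
  have prod: "(\<Prod>e\<in>class_arcs T \<gamma> c. entry \<phi> e \<omega>) = entry \<phi> e \<omega> * entry \<phi> e' \<omega>" for \<omega>
    using e' by auto
  show "(\<integral>\<omega>. (\<Prod>e\<in>class_arcs T \<gamma> c. entry \<phi> e \<omega>) \<partial>M) =
    (if congruent_class T \<gamma> c then of_real (\<beta> (fst c)) else 1)"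
  proof (cases "tail T e = tail T e'")
    case True
    then have "head T e = head T e'" using e'(3) by (auto simp: ends_def doubleton_eq_iff)
    then have "congruent_class T \<gamma> c" "entry \<phi> e' \<omega> = entry \<phi> e \<omega>" for \<omega>
      using True e' by (auto simp: congruent_class_def entry_def)
    then show ?thesis using integral_entry_nonloop(2)[OF \<phi> inj e(1) nl] fst by (simp add: prod)
  next
    case False
    then have sw: "head T e' = tail T e" "tail T e' = head T e"
      using e'(3) by (auto simp: ends_def doubleton_eq_iff)
    have "entry \<phi> e' \<omega> = cnj (entry \<phi> e \<omega>)" if "\<omega> \<in> space M" for \<omega>
      using hermitian[OF \<phi>_ends(1)[OF \<phi> e(1)] \<phi>_ends(2)[OF \<phi> e(1)] that, of "\<gamma> e"] e' sw
      by (simp add: entry_def)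
    then have "(\<integral>\<omega>. entry \<phi> e \<omega> * entry \<phi> e' \<omega> \<partial>M) = (\<integral>\<omega>. entry \<phi> e \<omega> * cnj (entry \<phi> e \<omega>) \<partial>M)"
      by (intro Bochner_Integration.integral_cong refl) simp
    moreover have "\<not> congruent_class T \<gamma> c" using False e' by (auto simp: congruent_class_def)
    ultimately show ?thesis using integral_entry_nonloop(3)[OF \<phi> inj e(1) nl] by (simp add: prod)
  qed
qed

lemma state_double_tree:
  assumes T: "colored_double_tree T \<gamma>"
  shows "injective_traffic_state M n (\<lambda>i j k \<omega>. of_real (s i) * band b X i j k \<omega>) T \<gamma> =
    of_real ((\<Prod>e\<in>arcs T. s (\<gamma> e)) * (real (card (band_embs T (\<lambda>e. b (\<gamma> e)) n)) / real n)) * \<sigma> \<beta> T \<gamma>"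
proof -
  have "(\<integral>\<omega>. (\<Prod>e\<in>arcs T. entry \<phi> e \<omega>) \<partial>M) = \<sigma> \<beta> T \<gamma>"
    if "\<phi> \<in> band_embs T (\<lambda>e. b (\<gamma> e)) n" for \<phi>
    using that by (intro expectation_double_tree T) (auto simp: band_embs_def)
  then show ?thesis unfolding state_eq by (simp add: mult_ac)
qed

text \<open>The map enters only through the order of the end points of each edge, which decides
  conjugation; whether an edge is a loop decides the law. Both survive translation, since the laws
  do not depend on the position of the entry.\<close>

lemma expectation_shape_weight:
  assumes \<phi>: "\<phi> \<in> verts T \<rightarrow> {1..n}" and inj: "inj_on \<phi> (verts T)"
    and \<mu>: "\<And>i j k. 1 \<le> j \<Longrightarrow> j < k \<Longrightarrow> k \<le> n \<Longrightarrow> distr M borel (X i j k) = \<mu> i"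
    and \<nu>: "\<And>i j. 1 \<le> j \<Longrightarrow> j \<le> n \<Longrightarrow> distr M borel (X i j j) = \<nu> i"
  shows "(\<integral>\<omega>. (\<Prod>e\<in>arcs T. entry \<phi> e \<omega>) \<partial>M) = shape_weight T \<gamma> \<mu> \<nu> (shape_of T r \<phi>)"
  unfolding expectation_factorizes[OF \<phi> inj] shape_weight_def
proof (intro prod.cong refl)
  fix c assume "c \<in> edge_class T \<gamma> ` arcs T"
  then obtain e\<^sub>0 where e\<^sub>0: "e\<^sub>0 \<in> arcs T" "c = edge_class T \<gamma> e\<^sub>0" by auto
  obtain i j k where ijk: "key \<phi> e\<^sub>0 = (i, j, k)" by (metis prod_cases3)
  have i: "i = fst c" using ijk e\<^sub>0 by (simp add: key_def edge_class_def)
  have jk: "1 \<le> j" "j \<le> k" "k \<le> n" using ijk \<phi>_ends[OF \<phi> e\<^sub>0(1)] by (auto simp: key_def)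
  have loop: "j = k \<longleftrightarrow> card (snd c) = 1"
  proof -
    have "j = k \<longleftrightarrow> \<phi> (head T e\<^sub>0) = \<phi> (tail T e\<^sub>0)" using ijk by (auto simp: key_def min_def max_def split: if_splits)
    also have "\<dots> \<longleftrightarrow> head T e\<^sub>0 = tail T e\<^sub>0" using inj e\<^sub>0 by (auto dest: inj_onD)
    finally show ?thesis using e\<^sub>0 by (auto simp: edge_class_def ends_def)
  qed
  have X: "X i j k \<in> borel_measurable M" using jk by (rule measurable_upper)
  have law: "(if card (snd c) = 1 then \<nu> (fst c) else \<mu> (fst c)) = distr M borel (X i j k)"
    using loop i jk \<mu>[of j k i] \<nu>[of j i] by auto
  have ent: "entry \<phi> e \<omega> = twist (shape_of T r \<phi> (head T e) \<le> shape_of T r \<phi> (tail T e)) (X i j k \<omega>)"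
    if "e \<in> class_arcs T \<gamma> c" "\<omega> \<in> space M" for e \<omega>
  proof -
    have e: "e \<in> arcs T" "key \<phi> e = (i, j, k)"
      using that key_eq_iff[OF \<phi> inj, of e e\<^sub>0] e\<^sub>0 ijk by (auto simp: class_arcs_def)
    then show ?thesis
      using entry_eq_twist[OF \<phi> e(1) that(2)] by (simp add: shape_of_def)
  qed
  show "(\<integral>\<omega>. (\<Prod>e\<in>class_arcs T \<gamma> c. entry \<phi> e \<omega>) \<partial>M) =
    (\<integral>z. (\<Prod>e\<in>class_arcs T \<gamma> c. twist (shape_of T r \<phi> (head T e) \<le> shape_of T r \<phi> (tail T e)) z)
      \<partial>(if card (snd c) = 1 then \<nu> (fst c) else \<mu> (fst c)))"
    unfolding law integral_distr[OF X measurable_twist_prod]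
    by (intro Bochner_Integration.integral_cong prod.cong refl ent)
qed

end

section \<open>The limiting volume for proportional growth\<close>

text \<open>The interval is open at 0 and closed at 1 so that the ceiling of \<open>n * x\<close>
  runs exactly through \<open>{1..n}\<close>, with cells of length 1/n.\<close>

abbreviation unit_uniform :: "real measure" where
  "unit_uniform \<equiv> restrict_space lborel {0<..1}"

abbreviation unit_cube :: "'v set \<Rightarrow> ('v \<Rightarrow> real) measure" where
  "unit_cube V \<equiv> PiM V (\<lambda>_. unit_uniform)"

text \<open>Injectivity is not imposed: points with coinciding coordinates form a null set.\<close>

definition band_region :: "('v, 'e) pre_digraph \<Rightarrow> ('e \<Rightarrow> real) \<Rightarrow> ('v \<Rightarrow> real) set" where
  "band_region T c = {x \<in> verts T \<rightarrow>\<^sub>E {0<..1}. \<forall>e\<in>arcs T. \<bar>x (head T e) - x (tail T e)\<bar> \<le> c e}"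

definition band_volume :: "('v, 'e) pre_digraph \<Rightarrow> ('e \<Rightarrow> real) \<Rightarrow> real" where
  "band_volume T c = measure (unit_cube (verts T)) (band_region T c)"

lemma prob_space_unit_uniform: "prob_space unit_uniform"
  by (rule prob_spaceI) (simp add: emeasure_restrict_space space_restrict_space)

lemma measure_unit_uniform_cell:
  assumes "1 \<le> k" "k \<le> n"
  shows "{(real k - 1) / real n<..real k / real n} \<in> sets unit_uniform"
    "measure unit_uniform {(real k - 1) / real n<..real k / real n} = 1 / real n"
proof -
  have s: "{(real k - 1) / real n<..real k / real n} \<subseteq> {0<..1}"
  proof
    fix x assume x: "x \<in> {(real k - 1) / real n<..real k / real n}"
    have "0 \<le> (real k - 1) / real n" "real k / real n \<le> 1" using assms by auto
    then show "x \<in> {0<..1}" using x by (auto intro: le_less_trans order_trans)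
  qed
  then show "{(real k - 1) / real n<..real k / real n} \<in> sets unit_uniform"
    by (subst sets_restrict_space_iff) auto
  have le: "(real k - 1) / real n \<le> real k / real n" by (intro divide_right_mono) auto
  show "measure unit_uniform {(real k - 1) / real n<..real k / real n} = 1 / real n"
    using s le by (subst measure_restrict_space) (auto simp: diff_divide_distrib)
qed

locale unit_cube_space =
  fixes V :: "'v set"
  assumes finite_V: "finite V"
begin

sublocale U: prob_space unit_uniform by (rule prob_space_unit_uniform)

sublocale Q: finite_product_prob_space "\<lambda>_. unit_uniform" V
  by standard (rule finite_V)

lemma space_unit_cube: "space (unit_cube V) = V \<rightarrow>\<^sub>E {0<..1}"
  by (simp add: space_PiM space_restrict_space)

lemma measurable_coordinate [measurable]:
  assumes "v \<in> V"
  shows "(\<lambda>x. x v) \<in> borel_measurable (unit_cube V)"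
proof -
  have "(\<lambda>x. x) \<in> measurable unit_uniform borel"
    by (rule measurable_restrict_space1) simp
  from measurable_compose[OF measurable_component_singleton[OF assms] this] show ?thesis by simp
qed

text \<open>Fubini with coordinate \<open>v\<close> integrated first: for given other coordinates a
  single value of \<open>x v\<close> is bad. It serves for \<open>d = 0\<close> (injectivity of the
  rounded map) and for \<open>d\<close> equal to plus or minus a width (boundary of the
  region).\<close>

lemma AE_difference_neq:
  assumes vw: "v \<in> V" "w \<in> V" "v \<noteq> w"
  shows "AE x in unit_cube V. x v - x w \<noteq> d"
proof -
  let ?N = "{x \<in> space (unit_cube V). x v - x w = d}"
  have N: "?N \<in> sets (unit_cube V)" using vw by measurable
  interpret product_sigma_finite "\<lambda>_. unit_uniform" ..
  have V: "V = insert v (V - {v})" using vw by auto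
  have "emeasure (unit_cube V) ?N = (\<integral>\<^sup>+x. indicator ?N x \<partial>unit_cube V)"
    using N by simp
  also have "\<dots> = (\<integral>\<^sup>+x. indicator ?N x \<partial>unit_cube (insert v (V - {v})))"
    using V by simp
  also have "\<dots> = (\<integral>\<^sup>+x. (\<integral>\<^sup>+y. indicator ?N (x(v := y)) \<partial>unit_uniform) \<partial>unit_cube (V - {v}))"
    using finite_V N V by (intro product_nn_integral_insert) auto
  also have "\<dots> = (\<integral>\<^sup>+x. 0 \<partial>unit_cube (V - {v}))"
  proof (intro nn_integral_cong)
    fix x
    have "AE y in unit_uniform. y \<noteq> d + x w"
      by (subst AE_restrict_space_iff) (auto intro: AE_mp[OF AE_lborel_singleton])
    then have "AE y in unit_uniform. indicator ?N (x(v := y)) = (0 :: ennreal)"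
      by eventually_elim (use vw in \<open>auto simp: indicator_def\<close>)
    then show "(\<integral>\<^sup>+y. indicator ?N (x(v := y)) \<partial>unit_uniform) = 0"
      by (subst nn_integral_cong_AE) auto
  qed
  finally have "emeasure (unit_cube V) ?N = 0" by simp
  then have "AE x in unit_cube V. x \<notin> ?N" using N by (intro AE_not_in) (auto simp: null_sets_def)
  moreover have "AE x in unit_cube V. x \<in> space (unit_cube V)" by simp
  ultimately show ?thesis by eventually_elim auto
qed

end

section \<open>From lattice counts to volumes\<close>

definition grid_point :: "'v set \<Rightarrow> nat \<Rightarrow> ('v \<Rightarrow> real) \<Rightarrow> 'v \<Rightarrow> nat" where
  "grid_point V n x = (\<lambda>v\<in>V. nat \<lceil>real n * x v\<rceil>)"

lemma grid_point_eq_iff: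
  assumes n: "0 < n" and x: "0 < t" and k: "1 \<le> k"
  shows "nat \<lceil>real n * t\<rceil> = k \<longleftrightarrow> t \<in> {(real k - 1) / real n<..real k / real n}"
proof -
  have "0 < real n * t" using n x by simp
  then have "nat \<lceil>real n * t\<rceil> = k \<longleftrightarrow> \<lceil>real n * t\<rceil> = int k" by linarith
  also have "\<dots> \<longleftrightarrow> real k - 1 < real n * t \<and> real n * t \<le> real k"
    by (simp add: ceiling_eq_iff)
  finally show ?thesis using n by (simp add: field_simps)
qed

lemma grid_point_tendsto:
  assumes t: "0 < t"
  shows "(\<lambda>n. real (nat \<lceil>real n * t\<rceil>) / real n) \<longlonglongrightarrow> t"
proof (rule tendsto_sandwich)
  show "\<forall>\<^sub>F n in sequentially. t \<le> real (nat \<lceil>real n * t\<rceil>) / real n"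
    using eventually_gt_at_top[of 0]
  proof eventually_elim
    case (elim n)
    have "real n * t \<le> real (nat \<lceil>real n * t\<rceil>)" by linarith
    then show ?case using elim by (simp add: field_simps)
  qed
  show "\<forall>\<^sub>F n in sequentially. real (nat \<lceil>real n * t\<rceil>) / real n \<le> t + 1 / real n"
    using eventually_gt_at_top[of 0]
  proof eventually_elim
    case (elim n)
    have "0 < real n * t" using elim t by simp
    then have "real (nat \<lceil>real n * t\<rceil>) \<le> real n * t + 1" by linarith
    from divide_right_mono[OF this, of "real n"] show ?case using elim by (simp add: add_divide_distrib)
  qed
  show "(\<lambda>n. t + 1 / real n) \<longlonglongrightarrow> t"
    using tendsto_add[OF tendsto_const lim_const_over_n[of 1], of t] by simp
qed simp

text \<open>The points rounded to a given map form a box with all sides 1/n. The boxes of different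
  maps are disjoint, so counting maps amounts to measuring their union.\<close>

lemma card_band_embs_eq_volume:
  assumes T: "fin_digraph T" and n: "0 < n"
  shows "{x \<in> verts T \<rightarrow>\<^sub>E {0<..1}. grid_point (verts T) n x \<in> band_embs T b n} \<in> sets (unit_cube (verts T))"
    and "measure (unit_cube (verts T)) {x \<in> verts T \<rightarrow>\<^sub>E {0<..1}. grid_point (verts T) n x \<in> band_embs T b n} =
      real (card (band_embs T b n)) / real n ^ card (verts T)"
proof -
  interpret fin_digraph T by fact
  interpret unit_cube_space "verts T" by standard simp
  define box where "box \<phi> = (\<Pi>\<^sub>E v\<in>verts T. {(real (\<phi> v) - 1) / real n<..real (\<phi> v) / real n})"
    for \<phi> :: "'a \<Rightarrow> nat"
  let ?A = "{x \<in> verts T \<rightarrow>\<^sub>E {0<..1}. grid_point (verts T) n x \<in> band_embs T b n}"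
  have \<phi>: "1 \<le> \<phi> v" "\<phi> v \<le> n" if "\<phi> \<in> band_embs T b n" "v \<in> verts T" for \<phi> v
    using that by (auto simp: band_embs_def PiE_iff)
  have cell: "{(real (\<phi> v) - 1) / real n<..real (\<phi> v) / real n} \<subseteq> {0<..1}"
    if "\<phi> \<in> band_embs T b n" "v \<in> verts T" for \<phi> v
    using sets.sets_into_space[OF measure_unit_uniform_cell(1)[OF \<phi>[OF that]]]
    by (simp add: space_restrict_space)
  have in_box: "x \<in> box \<phi> \<longleftrightarrow> x \<in> verts T \<rightarrow>\<^sub>E {0<..1} \<and> grid_point (verts T) n x = \<phi>"
    if p: "\<phi> \<in> band_embs T b n" for x \<phi>
  proof
    assume x: "x \<in> box \<phi>"
    have x1: "x \<in> verts T \<rightarrow>\<^sub>E {0<..1}" using x cell[OF p] unfolding box_def PiE_iff by blast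
    have "grid_point (verts T) n x v = \<phi> v" for v
    proof (cases "v \<in> verts T")
      case True
      then show ?thesis
        using x x1 grid_point_eq_iff[OF n _ \<phi>(1)[OF p True], of "x v"]
        by (auto simp: box_def PiE_iff grid_point_def)
    next
      case False
      then show ?thesis using p by (auto simp: grid_point_def band_embs_def PiE_iff extensional_def)
    qed
    then show "x \<in> verts T \<rightarrow>\<^sub>E {0<..1} \<and> grid_point (verts T) n x = \<phi>" using x1 by auto
  next
    assume x: "x \<in> verts T \<rightarrow>\<^sub>E {0<..1} \<and> grid_point (verts T) n x = \<phi>"
    then have g: "nat \<lceil>real n * x v\<rceil> = \<phi> v" if "v \<in> verts T" for v
      using that by (auto simp: grid_point_def)
    have "x v \<in> {(real (\<phi> v) - 1) / real n<..real (\<phi> v) / real n}" if "v \<in> verts T" for v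
      using grid_point_eq_iff[OF n _ \<phi>(1)[OF p that], of "x v"] g[OF that] x that by (auto simp: PiE_iff)
    then show "x \<in> box \<phi>" using x by (auto simp: box_def PiE_iff)
  qed
  have A: "?A = (\<Union>\<phi>\<in>band_embs T b n. box \<phi>)" using in_box by auto
  have fin: "finite (band_embs T b n)" by (intro finite_band_embs) simp
  have box_sets: "box \<phi> \<in> sets (unit_cube (verts T))" if "\<phi> \<in> band_embs T b n" for \<phi>
    unfolding box_def using \<phi>[OF that] by (intro sets_PiM_I_finite measure_unit_uniform_cell) auto
  show "?A \<in> sets (unit_cube (verts T))" unfolding A using fin box_sets by (intro sets.finite_UN) auto
  have "disjoint_family_on box (band_embs T b n)"
    using in_box by (fastforce simp: disjoint_family_on_def)
  then have "measure (unit_cube (verts T)) ?A = (\<Sum>\<phi>\<in>band_embs T b n. measure (unit_cube (verts T)) (box \<phi>))"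
    unfolding A using fin box_sets by (intro Q.finite_measure_finite_Union) auto
  also have "\<dots> = (\<Sum>\<phi>\<in>band_embs T b n. (1 / real n) ^ card (verts T))"
  proof (intro sum.cong refl)
    fix \<phi> assume p: "\<phi> \<in> band_embs T b n"
    have "measure (unit_cube (verts T)) (box \<phi>) =
        (\<Prod>v\<in>verts T. measure unit_uniform {(real (\<phi> v) - 1) / real n<..real (\<phi> v) / real n})"
      unfolding box_def using \<phi>[OF p] by (intro Q.prob_times measure_unit_uniform_cell) auto
    also have "\<dots> = (\<Prod>v\<in>verts T. 1 / real n)"
      using \<phi>[OF p] by (intro prod.cong refl measure_unit_uniform_cell) auto
    finally show "measure (unit_cube (verts T)) (box \<phi>) = (1 / real n) ^ card (verts T)" by simp
  qed
  finally show "measure (unit_cube (verts T)) ?A = real (card (band_embs T b n)) / real n ^ card (verts T)"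
    by (simp add: power_one_over divide_simps)
qed

lemma band_region_measurable:
  assumes "fin_digraph T"
  shows "band_region T c \<in> sets (unit_cube (verts T))"
proof -
  interpret fin_digraph T by fact
  interpret unit_cube_space "verts T" by standard simp
  have "{x \<in> space (unit_cube (verts T)). \<forall>e\<in>arcs T. \<bar>x (head T e) - x (tail T e)\<bar> \<le> c e} \<in> sets (unit_cube (verts T))"
  proof (rule sets.sets_Collect_finite_All)
    fix e assume "e \<in> arcs T"
    then have [measurable]: "(\<lambda>x. x (head T e)) \<in> borel_measurable (unit_cube (verts T))"
      "(\<lambda>x. x (tail T e)) \<in> borel_measurable (unit_cube (verts T))"
      by (intro measurable_coordinate head_in_verts tail_in_verts; assumption)+
    show "{x \<in> space (unit_cube (verts T)). \<bar>x (head T e) - x (tail T e)\<bar> \<le> c e} \<in> sets (unit_cube (verts T))"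
      by measurable
  qed (simp_all)
  then show ?thesis by (simp add: band_region_def space_unit_cube)
qed

text \<open>The normalized counts are integrals of indicators on one fixed cube, so dominated
  convergence with the bound 1 applies. Pointwise convergence can fail only where two coordinates
  agree or a difference equals a width; since edges join distinct vertices, this is a null
  set.\<close>

lemma card_band_embs_tendsto:
  assumes T: "fin_digraph T" and nl: "\<And>e. e \<in> arcs T \<Longrightarrow> head T e \<noteq> tail T e"
    and b: "\<And>e. e \<in> arcs T \<Longrightarrow> (\<lambda>n. real (b n e) / real n) \<longlonglongrightarrow> c e"
  shows "(\<lambda>n. real (card (band_embs T (b n) n)) / real n ^ card (verts T)) \<longlonglongrightarrow> band_volume T c"
proof -
  interpret fin_digraph T by fact
  interpret unit_cube_space "verts T" by standard simp
  let ?Q = "unit_cube (verts T)"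
  define A where "A n = {x \<in> verts T \<rightarrow>\<^sub>E {0<..1}. grid_point (verts T) n x \<in> band_embs T (b n) n}" for n
  have A_sets: "A n \<in> sets ?Q" if "0 < n" for n
    unfolding A_def by (rule card_band_embs_eq_volume(1)[OF T that])
  let ?g = "\<lambda>n t. real (nat \<lceil>real n * t\<rceil>)"
  have conv: "(\<lambda>n. indicator (A (Suc n)) x) \<longlonglongrightarrow> (indicator (band_region T c) x :: real)"
    if x: "x \<in> verts T \<rightarrow>\<^sub>E {0<..1}"
      and dist: "\<forall>v\<in>verts T. \<forall>w\<in>verts T. v \<noteq> w \<longrightarrow> x v - x w \<noteq> 0"
      and edge: "\<forall>e\<in>arcs T. x (head T e) - x (tail T e) \<noteq> c e \<and> x (head T e) - x (tail T e) \<noteq> - c e" for x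
  proof -
    have x0: "0 < x v" "x v \<le> 1" if "v \<in> verts T" for v using x that by (auto simp: PiE_iff)
    have diff: "(\<lambda>n. (?g n (x v) - ?g n (x w)) / real n) \<longlonglongrightarrow> x v - x w"
      if "v \<in> verts T" "w \<in> verts T" for v w
      unfolding diff_divide_distrib by (intro tendsto_diff grid_point_tendsto x0 that)
    have ge1: "nat \<lceil>real n * x v\<rceil> \<in> {1..n}" if "v \<in> verts T" "0 < n" for v n
    proof -
      have "0 < real n * x v" "real n * x v \<le> real n" using x0[OF that(1)] that(2) by auto
      then show ?thesis by (auto simp: nat_le_iff ceiling_le_iff Suc_le_eq)
    qed
    have inj: "\<forall>\<^sub>F n in sequentially. inj_on (grid_point (verts T) n x) (verts T)"
    proof -
      have "\<forall>\<^sub>F n in sequentially. \<forall>v\<in>verts T. \<forall>w\<in>verts T. v \<noteq> w \<longrightarrow> ?g n (x v) \<noteq> ?g n (x w)"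
      proof (intro eventually_ball_finite ballI finite_verts)
        fix v w assume vw: "v \<in> verts T" "w \<in> verts T"
        show "\<forall>\<^sub>F n in sequentially. v \<noteq> w \<longrightarrow> ?g n (x v) \<noteq> ?g n (x w)"
        proof (cases "v = w")
          case False
          then have "x v - x w \<noteq> 0" using dist vw by blast
          from tendsto_imp_eventually_ne[OF diff[OF vw] this] show ?thesis
            by eventually_elim auto
        qed simp
      qed
      then show ?thesis
        by eventually_elim (auto simp: inj_on_def grid_point_def)
    qed
    have edges: "\<forall>\<^sub>F n in sequentially. \<forall>e\<in>arcs T.
      \<bar>int (grid_point (verts T) n x (head T e)) - int (grid_point (verts T) n x (tail T e))\<bar> \<le> int (b n e) \<longleftrightarrow>
      \<bar>x (head T e) - x (tail T e)\<bar> \<le> c e"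
    proof (intro eventually_ball_finite ballI finite_arcs)
      fix e assume e: "e \<in> arcs T"
      then have ht: "head T e \<in> verts T" "tail T e \<in> verts T" by auto
      \<comment> \<open>The slack in the band constraint of \<open>e\<close>, scaled by 1/n. Off the
        null set its limit is nonzero, so its sign is eventually that of the limit.\<close>
      let ?d = "\<lambda>n. real (b n e) / real n - \<bar>(?g n (x (head T e)) - ?g n (x (tail T e))) / real n\<bar>"
      have lim: "?d \<longlonglongrightarrow> c e - \<bar>x (head T e) - x (tail T e)\<bar>"
        by (intro tendsto_diff tendsto_rabs diff b e ht)
      have ne: "c e - \<bar>x (head T e) - x (tail T e)\<bar> \<noteq> 0"
        using edge e by (auto simp: abs_if split: if_splits)
      have d: "\<bar>int (grid_point (verts T) n x (head T e)) - int (grid_point (verts T) n x (tail T e))\<bar> \<le> int (b n e)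
        \<longleftrightarrow> 0 \<le> ?d n" if "0 < n" for n
      proof -
        have "?d n = (real (b n e) - \<bar>?g n (x (head T e)) - ?g n (x (tail T e))\<bar>) / real n"
          by (simp add: abs_divide diff_divide_distrib[where a = "real (b n e)"])
        then have "0 \<le> ?d n \<longleftrightarrow> \<bar>?g n (x (head T e)) - ?g n (x (tail T e))\<bar> \<le> real (b n e)"
          using that by (simp add: zero_le_divide_iff)
        also have "\<dots> \<longleftrightarrow> \<bar>int (nat \<lceil>real n * x (head T e)\<rceil>) - int (nat \<lceil>real n * x (tail T e)\<rceil>)\<bar> \<le> int (b n e)"
          by linarith
        finally show ?thesis using ht by (simp add: grid_point_def)
      qed
      show "\<forall>\<^sub>F n in sequentially.
        \<bar>int (grid_point (verts T) n x (head T e)) - int (grid_point (verts T) n x (tail T e))\<bar> \<le> int (b n e) \<longleftrightarrow>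
        \<bar>x (head T e) - x (tail T e)\<bar> \<le> c e"
      proof (cases "\<bar>x (head T e) - x (tail T e)\<bar> \<le> c e")
        case True
        then have "0 < c e - \<bar>x (head T e) - x (tail T e)\<bar>" using ne by simp
        from order_tendstoD(1)[OF lim this] eventually_gt_at_top[of 0] show ?thesis
          by eventually_elim (use d True in auto)
      next
        case False
        then have "c e - \<bar>x (head T e) - x (tail T e)\<bar> < 0" by simp
        from order_tendstoD(2)[OF lim this] eventually_gt_at_top[of 0] show ?thesis
          by eventually_elim (use d False in auto)
      qed
    qed
    have "\<forall>\<^sub>F n in sequentially. indicator (A n) x = (indicator (band_region T c) x :: real)"
      using inj edges eventually_gt_at_top[of 0]
    proof eventually_elim
      case (elim n)
      have "grid_point (verts T) n x \<in> verts T \<rightarrow>\<^sub>E {1..n}"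
        using ge1[OF _ elim(3)] by (auto simp: grid_point_def)
      then have "x \<in> A n \<longleftrightarrow> x \<in> band_region T c"
        using elim(1,2) x by (simp add: A_def band_region_def band_embs_def)
      then show ?case by (simp add: indicator_def)
    qed
    then have "\<forall>\<^sub>F n in sequentially. indicator (A (Suc n)) x = (indicator (band_region T c) x :: real)"
      by (subst eventually_sequentially_Suc)
    then show ?thesis by (rule tendsto_eventually)
  qed
  have ae1: "AE x in ?Q. \<forall>v\<in>verts T. \<forall>w\<in>verts T. v \<noteq> w \<longrightarrow> x v - x w \<noteq> 0"
    using AE_difference_neq by (intro AE_finite_allI finite_verts) (auto simp del: eq_iff_diff_eq_0[symmetric])
  have ae2: "AE x in ?Q. \<forall>e\<in>arcs T. x (head T e) - x (tail T e) \<noteq> c e \<and> x (head T e) - x (tail T e) \<noteq> - c e"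
    using AE_difference_neq nl by (intro AE_finite_allI finite_arcs AE_conjI) auto
  have ae3: "AE x in ?Q. x \<in> verts T \<rightarrow>\<^sub>E {0<..1}"
    using AE_space[of ?Q] by (simp only: space_unit_cube)
  \<comment> \<open>\<open>A_sets\<close> speaks of positive indices, hence the shift to
    \<open>Suc n\<close>; it is undone at the end.\<close>
  have "(\<lambda>n. \<integral>x. indicator (A (Suc n)) x \<partial>?Q) \<longlonglongrightarrow> (\<integral>x. (indicator (band_region T c) x :: real) \<partial>?Q)"
  proof (rule integral_dominated_convergence[where w = "\<lambda>_. 1"])
    show "(indicator (band_region T c) :: _ \<Rightarrow> real) \<in> borel_measurable ?Q"
      using band_region_measurable[OF T] by simp
    show "(indicator (A (Suc n)) :: _ \<Rightarrow> real) \<in> borel_measurable ?Q" for n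
      using A_sets by simp
    show "AE x in ?Q. (\<lambda>n. indicator (A (Suc n)) x) \<longlonglongrightarrow> (indicator (band_region T c) x :: real)"
      using ae1 ae2 ae3 by eventually_elim (rule conv)
  qed (auto simp: indicator_def)
  then have "(\<lambda>n. measure ?Q (A (Suc n))) \<longlonglongrightarrow> band_volume T c"
    using A_sets band_region_measurable[OF T]
    by (simp add: band_volume_def Q.emeasure_eq_measure)
  moreover have "measure ?Q (A (Suc n)) = real (card (band_embs T (b (Suc n)) (Suc n))) / real (Suc n) ^ card (verts T)" for n
    unfolding A_def by (rule card_band_embs_eq_volume(2)[OF T]) simp
  ultimately have "(\<lambda>n. real (card (band_embs T (b (Suc n)) (Suc n))) / real (Suc n) ^ card (verts T)) \<longlonglongrightarrow> band_volume T c"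
    by simp
  then show ?thesis by (rule LIMSEQ_imp_Suc)
qed

text \<open>The small cube of side \<open>m\<close> at the origin lies in the region, since its
  coordinates differ by less than \<open>m\<close>. This suffices for widths near 1.\<close>

lemma band_volume_ge_power:
  assumes T: "fin_digraph T" and m: "0 < m" "m \<le> 1" and c: "\<And>e. e \<in> arcs T \<Longrightarrow> m \<le> c e"
  shows "m ^ card (verts T) \<le> band_volume T c"
proof -
  interpret fin_digraph T by fact
  interpret unit_cube_space "verts T" by standard simp
  have s: "{0<..m} \<in> sets unit_uniform" using m by (subst sets_restrict_space_iff) auto
  have "measure unit_uniform {0<..m} = m" using m by (subst measure_restrict_space) auto
  then have "m ^ card (verts T) = measure (unit_cube (verts T)) (\<Pi>\<^sub>E v\<in>verts T. {0<..m})"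
    using s by (subst Q.prob_times) auto
  also have "\<dots> \<le> band_volume T c"
    unfolding band_volume_def
  proof (intro Q.finite_measure_mono band_region_measurable[OF T] subsetI)
    fix x assume x: "x \<in> (\<Pi>\<^sub>E v\<in>verts T. {0<..m})"
    have "\<bar>x (head T e) - x (tail T e)\<bar> \<le> c e" if "e \<in> arcs T" for e
    proof -
      have "x (head T e) \<in> {0<..m}" "x (tail T e) \<in> {0<..m}"
        using x that by (auto simp: PiE_iff)
      then show ?thesis using c[OF that] by (auto simp: abs_le_iff)
    qed
    then show "x \<in> band_region T c" using x m by (auto simp: band_region_def PiE_iff intro: order_trans)
  qed
  finally show ?thesis .
qed

lemma band_volume_le_1:
  assumes "fin_digraph T"
  shows "band_volume T c \<le> 1"
proof -
  interpret fin_digraph T by fact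
  interpret unit_cube_space "verts T" by standard simp
  show ?thesis unfolding band_volume_def by (rule Q.prob_le_1)
qed

section \<open>Colored double trees and all other test graphs\<close>

text \<open>Only tree edges are tested for a twin with the same label. A tree edge is never a loop,
  so one without a twin kills the expectation; if all have twins,
  \<open>double_tree_leftover\<close> provides a surplus arc.\<close>

lemma non_double_tree_cases:
  assumes T: "test_graph T" and g: "grown_tree T r (verts T) F" and nd: "\<not> colored_double_tree T \<gamma>"
  obtains (single) e where "e \<in> arcs T" "head T e \<noteq> tail T e"
      "\<And>e'. e' \<in> arcs T \<Longrightarrow> edge_class T \<gamma> e' = edge_class T \<gamma> e \<Longrightarrow> e' = e"
  | (leftover) p where "\<And>f. f \<in> F \<Longrightarrow> p f \<in> arcs T \<and> \<gamma> (p f) = \<gamma> f" "p ` F \<inter> F = {}"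
      "inj_on p F" "arcs T - (F \<union> p ` F) \<noteq> {}"
proof (cases "\<exists>f\<in>F. \<forall>e'\<in>arcs T. edge_class T \<gamma> e' = edge_class T \<gamma> f \<longrightarrow> e' = f")
  case True
  then obtain f where f: "f \<in> F" "\<And>e'. e' \<in> arcs T \<Longrightarrow> edge_class T \<gamma> e' = edge_class T \<gamma> f \<Longrightarrow> e' = f"
    by blast
  have "f \<in> arcs T" "card (ends T f) = 2" using grown_tree_basic[OF g] f by auto
  then have "f \<in> arcs T" "head T f \<noteq> tail T f" by (auto simp: ends_def)
  then show ?thesis using single f(2) by blast
next
  case False
  then have "\<forall>f\<in>F. \<exists>e. e \<in> arcs T \<and> e \<noteq> f \<and> ends T e = ends T f \<and> \<gamma> e = \<gamma> f"
    by (auto simp: edge_class_def)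
  then obtain p where p: "\<And>f. f \<in> F \<Longrightarrow> p f \<in> arcs T \<and> p f \<noteq> f \<and> ends T (p f) = ends T f \<and> \<gamma> (p f) = \<gamma> f"
    by metis
  from double_tree_leftover[OF T g nd p] show ?thesis
    using p by (intro leftover[of p]) auto
qed

text \<open>Both twins are charged to their tree edge, which turns the exponents -1/2 of the
  normalization into -1.\<close>

lemma double_tree_prod:
  fixes h :: "'i \<Rightarrow> 'a::comm_monoid_mult"
  assumes T: "colored_double_tree T \<gamma>" "finite (arcs T)" and g: "grown_tree T r (verts T) F"
  shows "(\<Prod>e\<in>arcs T. h (\<gamma> e)) = (\<Prod>f\<in>F. h (\<gamma> f) ^ 2)"
proof -
  have cov: "ends T ` arcs T = ends T ` F"
    using T double_tree_ends_covered[OF _ g] unfolding colored_double_tree_def by blast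
  note b = grown_tree_basic[OF g]
  have "(\<Prod>e\<in>arcs T. h (\<gamma> e)) = (\<Prod>u\<in>ends T ` F. \<Prod>e\<in>{e \<in> arcs T. ends T e = u}. h (\<gamma> e))"
    using prod.image_gen[OF T(2), of "\<lambda>e. h (\<gamma> e)" "ends T"] cov by simp
  also have "\<dots> = (\<Prod>f\<in>F. \<Prod>e\<in>{e \<in> arcs T. ends T e = ends T f}. h (\<gamma> e))"
    using b by (subst prod.reindex) auto
  also have "\<dots> = (\<Prod>f\<in>F. h (\<gamma> f) ^ 2)"
  proof (intro prod.cong refl)
    fix f assume "f \<in> F"
    then have f: "f \<in> arcs T" using b by auto
    have "(\<Prod>e\<in>{e \<in> arcs T. ends T e = ends T f}. h (\<gamma> e)) = (\<Prod>e\<in>{e \<in> arcs T. ends T e = ends T f}. h (\<gamma> f))"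
    proof (intro prod.cong refl)
      fix e assume "e \<in> {e \<in> arcs T. ends T e = ends T f}"
      then have "\<gamma> e = \<gamma> f" using T(1) f unfolding colored_double_tree_def by blast
      then show "h (\<gamma> e) = h (\<gamma> f)" by simp
    qed
    also have "\<dots> = h (\<gamma> f) ^ 2" proof -
      have "card {e \<in> arcs T. ends T e = ends T f} = 2"
        using T(1) f unfolding colored_double_tree_def by blast
      then show ?thesis by simp
    qed
    finally show "(\<Prod>e\<in>{e \<in> arcs T. ends T e = ends T f}. h (\<gamma> e)) = h (\<gamma> f) ^ 2" .
  qed
  finally show ?thesis .
qed

lemma double_tree_covered_by_tree:
  assumes T: "colored_double_tree T \<gamma>" and g: "grown_tree T r (verts T) F" and e: "e \<in> arcs T"
  obtains f where "f \<in> F" "ends T f = ends T e" "\<gamma> f = \<gamma> e"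
proof -
  have "ends T ` arcs T = ends T ` F"
    using T double_tree_ends_covered[OF _ g] unfolding colored_double_tree_def by blast
  then have "ends T e \<in> ends T ` F" using e by blast
  then obtain f where f: "f \<in> F" "ends T e = ends T f" by blast
  then have "f \<in> arcs T" using grown_tree_basic[OF g] by blast
  then have "\<gamma> f = \<gamma> e" using T e f unfolding colored_double_tree_def by blast
  with f that show ?thesis by simp
qed

text \<open>The constraint of an arc is the one already imposed by the parallel tree edge of the
  same width, so the lower bound for \<open>F\<close> holds for all arcs.\<close>

lemma shapes_covered:
  assumes g: "grown_tree T r (verts T) F"
    and cov: "\<And>e. e \<in> arcs T \<Longrightarrow> \<exists>f\<in>F. ends T f = ends T e \<and> b f = b e"
  shows "shapes T r b (verts T) (arcs T) = shapes T r b (verts T) F"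
proof
  show "shapes T r b (verts T) (arcs T) \<subseteq> shapes T r b (verts T) F"
    using grown_tree_basic[OF g] by (intro shapes_mono) simp
  show "shapes T r b (verts T) F \<subseteq> shapes T r b (verts T) (arcs T)"
  proof
    fix \<psi> assume \<psi>: "\<psi> \<in> shapes T r b (verts T) F"
    have "\<bar>\<psi> (head T e) - \<psi> (tail T e)\<bar> \<le> int (b e)" if "e \<in> arcs T" for e
    proof -
      from cov[OF that] obtain f where f: "f \<in> F" "ends T f = ends T e" "b f = b e" by blast
      have "\<bar>\<psi> (head T f) - \<psi> (tail T f)\<bar> \<le> int (b e)" using \<psi> f by (auto simp: shapes_def)
      then show ?thesis using f(2) by (auto simp: ends_def doubleton_eq_iff abs_minus_commute)
    qed
    then show "\<psi> \<in> shapes T r b (verts T) (arcs T)" using \<psi> by (simp add: shapes_def)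
  qed
qed

lemma card_shapes_ge:
  assumes g: "grown_tree T r (verts T) F"
    and cov: "\<And>e. e \<in> arcs T \<Longrightarrow> \<exists>f\<in>F. ends T f = ends T e \<and> b f = b e"
  shows "(\<Prod>f\<in>F. 2 * b f + 1 - card (verts T)) \<le> card (shapes T r b (verts T) (arcs T))"
  using card_shapes[OF g, of b "card (verts T)"] shapes_covered[OF g cov] by simp

section \<open>Two-sided bounds for the limiting volume\<close>

lemma tendsto_real_nat_diff:
  assumes "(\<lambda>n. real (x n) / real n) \<longlonglongrightarrow> a" "(\<lambda>n. real (y n) / real n) \<longlonglongrightarrow> d"
  shows "(\<lambda>n. real (x n - y n) / real n) \<longlonglongrightarrow> max 0 (a - d)"
proof -
  have "real (x n - y n) / real n = max 0 (real (x n) / real n - real (y n) / real n)" for n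
  proof (cases "y n \<le> x n")
    case True
    then have "real (y n) / real n \<le> real (x n) / real n" by (intro divide_right_mono) auto
    then show ?thesis using True by (simp add: of_nat_diff diff_divide_distrib)
  next
    case False
    then have "real (x n) / real n \<le> real (y n) / real n" by (intro divide_right_mono) auto
    then show ?thesis using False by simp
  qed
  then show ?thesis using assms by (auto intro!: tendsto_intros)
qed

lemma nat_floor_over_tendsto:
  assumes "0 \<le> c"
  shows "(\<lambda>n. real (nat \<lfloor>c * real n\<rfloor>) / real n) \<longlonglongrightarrow> c"
proof (rule tendsto_sandwich)
  show "\<forall>\<^sub>F n in sequentially. c - 1 / real n \<le> real (nat \<lfloor>c * real n\<rfloor>) / real n"
    using eventually_gt_at_top[of 0]
  proof eventually_elim
    case (elim n)
    have "c * real n - 1 \<le> real (nat \<lfloor>c * real n\<rfloor>)" by linarith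
    from divide_right_mono[OF this, of "real n"] show ?case using elim by (simp add: diff_divide_distrib)
  qed
  show "\<forall>\<^sub>F n in sequentially. real (nat \<lfloor>c * real n\<rfloor>) / real n \<le> c"
    using eventually_gt_at_top[of 0]
  proof eventually_elim
    case (elim n)
    have "0 \<le> c * real n" using assms by simp
    then have "real (nat \<lfloor>c * real n\<rfloor>) \<le> c * real n" by linarith
    then show ?case using elim by (simp add: field_simps)
  qed
  show "(\<lambda>n. c - 1 / real n) \<longlonglongrightarrow> c"
    using tendsto_diff[OF tendsto_const lim_const_over_n[of 1], of c] by simp
qed simp

text \<open>The volume depends on \<open>c\<close> alone, so it is computed along one convenient
  choice of widths, and the leaf counts pass to the limit without any integration. The factor 1 - 2
  * sum is the proportion of root positions from which no shape can leave \<open>{1..n}\<close>;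
  \<open>max 0\<close> is the trace of truncated subtraction.\<close>

lemma band_volume_bounds:
  assumes T: "fin_digraph T" and g: "grown_tree T r (verts T) F"
    and cov: "\<And>e. e \<in> arcs T \<Longrightarrow> \<exists>f\<in>F. ends T f = ends T e \<and> c f = c e"
    and c: "\<And>e. 0 \<le> c e"
  shows "band_volume T c \<le> (\<Prod>f\<in>F. 2 * c f)"
    and "max 0 (1 - 2 * (\<Sum>f\<in>F. c f)) * (\<Prod>f\<in>F. 2 * c f) \<le> band_volume T c"
proof -
  note bas = grown_tree_basic[OF g]
  define b where "b n e = nat \<lfloor>c e * real n\<rfloor>" for n e
  have b: "(\<lambda>n. real (b n e) / real n) \<longlonglongrightarrow> c e" for e
    unfolding b_def by (rule nat_floor_over_tendsto[OF c])
  have cov': "\<exists>f\<in>F. ends T f = ends T e \<and> b n f = b n e" if "e \<in> arcs T" for e n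
    using cov[OF that] by (auto simp: b_def)
  have nl: "head T e \<noteq> tail T e" if "e \<in> arcs T" for e
  proof -
    from cov[OF that] obtain f where f: "f \<in> F" "ends T f = ends T e" by blast
    then have "card (ends T e) = 2" using bas by auto
    then show ?thesis by (auto simp: ends_def)
  qed
  have lim: "(\<lambda>n. real (card (band_embs T (b n) n)) / real n ^ card (verts T)) \<longlonglongrightarrow> band_volume T c"
    by (rule card_band_embs_tendsto[OF T nl b])
  \<comment> \<open>Distributes the normalization: one factor \<open>n\<close> for the root, one for
    each tree edge.\<close>
  have V: "real n ^ card (verts T) = real n * (\<Prod>f\<in>F. real n)" for n
    using bas by simp
  have one: "(\<lambda>n. real n / real n) \<longlonglongrightarrow> 1"
    by (rule tendsto_eventually) (auto simp: eventually_at_top_dense intro!: exI[of _ 0])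
  have w: "(\<lambda>n. real (2 * b n e + 1) / real n) \<longlonglongrightarrow> 2 * c e" for e
  proof -
    have "(\<lambda>n. 2 * (real (b n e) / real n) + 1 / real n) \<longlonglongrightarrow> 2 * c e + 0"
      by (intro tendsto_intros b lim_const_over_n)
    then show ?thesis by (simp add: add_divide_distrib add.commute)
  qed
  show "band_volume T c \<le> (\<Prod>f\<in>F. 2 * c f)"
  proof (rule LIMSEQ_le[OF lim])
    show "(\<lambda>n. \<Prod>f\<in>F. real (2 * b n f + 1) / real n) \<longlonglongrightarrow> (\<Prod>f\<in>F. 2 * c f)"
      by (intro tendsto_prod w)
    have "real (card (band_embs T (b n) n)) / real n ^ card (verts T) \<le> (\<Prod>f\<in>F. real (2 * b n f + 1) / real n)"
      if n: "1 \<le> n" for n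
    proof -
      have "card (band_embs T (b n) n) \<le> n * (\<Prod>f\<in>F. 2 * b n f + 1)"
        using card_band_embs(1)[OF T g, of "b n" n] finite_shapes(2)[OF g, of "b n"]
        by (meson mult_le_mono2 order_trans)
      then have "real (card (band_embs T (b n) n)) \<le> real (n * (\<Prod>f\<in>F. 2 * b n f + 1))"
        by (simp only: of_nat_le_iff)
      then have "real (card (band_embs T (b n) n)) / real n ^ card (verts T) \<le>
          real (n * (\<Prod>f\<in>F. 2 * b n f + 1)) / real n ^ card (verts T)"
        by (intro divide_right_mono) auto
      also have "\<dots> = (\<Prod>f\<in>F. real (2 * b n f + 1) / real n)"
        unfolding V prod_dividef of_nat_mult of_nat_prod using n by simp
      finally show ?thesis .
    qed
    then show "\<exists>N. \<forall>n\<ge>N. real (card (band_embs T (b n) n)) / real n ^ card (verts T) \<le>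
        (\<Prod>f\<in>F. real (2 * b n f + 1) / real n)" by blast
  qed
  let ?N = "card (verts T)"
  show "max 0 (1 - 2 * (\<Sum>f\<in>F. c f)) * (\<Prod>f\<in>F. 2 * c f) \<le> band_volume T c"
  proof (rule LIMSEQ_le[OF _ lim])
    have s: "(\<lambda>n. real (2 * (\<Sum>f\<in>F. b n f)) / real n) \<longlonglongrightarrow> 2 * (\<Sum>f\<in>F. c f)"
    proof -
      have "(\<lambda>n. 2 * (\<Sum>f\<in>F. real (b n f) / real n)) \<longlonglongrightarrow> 2 * (\<Sum>f\<in>F. c f)"
        by (intro tendsto_intros b)
      moreover have "real (2 * (\<Sum>f\<in>F. b n f)) / real n = 2 * (\<Sum>f\<in>F. real (b n f) / real n)" for n
        by (simp add: sum_divide_distrib[symmetric])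
      ultimately show ?thesis by (simp only:)
    qed
    \<comment> \<open>Positions already taken cost at most the constant \<open>?N\<close>, which
      disappears after division by \<open>n\<close>.\<close>
    have "(\<lambda>n. real (2 * b n f + 1 - ?N) / real n) \<longlonglongrightarrow> max 0 (2 * c f - 0)" for f
      by (rule tendsto_real_nat_diff[OF w lim_const_over_n])
    then have w': "(\<lambda>n. real (2 * b n f + 1 - ?N) / real n) \<longlonglongrightarrow> 2 * c f" for f
      using c by (simp add: max_def)
    show "(\<lambda>n. real (n - 2 * (\<Sum>f\<in>F. b n f)) / real n * (\<Prod>f\<in>F. real (2 * b n f + 1 - ?N) / real n))
      \<longlonglongrightarrow> max 0 (1 - 2 * (\<Sum>f\<in>F. c f)) * (\<Prod>f\<in>F. 2 * c f)"
      by (intro tendsto_mult tendsto_prod tendsto_real_nat_diff one s w')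
    have "real (n - 2 * (\<Sum>f\<in>F. b n f)) / real n * (\<Prod>f\<in>F. real (2 * b n f + 1 - ?N) / real n) \<le>
        real (card (band_embs T (b n) n)) / real n ^ card (verts T)" for n
    proof -
      have "(n - 2 * (\<Sum>f\<in>F. b n f)) * (\<Prod>f\<in>F. 2 * b n f + 1 - ?N) \<le> card (band_embs T (b n) n)"
        using card_band_embs(2)[OF T g, of n "b n"] card_shapes_ge[OF g cov', of n]
        by (meson mult_le_mono2 order_trans)
      then have "real ((n - 2 * (\<Sum>f\<in>F. b n f)) * (\<Prod>f\<in>F. 2 * b n f + 1 - ?N)) \<le> real (card (band_embs T (b n) n))"
        by (simp only: of_nat_le_iff)
      then have "real ((n - 2 * (\<Sum>f\<in>F. b n f)) * (\<Prod>f\<in>F. 2 * b n f + 1 - ?N)) / real n ^ card (verts T) \<le>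
          real (card (band_embs T (b n) n)) / real n ^ card (verts T)"
        by (intro divide_right_mono) auto
      then show ?thesis
        unfolding V prod_dividef of_nat_mult of_nat_prod by (simp add: times_divide_times_eq)
    qed
    then show "\<exists>N. \<forall>n\<ge>N. real (n - 2 * (\<Sum>f\<in>F. b n f)) / real n * (\<Prod>f\<in>F. real (2 * b n f + 1 - ?N) / real n) \<le>
        real (card (band_embs T (b n) n)) / real n ^ card (verts T)" by blast
  qed
qed

section \<open>Limits in the matrix size and in the band width\<close>

lemma wigner_imp_wigner_matrix:
  assumes T: "fin_digraph T" and w: "wigner \<beta> P X"
    and K: "\<And>e j k l. e \<in> arcs T \<Longrightarrow> 1 \<le> j \<Longrightarrow> j \<le> k \<Longrightarrow> k \<le> n \<Longrightarrow>
      (\<integral>\<^sup>+\<omega>. ennreal (cmod (X n (\<gamma> e) j k \<omega>) ^ l) \<partial>P n) \<le> ennreal (K l)"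
    and K0: "\<And>l. 0 \<le> K l"
  shows "wigner_matrix (P n) T \<beta> (X n) n \<gamma> K"
proof -
  have P: "prob_space (P n)" using w by (simp add: wigner_def)
  show ?thesis
    by (intro wigner_matrix.intro wigner_matrix_axioms.intro P T K K0)
       (use w in \<open>unfold wigner_def, blast\<close>)+
qed

text \<open>The labels occurring in \<open>T\<close> form a finite set, so the uniform supremum over
  that set is one bound for all sizes and positions.\<close>

lemma uniformly_controlled_moments_bound:
  assumes u: "uniformly_controlled_moments P X" and fin: "finite (arcs T)"
  obtains K where "\<And>l::nat. (0::real) \<le> K l"
    "\<And>n e j k l. e \<in> arcs T \<Longrightarrow> 1 \<le> j \<Longrightarrow> j \<le> k \<Longrightarrow> k \<le> n \<Longrightarrow>
      (\<integral>\<^sup>+\<omega>. ennreal (cmod (X n (\<gamma> e) j k \<omega>) ^ l) \<partial>P n) \<le> ennreal (K l)"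
proof -
  define S where "S l = (SUP n. SUP i\<in>\<gamma> ` arcs T. SUP (j, k)\<in>{(j, k). 1 \<le> j \<and> j \<le> k \<and> k \<le> n}.
    \<integral>\<^sup>+\<omega>. ennreal (cmod (X n i j k \<omega>) ^ l) \<partial>P n)" for l
  have S: "S l < \<infinity>" for l
    using u fin unfolding uniformly_controlled_moments_def S_def by blast
  show ?thesis
  proof (rule that[of "\<lambda>l. enn2real (S l)"])
    fix n :: nat and e and j k l :: nat assume "e \<in> arcs T" "1 \<le> j" "j \<le> k" "k \<le> n"
    then have "(\<integral>\<^sup>+\<omega>. ennreal (cmod (X n (\<gamma> e) j k \<omega>) ^ l) \<partial>P n) \<le> S l"
      unfolding S_def
      by (intro SUP_upper2[of n UNIV] SUP_upper2[of "\<gamma> e" "\<gamma> ` arcs T"]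
          SUP_upper2[of "(j, k)" "{(j, k). 1 \<le> j \<and> j \<le> k \<and> k \<le> n}"]) auto
    then show "(\<integral>\<^sup>+\<omega>. ennreal (cmod (X n (\<gamma> e) j k \<omega>) ^ l) \<partial>P n) \<le> ennreal (enn2real (S l))"
      using S[of l] by (simp add: less_top)
  qed simp
qed

text \<open>The finitely many laws involved do not change with \<open>n\<close> or the position, so
  the sum of their moments is a common bound.\<close>

lemma entry_laws_moment_bound:
  assumes w: "wigner \<beta> P X" and E: "entry_laws P X \<mu> \<nu>" and fin: "finite (arcs T)"
    and fm: "\<And>i. finite_moments (\<mu> i)" "\<And>i. finite_moments (\<nu> i)"
  obtains K where "\<And>l::nat. (0::real) \<le> K l"
    "\<And>n e j k l. e \<in> arcs T \<Longrightarrow> 1 \<le> j \<Longrightarrow> j \<le> k \<Longrightarrow> k \<le> n \<Longrightarrow>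
      (\<integral>\<^sup>+\<omega>. ennreal (cmod (X n (\<gamma> e) j k \<omega>) ^ l) \<partial>P n) \<le> ennreal (K l)"
proof -
  define S where "S l = (\<Sum>i\<in>\<gamma> ` arcs T. (\<integral>\<^sup>+z. ennreal (cmod z ^ l) \<partial>\<mu> i) + (\<integral>\<^sup>+z. ennreal (cmod z ^ l) \<partial>\<nu> i))" for l
  have S: "S l < \<infinity>" for l
    using fm fin by (auto simp: S_def finite_moments_def less_top)
  show ?thesis
  proof (rule that[of "\<lambda>l. enn2real (S l)"])
    fix n :: nat and e and j k l :: nat assume e: "e \<in> arcs T" and jk: "1 \<le> j" "j \<le> k" "k \<le> n"
    let ?N = "if j = k then \<nu> (\<gamma> e) else \<mu> (\<gamma> e)"
    have P: "prob_space (P n)" using w by (simp add: wigner_def)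
    have "prob_space.indep_vars (P n) (\<lambda>_. borel) (\<lambda>(i, j, k). X n i j k)
       {(i, j, k). 1 \<le> j \<and> j \<le> k \<and> k \<le> n}" using w by (simp add: wigner_def)
    then have X: "X n (\<gamma> e) j k \<in> borel_measurable (P n)"
      using jk unfolding prob_space.indep_vars_def[OF P] by fastforce
    have N: "?N = distr (P n) borel (X n (\<gamma> e) j k)"
      using E jk by (auto simp: entry_laws_def)
    have "(\<integral>\<^sup>+\<omega>. ennreal (cmod (X n (\<gamma> e) j k \<omega>) ^ l) \<partial>P n) = (\<integral>\<^sup>+z. ennreal (cmod z ^ l) \<partial>?N)"
      unfolding N by (subst nn_integral_distr[OF X]) auto
    also have "\<dots> \<le> (\<integral>\<^sup>+z. ennreal (cmod z ^ l) \<partial>\<mu> (\<gamma> e)) + (\<integral>\<^sup>+z. ennreal (cmod z ^ l) \<partial>\<nu> (\<gamma> e))"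
      by (auto simp: add_increasing add_increasing2)
    also have "\<dots> \<le> S l" unfolding S_def using e fin by (intro member_le_sum) auto
    finally show "(\<integral>\<^sup>+\<omega>. ennreal (cmod (X n (\<gamma> e) j k \<omega>) ^ l) \<partial>P n) \<le> ennreal (enn2real (S l))"
      using S[of l] by (simp add: less_top)
  qed simp
qed

lemma theta_proportional_eq:
  "theta_proportional c b n X =
    (\<lambda>i j k \<omega>. of_real ((2 * c i - (c i)\<^sup>2) powr (- 1 / 2) * real n powr (- 1 / 2)) * band b X i j k \<omega>)"
  by (intro ext) (simp add: theta_proportional_def)

lemma theta_fixed_eq:
  "theta_fixed b X = (\<lambda>i j k \<omega>. of_real ((2 * real (b i) + 1) powr (- 1 / 2)) * band b X i j k \<omega>)"
  by (intro ext) (simp add: theta_fixed_def)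

lemma powr_neg_half_squared:
  assumes "0 < (x::real)"
  shows "(x powr (- 1 / 2)) ^ 2 = 1 / x"
  using assms by (simp add: power2_eq_square powr_add[symmetric] powr_minus_divide)

lemma card_band_embs_le_power:
  assumes "finite (verts T)"
  shows "card (band_embs T b n) \<le> n ^ card (verts T)"
proof -
  have "card (band_embs T b n) \<le> card (verts T \<rightarrow>\<^sub>E {1..n})"
    by (intro card_mono finite_PiE assms) (auto simp: band_embs_def)
  then show ?thesis using assms by (simp add: card_PiE)
qed

section \<open>Proportional growth\<close>

text \<open>The witness for the limit: one factor 1/(2c-c^2) per pair of twins, times the volume of
  admissible positions. Neither the integer widths nor the model occur in it.\<close>

definition proportional_limit ::
  "('i \<Rightarrow> real) \<Rightarrow> ('v, 'e) pre_digraph \<Rightarrow> 'e set \<Rightarrow> ('e \<Rightarrow> 'i) \<Rightarrow> ('i \<Rightarrow> real) \<Rightarrow> complex" where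
  "proportional_limit \<beta> T F \<gamma> c = (if colored_double_tree T \<gamma>
     then of_real ((\<Prod>f\<in>F. 1 / (2 * c (\<gamma> f) - (c (\<gamma> f))\<^sup>2)) * band_volume T (\<lambda>e. c (\<gamma> e))) * \<sigma> \<beta> T \<gamma> else 0)"

lemma double_tree_no_loops:
  assumes "colored_double_tree T \<gamma>" "e \<in> arcs T"
  shows "head T e \<noteq> tail T e"
proof -
  have "card (ends T e) = 2"
    using assms unfolding colored_double_tree_def undirected_tree_def by blast
  then show ?thesis by (auto simp: ends_def)
qed

lemma tendsto_proportional_limit:
  assumes T: "test_graph T" and g: "grown_tree T r (verts T) F"
    and c: "\<And>i. 0 < c i \<and> c i < 1" and w: "wigner \<beta> P X" and u: "uniformly_controlled_moments P X"
    and b: "\<And>i. (\<lambda>n. real (b n i) / real n) \<longlonglongrightarrow> c i"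
  shows "(\<lambda>n. injective_traffic_state (P n) n (theta_proportional c (b n) n (X n)) T \<gamma>)
    \<longlonglongrightarrow> proportional_limit \<beta> T F \<gamma> c"
proof -
  interpret fin_digraph T using T by (simp add: test_graph_def)
  note bas = grown_tree_basic[OF g]
  from uniformly_controlled_moments_bound[OF u finite_arcs] obtain K where
    K: "\<And>l::nat. (0::real) \<le> K l" "\<And>n e j k l. e \<in> arcs T \<Longrightarrow> 1 \<le> j \<Longrightarrow> j \<le> k \<Longrightarrow> k \<le> n \<Longrightarrow>
      (\<integral>\<^sup>+\<omega>. ennreal (cmod (X n (\<gamma> e) j k \<omega>) ^ l) \<partial>P n) \<le> ennreal (K l)" by blast
  have W: "wigner_matrix (P n) T \<beta> (X n) n \<gamma> K" for n
    by (rule wigner_imp_wigner_matrix[OF fin_digraph_axioms w K(2,1)])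
  have c2: "0 < 2 * c i - (c i)\<^sup>2" for i
    using c[of i] by (simp add: power2_eq_square flip: left_diff_distrib)
  define s where "s n i = (2 * c i - (c i)\<^sup>2) powr (- 1 / 2) * real n powr (- 1 / 2)" for n i
  have s2: "s n i ^ 2 = 1 / (2 * c i - (c i)\<^sup>2) / real n" if "0 < n" for n i
    using that powr_neg_half_squared[OF c2[of i]] powr_neg_half_squared[of "real n"]
    by (simp add: s_def power_mult_distrib)
  let ?B = "\<lambda>n. band_embs T (\<lambda>e. b n (\<gamma> e)) n"
  have V: "real n ^ card (verts T) = real n * real n ^ card F" for n
    using bas by simp
  show ?thesis
  proof (cases "colored_double_tree T \<gamma>")
    case True
    let ?A = "\<Prod>f\<in>F. 1 / (2 * c (\<gamma> f) - (c (\<gamma> f))\<^sup>2)"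
    have "(\<lambda>n. real (card (?B n)) / real n ^ card (verts T)) \<longlonglongrightarrow> band_volume T (\<lambda>e. c (\<gamma> e))"
      using double_tree_no_loops[OF True] b by (intro card_band_embs_tendsto) (auto intro: fin_digraph_axioms)
    then have lim: "(\<lambda>n. of_real (?A * (real (card (?B n)) / real n ^ card (verts T))) * \<sigma> \<beta> T \<gamma>)
        \<longlonglongrightarrow> proportional_limit \<beta> T F \<gamma> c"
      unfolding proportional_limit_def if_P[OF True] by (intro tendsto_intros)
    have eq: "injective_traffic_state (P n) n (theta_proportional c (b n) n (X n)) T \<gamma> =
      of_real (?A * (real (card (?B n)) / real n ^ card (verts T))) * \<sigma> \<beta> T \<gamma>" if n: "0 < n" for n
    proof -
      have "(\<Prod>e\<in>arcs T. s n (\<gamma> e)) = ?A / real n ^ card F"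
        unfolding double_tree_prod[OF True finite_arcs g] by (simp add: s2[OF n] prod_dividef prod.distrib)
      then have "(\<Prod>e\<in>arcs T. s n (\<gamma> e)) * (real (card (?B n)) / real n) =
          ?A * (real (card (?B n)) / real n ^ card (verts T))"
        unfolding V by simp
      then show ?thesis
        unfolding theta_proportional_eq s_def[symmetric] wigner_matrix.state_double_tree[OF W True] by simp
    qed
    have "\<forall>\<^sub>F n in sequentially. of_real (?A * (real (card (?B n)) / real n ^ card (verts T))) * \<sigma> \<beta> T \<gamma> =
        injective_traffic_state (P n) n (theta_proportional c (b n) n (X n)) T \<gamma>"
      by (rule eventually_mono[OF eventually_gt_at_top[of 0]]) (rule eq[symmetric])
    with lim show ?thesis by (rule Lim_transform_eventually)
  next
    case False
    then have L0: "proportional_limit \<beta> T F \<gamma> c = 0" by (simp add: proportional_limit_def)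
    from T g False show ?thesis
    proof (cases rule: non_double_tree_cases)
      case (single e)
      have "injective_traffic_state (P n) n (theta_proportional c (b n) n (X n)) T \<gamma> = 0" for n
        unfolding theta_proportional_eq by (rule wigner_matrix.state_zero_if_single[OF W single(1,2)]) (rule single(3))
      then show ?thesis by (simp add: L0)
    next
      case (leftover p)
      have "2 * card F < card (arcs T)"
      proof -
        have "card (F \<union> p ` F) = 2 * card F"
          using leftover bas by (subst card_Un_disjoint) (auto simp: card_image Int_commute)
        moreover have "F \<union> p ` F \<subset> arcs T" using leftover bas by auto
        ultimately show ?thesis using psubset_card_mono[OF finite_arcs] by metis
      qed
      define C where "C = 1 + real (card (arcs T)) * K (card (arcs T))"
      define A where "A = (\<Prod>e\<in>arcs T. (2 * c (\<gamma> e) - (c (\<gamma> e))\<^sup>2) powr (- 1 / 2))"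
      have C: "0 \<le> C" using K(1) by (simp add: C_def)
      have A: "0 \<le> A" by (auto simp: A_def intro: prod_nonneg)
      have bound: "cmod (injective_traffic_state (P n) n (theta_proportional c (b n) n (X n)) T \<gamma>) \<le>
          A * C * real n powr (- 1 / 2)" if n: "1 \<le> n" for n
      proof -
        let ?t = "real n powr (- 1 / 2)"
        have t: "0 \<le> ?t" "?t \<le> 1" "?t ^ 2 = 1 / real n"
          using n powr_neg_half_squared[of "real n"] by (auto simp: powr_minus_divide ge_one_powr_ge_zero)
        \<comment> \<open>As \<open>?t\<close> is at most 1, more arcs only help: the first 2 |F|
          powers of \<open>?t\<close> cancel the count of maps per root position, and one surplus
          power remains to drive the limit to 0.\<close>
        have "?t ^ card (arcs T) \<le> ?t ^ (2 * card F + 1)"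
          using \<open>2 * card F < card (arcs T)\<close> t by (intro power_decreasing) auto
        also have "\<dots> = ?t / real n ^ card F"
          by (simp only: power_add power_mult t(3) power_one_right) (simp add: power_one_over)
        finally have tp: "?t ^ card (arcs T) \<le> ?t / real n ^ card F" .
        have prods: "(\<Prod>e\<in>arcs T. s n (\<gamma> e)) = A * ?t ^ card (arcs T)"
          by (simp add: s_def A_def prod.distrib)
        \<comment> \<open>Ignoring the bands is harmless here: the widths are of order
          \<open>n\<close>, so the crude count already has the right power.\<close>
        have cb: "real (card (?B n)) / real n \<le> real n ^ card F"
        proof -
          have "real (card (?B n)) \<le> real (n ^ card (verts T))"
            using card_band_embs_le_power[OF finite_verts] of_nat_le_iff by blast
          then show ?thesis using n V[of n] by (simp add: field_simps)
        qed
        have "cmod (injective_traffic_state (P n) n (theta_proportional c (b n) n (X n)) T \<gamma>) \<le>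
          \<bar>\<Prod>e\<in>arcs T. s n (\<gamma> e)\<bar> * (real (card (?B n)) / real n) * C"
          unfolding theta_proportional_eq s_def[symmetric] C_def by (rule wigner_matrix.norm_state_le[OF W])
        also have "\<dots> = A * ?t ^ card (arcs T) * (real (card (?B n)) / real n) * C"
          unfolding prods using A t by (simp add: abs_mult)
        also have "\<dots> \<le> A * (?t / real n ^ card F) * (real n ^ card F) * C"
          using A C t tp cb by (intro mult_right_mono mult_mono mult_left_mono) auto
        also have "\<dots> = A * C * ?t" using n by simp
        finally show ?thesis .
      qed
      have "(\<lambda>n. A * C * real n powr (- 1 / 2)) \<longlonglongrightarrow> A * C * 0"
        by (intro tendsto_mult tendsto_const tendsto_neg_powr filterlim_real_sequentially) simp
      then have "(\<lambda>n. A * C * real n powr (- 1 / 2)) \<longlonglongrightarrow> 0" by simp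
      then show ?thesis unfolding L0
        by (rule Lim_null_comparison[rotated]) (use bound in \<open>auto simp: eventually_at_top_linorder\<close>)
    qed
  qed
qed

text \<open>Off the double trees both sides are 0; on them \<sigma> is a constant factor, and only a
  real scalar depends on \<open>c\<close>.\<close>

lemma proportional_limit_tendsto_if_volume:
  assumes vol: "colored_double_tree T \<gamma> \<Longrightarrow>
      ((\<lambda>c. (\<Prod>f\<in>F. 1 / (2 * c (\<gamma> f) - (c (\<gamma> f))\<^sup>2)) * band_volume T (\<lambda>e. c (\<gamma> e))) \<longlongrightarrow> 1) Fl"
  shows "(proportional_limit \<beta> T F \<gamma> \<longlongrightarrow> \<sigma> \<beta> T \<gamma>) Fl"
proof (cases "colored_double_tree T \<gamma>")
  case True
  have "((\<lambda>c. of_real ((\<Prod>f\<in>F. 1 / (2 * c (\<gamma> f) - (c (\<gamma> f))\<^sup>2)) * band_volume T (\<lambda>e. c (\<gamma> e))) * \<sigma> \<beta> T \<gamma>)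
    \<longlongrightarrow> of_real 1 * \<sigma> \<beta> T \<gamma>) Fl"
    by (intro tendsto_mult tendsto_const tendsto_of_real vol True)
  then show ?thesis using True by (simp add: proportional_limit_def[abs_def])
next
  case False
  then show ?thesis by (simp add: proportional_limit_def[abs_def] \<sigma>_def)
qed


lemma finite_arcs_test_graph: "test_graph T \<Longrightarrow> finite (arcs T)"
  by (simp add: test_graph_def fin_digraph.finite_arcs)

text \<open>Each proportion is squeezed between 0 and the maximum. Multiplying the bounds of
  \<open>band_volume_bounds\<close> by the normalization leaves products of 2/(2-c), and the
  boundary factor 1 - 2 * sum tends to 1.\<close>

lemma proportional_limit_at_0:
  assumes T: "test_graph T" and g: "grown_tree T r (verts T) F"
  shows "(proportional_limit \<beta> T F \<gamma> \<longlongrightarrow> \<sigma> \<beta> T \<gamma>)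
    (inf (filtercomap (\<lambda>c. Max ((\<lambda>e. c (\<gamma> e)) ` arcs T)) (at_right 0))
         (principal {c. \<forall>i. 0 < c i \<and> c i < 1}))" (is "(_ \<longlongrightarrow> _) ?Fl")
proof (rule proportional_limit_tendsto_if_volume)
  note bas = grown_tree_basic[OF g]
  have pos: "\<forall>\<^sub>F c in ?Fl. \<forall>i. 0 < c i \<and> c i < 1"
    by (rule filter_leD[OF inf_le2]) (simp add: eventually_principal)
  have Max: "((\<lambda>c. Max ((\<lambda>e. c (\<gamma> e)) ` arcs T)) \<longlongrightarrow> 0) ?Fl"
    by (rule filterlim_mono[OF filterlim_filtercomap at_within_le_nhds inf_le1])
  have lim: "((\<lambda>c. c (\<gamma> f)) \<longlongrightarrow> 0) ?Fl" if "f \<in> F" for f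
  proof (rule tendsto_sandwich[OF _ _ tendsto_const Max])
    show "\<forall>\<^sub>F c in ?Fl. 0 \<le> c (\<gamma> f)" using pos by eventually_elim (simp add: less_imp_le)
    show "\<forall>\<^sub>F c in ?Fl. c (\<gamma> f) \<le> Max ((\<lambda>e. c (\<gamma> e)) ` arcs T)"
      using that bas finite_arcs_test_graph[OF T] by (intro always_eventually allI Max_ge) auto
  qed
  assume cdt: "colored_double_tree T \<gamma>"
  let ?R = "\<lambda>c. (\<Prod>f\<in>F. 1 / (2 * c (\<gamma> f) - (c (\<gamma> f))\<^sup>2)) * band_volume T (\<lambda>e. c (\<gamma> e))"
  have fin: "fin_digraph T" using T by (simp add: test_graph_def)
  have bounds: "?R c \<le> (\<Prod>f\<in>F. 2 / (2 - c (\<gamma> f))) \<and>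
      max 0 (1 - 2 * (\<Sum>f\<in>F. c (\<gamma> f))) * (\<Prod>f\<in>F. 2 / (2 - c (\<gamma> f))) \<le> ?R c"
    if c: "\<forall>i. 0 < c i \<and> c i < 1" for c
  proof -
    have cov: "\<exists>f\<in>F. ends T f = ends T e \<and> c (\<gamma> f) = c (\<gamma> e)" if "e \<in> arcs T" for e
      using double_tree_covered_by_tree[OF cdt g that] by metis
    have c0: "0 \<le> c (\<gamma> e)" for e using c by (simp add: less_imp_le)
    have q: "1 / (2 * c i - (c i)\<^sup>2) * (2 * c i) = 2 / (2 - c i)" for i
    proof -
      have "c i \<noteq> 0" "2 * c i - (c i)\<^sup>2 = (2 - c i) * c i"
        using c[rule_format, of i] by (auto simp: power2_eq_square algebra_simps)
      then show ?thesis by simp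
    qed
    let ?A = "\<Prod>f\<in>F. 1 / (2 * c (\<gamma> f) - (c (\<gamma> f))\<^sup>2)"
    have A: "0 \<le> ?A"
    proof (intro prod_nonneg divide_nonneg_nonneg)
      fix f
      have "(c (\<gamma> f))\<^sup>2 \<le> c (\<gamma> f)" using c[rule_format, of "\<gamma> f"] by (simp add: power2_eq_square mult_left_le)
      then show "0 \<le> 2 * c (\<gamma> f) - (c (\<gamma> f))\<^sup>2" using c0[of f] by simp
    qed simp
    have P: "?A * (\<Prod>f\<in>F. 2 * c (\<gamma> f)) = (\<Prod>f\<in>F. 2 / (2 - c (\<gamma> f)))"
      unfolding prod.distrib[symmetric] by (intro prod.cong refl q)
    note vb = band_volume_bounds[OF fin g cov c0]
    show ?thesis
      using mult_left_mono[OF vb(1) A] mult_left_mono[OF vb(2) A] P by (simp add: mult.left_commute)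
  qed
  show "(?R \<longlongrightarrow> 1) ?Fl"
  proof (rule tendsto_sandwich)
    show "\<forall>\<^sub>F c in ?Fl. max 0 (1 - 2 * (\<Sum>f\<in>F. c (\<gamma> f))) * (\<Prod>f\<in>F. 2 / (2 - c (\<gamma> f))) \<le> ?R c"
      using pos by eventually_elim (use bounds in blast)
    show "\<forall>\<^sub>F c in ?Fl. ?R c \<le> (\<Prod>f\<in>F. 2 / (2 - c (\<gamma> f)))"
      using pos by eventually_elim (use bounds in blast)
    have *: "((\<lambda>c. \<Prod>f\<in>F. 2 / (2 - c (\<gamma> f))) \<longlongrightarrow> (\<Prod>f\<in>F. 2 / (2 - 0))) ?Fl"
      by (intro tendsto_intros lim) auto
    then show "((\<lambda>c. \<Prod>f\<in>F. 2 / (2 - c (\<gamma> f))) \<longlongrightarrow> 1) ?Fl" by simp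
    have "((\<lambda>c. max 0 (1 - 2 * (\<Sum>f\<in>F. c (\<gamma> f))) * (\<Prod>f\<in>F. 2 / (2 - c (\<gamma> f)))) \<longlongrightarrow>
        max 0 (1 - 2 * (\<Sum>f\<in>F. 0)) * (\<Prod>f\<in>F. 2 / (2 - 0))) ?Fl"
      by (intro tendsto_intros lim) auto
    then show "((\<lambda>c. max 0 (1 - 2 * (\<Sum>f\<in>F. c (\<gamma> f))) * (\<Prod>f\<in>F. 2 / (2 - c (\<gamma> f)))) \<longlongrightarrow> 1) ?Fl"
      by simp
  qed
qed

text \<open>No cancellation is involved: 2c-c^2 tends to 1, and the volume lies between a fixed
  power of the minimum and 1.\<close>

lemma proportional_limit_at_1:
  assumes T: "test_graph T" and ne: "arcs T \<noteq> {}" and g: "grown_tree T r (verts T) F"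
  shows "(proportional_limit \<beta> T F \<gamma> \<longlongrightarrow> \<sigma> \<beta> T \<gamma>)
    (inf (filtercomap (\<lambda>c. Min ((\<lambda>e. c (\<gamma> e)) ` arcs T)) (at_left 1))
         (principal {c. \<forall>i. 0 < c i \<and> c i < 1}))" (is "(_ \<longlongrightarrow> _) ?Fl")
proof (rule proportional_limit_tendsto_if_volume)
  note bas = grown_tree_basic[OF g]
  have fin: "fin_digraph T" using T by (simp add: test_graph_def)
  let ?m = "\<lambda>c. Min ((\<lambda>e. c (\<gamma> e)) ` arcs T)"
  have pos: "\<forall>\<^sub>F c in ?Fl. \<forall>i. 0 < c i \<and> c i < 1"
    by (rule filter_leD[OF inf_le2]) (simp add: eventually_principal)
  have Min: "(?m \<longlongrightarrow> 1) ?Fl"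
    by (rule filterlim_mono[OF filterlim_filtercomap at_within_le_nhds inf_le1])
  have Min_le: "?m c \<le> c (\<gamma> e)" if "e \<in> arcs T" for c e
    using that finite_arcs_test_graph[OF T] by (intro Min_le) auto
  have lim: "((\<lambda>c. c (\<gamma> f)) \<longlongrightarrow> 1) ?Fl" if "f \<in> F" for f
  proof (rule tendsto_sandwich[OF _ _ Min tendsto_const])
    show "\<forall>\<^sub>F c in ?Fl. c (\<gamma> f) \<le> 1" using pos by eventually_elim (simp add: less_imp_le)
    show "\<forall>\<^sub>F c in ?Fl. ?m c \<le> c (\<gamma> f)"
      using that bas Min_le by (intro always_eventually allI) auto
  qed
  have vol: "((\<lambda>c. band_volume T (\<lambda>e. c (\<gamma> e))) \<longlongrightarrow> 1) ?Fl"
  proof (rule tendsto_sandwich)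
    show "\<forall>\<^sub>F c in ?Fl. ?m c ^ card (verts T) \<le> band_volume T (\<lambda>e. c (\<gamma> e))"
      using pos
    proof eventually_elim
      case (elim c)
      obtain e where e: "e \<in> arcs T" using ne by blast
      have "0 < ?m c" using elim ne finite_arcs_test_graph[OF T] by (subst Min_gr_iff) auto
      moreover have "?m c \<le> 1" using Min_le[OF e, of c] elim by (meson less_imp_le order_trans)
      ultimately show ?case by (intro band_volume_ge_power[OF fin] Min_le) auto
    qed
    show "\<forall>\<^sub>F c in ?Fl. band_volume T (\<lambda>e. c (\<gamma> e)) \<le> 1"
      by (intro always_eventually allI band_volume_le_1[OF fin])
    show "((\<lambda>c. ?m c ^ card (verts T)) \<longlongrightarrow> 1) ?Fl"
      using tendsto_power[OF Min, of "card (verts T)"] by simp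
  qed simp
  have "((\<lambda>c. (\<Prod>f\<in>F. 1 / (2 * c (\<gamma> f) - (c (\<gamma> f))\<^sup>2)) * band_volume T (\<lambda>e. c (\<gamma> e)))
      \<longlongrightarrow> (\<Prod>f\<in>F. 1 / (2 * 1 - 1\<^sup>2)) * 1) ?Fl"
    by (intro tendsto_intros lim vol) auto
  then show "((\<lambda>c. (\<Prod>f\<in>F. 1 / (2 * c (\<gamma> f) - (c (\<gamma> f))\<^sup>2)) * band_volume T (\<lambda>e. c (\<gamma> e))) \<longlongrightarrow> 1) ?Fl"
    by simp
qed

section \<open>Fixed band widths\<close>

text \<open>Each shape occurs about \<open>n\<close> times, once per root position, so the average
  over \<open>n\<close> leaves its weight. Unlike for proportional growth, the value need not vanish
  off the double trees.\<close>

definition fixed_limit ::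
  "('i \<Rightarrow> complex measure) \<Rightarrow> ('i \<Rightarrow> complex measure) \<Rightarrow> ('v, 'e) pre_digraph \<Rightarrow> 'v \<Rightarrow> ('e \<Rightarrow> 'i) \<Rightarrow>
    ('i \<Rightarrow> nat) \<Rightarrow> complex" where
  "fixed_limit \<mu> \<nu> T r \<gamma> b = of_real (\<Prod>e\<in>arcs T. (2 * real (b (\<gamma> e)) + 1) powr (- 1 / 2)) *
    (\<Sum>\<psi>\<in>shapes T r (\<lambda>e. b (\<gamma> e)) (verts T) (arcs T). shape_weight T \<gamma> \<mu> \<nu> \<psi>)"

lemma tendsto_fixed_limit:
  assumes T: "test_graph T" and g: "grown_tree T r (verts T) F"
    and w: "wigner \<beta> P X" and E: "entry_laws P X \<mu> \<nu>"
    and fm: "\<And>i. finite_moments (\<mu> i)" "\<And>i. finite_moments (\<nu> i)"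
  shows "(\<lambda>n. injective_traffic_state (P n) n (theta_fixed b (X n)) T \<gamma>) \<longlonglongrightarrow> fixed_limit \<mu> \<nu> T r \<gamma> b"
proof -
  interpret fin_digraph T using T by (simp add: test_graph_def)
  from entry_laws_moment_bound[OF w E finite_arcs fm] obtain K where
    K: "\<And>l::nat. (0::real) \<le> K l" "\<And>n e j k l. e \<in> arcs T \<Longrightarrow> 1 \<le> j \<Longrightarrow> j \<le> k \<Longrightarrow> k \<le> n \<Longrightarrow>
      (\<integral>\<^sup>+\<omega>. ennreal (cmod (X n (\<gamma> e) j k \<omega>) ^ l) \<partial>P n) \<le> ennreal (K l)" by blast
  have W: "wigner_matrix (P n) T \<beta> (X n) n \<gamma> K" for n
    by (rule wigner_imp_wigner_matrix[OF fin_digraph_axioms w K(2,1)])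
  let ?u = "\<lambda>n \<phi>. \<integral>\<omega>. (\<Prod>e\<in>arcs T. wigner_matrix.entry T (X n) \<gamma> \<phi> e \<omega>) \<partial>P n"
  let ?b = "\<lambda>e. b (\<gamma> e)"
  have u: "?u n \<phi> = shape_weight T \<gamma> \<mu> \<nu> (shape_of T r \<phi>)" if "\<phi> \<in> band_embs T ?b n" for n \<phi>
    using that E by (intro wigner_matrix.expectation_shape_weight[OF W])
      (auto simp: band_embs_def entry_laws_def)
  have "(\<lambda>n. (\<Sum>\<phi>\<in>band_embs T ?b n. ?u n \<phi>) / of_nat n) \<longlonglongrightarrow>
      (\<Sum>\<psi>\<in>shapes T r ?b (verts T) (arcs T). shape_weight T \<gamma> \<mu> \<nu> \<psi>)"
    by (rule sum_band_embs_tendsto[OF fin_digraph_axioms g]) (rule u)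
  then have "(\<lambda>n. of_real (\<Prod>e\<in>arcs T. (2 * real (b (\<gamma> e)) + 1) powr (- 1 / 2)) *
      ((\<Sum>\<phi>\<in>band_embs T ?b n. ?u n \<phi>) / of_nat n)) \<longlonglongrightarrow> fixed_limit \<mu> \<nu> T r \<gamma> b"
    unfolding fixed_limit_def by (intro tendsto_mult tendsto_const)
  then show ?thesis
    unfolding theta_fixed_eq wigner_matrix.state_eq[OF W] by (simp only: times_divide_eq_left times_divide_eq_right)
qed

text \<open>A model with the given laws is among the hypotheses because the weights are not
  evaluated directly: equalities and bounds are shown for the states of the model, uniformly in
  \<open>n\<close>, and carried over to \<open>fixed_limit\<close> by passing to the limit.\<close>

lemma fixed_limit_tendsto:
  assumes T: "test_graph T" and ne: "arcs T \<noteq> {}" and g: "grown_tree T r (verts T) F"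
    and w: "wigner \<beta> P X" and E: "entry_laws P X \<mu> \<nu>"
    and fm: "\<And>i. finite_moments (\<mu> i)" "\<And>i. finite_moments (\<nu> i)"
  shows "(fixed_limit \<mu> \<nu> T r \<gamma> \<longlongrightarrow> \<sigma> \<beta> T \<gamma>) (filtercomap (\<lambda>b. Min ((\<lambda>e. b (\<gamma> e)) ` arcs T)) at_top)"
    (is "(_ \<longlongrightarrow> _) ?Fl")
proof -
  interpret fin_digraph T using T by (simp add: test_graph_def)
  note bas = grown_tree_basic[OF g]
  from entry_laws_moment_bound[OF w E finite_arcs fm] obtain K where
    K: "\<And>l::nat. (0::real) \<le> K l" "\<And>n e j k l. e \<in> arcs T \<Longrightarrow> 1 \<le> j \<Longrightarrow> j \<le> k \<Longrightarrow> k \<le> n \<Longrightarrow>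
      (\<integral>\<^sup>+\<omega>. ennreal (cmod (X n (\<gamma> e) j k \<omega>) ^ l) \<partial>P n) \<le> ennreal (K l)" by blast
  have W: "wigner_matrix (P n) T \<beta> (X n) n \<gamma> K" for n
    by (rule wigner_imp_wigner_matrix[OF fin_digraph_axioms w K(2,1)])
  note lim = tendsto_fixed_limit[OF T g w E fm, of _ \<gamma>]
  have b_top: "filterlim (\<lambda>b. b (\<gamma> e)) at_top ?Fl" if "e \<in> arcs T" for e
    using that by (intro filterlim_at_top_mono[OF filterlim_filtercomap] always_eventually allI Min_le) auto
  have width_top: "filterlim (\<lambda>b. 2 * real (b (\<gamma> e)) + 1) at_top ?Fl" if "e \<in> arcs T" for e
  proof -
    have "filterlim (\<lambda>b. real (b (\<gamma> e))) at_top ?Fl"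
      by (rule filterlim_compose[OF filterlim_real_sequentially b_top[OF that]])
    then show ?thesis by (rule filterlim_at_top_mono) (simp add: always_eventually)
  qed
  let ?s = "\<lambda>b i. (2 * real (b i) + 1) powr (- 1 / 2)"
  have s2: "?s b i ^ 2 = 1 / (2 * real (b i) + 1)" for b :: "'c \<Rightarrow> nat" and i
    by (intro powr_neg_half_squared) simp
  show ?thesis
  proof (cases "colored_double_tree T \<gamma>")
    case True
    let ?Z = "\<lambda>b. real (card (shapes T r (\<lambda>e. b (\<gamma> e)) (verts T) (arcs T)))"
    let ?q = "\<lambda>b. (\<Prod>f\<in>F. 1 / (2 * real (b (\<gamma> f)) + 1)) * ?Z b"
    \<comment> \<open>The states of a double tree are \<sigma> times a normalized count, so
      uniqueness of limits identifies the sum of weights with \<sigma> times the number of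
      shapes.\<close>
    have L: "fixed_limit \<mu> \<nu> T r \<gamma> b = of_real (?q b) * \<sigma> \<beta> T \<gamma>" for b
    proof (rule LIMSEQ_unique[OF lim])
      have "(\<lambda>n. (\<Sum>\<phi>\<in>band_embs T (\<lambda>e. b (\<gamma> e)) n. 1::real) / of_nat n) \<longlonglongrightarrow>
          (\<Sum>\<psi>\<in>shapes T r (\<lambda>e. b (\<gamma> e)) (verts T) (arcs T). 1)"
        by (rule sum_band_embs_tendsto[OF fin_digraph_axioms g, where w = "\<lambda>_. 1"]) simp
      then have "(\<lambda>n. real (card (band_embs T (\<lambda>e. b (\<gamma> e)) n)) / real n) \<longlonglongrightarrow> ?Z b" by simp
      then have "(\<lambda>n. of_real ((\<Prod>e\<in>arcs T. ?s b (\<gamma> e)) *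
          (real (card (band_embs T (\<lambda>e. b (\<gamma> e)) n)) / real n)) * \<sigma> \<beta> T \<gamma>) \<longlonglongrightarrow>
          of_real ((\<Prod>e\<in>arcs T. ?s b (\<gamma> e)) * ?Z b) * \<sigma> \<beta> T \<gamma>"
        by (intro tendsto_mult tendsto_of_real tendsto_const)
      moreover have "(\<Prod>e\<in>arcs T. ?s b (\<gamma> e)) = (\<Prod>f\<in>F. 1 / (2 * real (b (\<gamma> f)) + 1))"
        unfolding double_tree_prod[OF True finite_arcs g, of "?s b"] s2 ..
      ultimately show "(\<lambda>n. injective_traffic_state (P n) n (theta_fixed b (X n)) T \<gamma>) \<longlonglongrightarrow>
          of_real (?q b) * \<sigma> \<beta> T \<gamma>"
        unfolding theta_fixed_eq wigner_matrix.state_double_tree[OF W True] by (simp only:)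
    qed
    have "(?q \<longlongrightarrow> 1) ?Fl"
    proof (rule tendsto_sandwich)
      have up: "?q b \<le> 1" for b
      proof -
        have "?Z b \<le> real (\<Prod>f\<in>F. 2 * b (\<gamma> f) + 1)"
          using finite_shapes(2)[OF g, of "\<lambda>e. b (\<gamma> e)"] by (simp only: of_nat_le_iff)
        then have "?q b \<le> (\<Prod>f\<in>F. 1 / (2 * real (b (\<gamma> f)) + 1)) * real (\<Prod>f\<in>F. 2 * b (\<gamma> f) + 1)"
          by (intro mult_left_mono prod_nonneg) auto
        also have "\<dots> = (\<Prod>f\<in>F. 1)"
          unfolding of_nat_prod prod.distrib[symmetric] by (intro prod.cong refl) (simp add: add_pos_nonneg)
        finally show ?thesis by simp
      qed
      then show "\<forall>\<^sub>F b in ?Fl. ?q b \<le> 1" by (intro always_eventually allI)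
      let ?N = "real (card (verts T))"
      have low: "(\<Prod>f\<in>F. max 0 (1 - ?N / (2 * real (b (\<gamma> f)) + 1))) \<le> ?q b" for b
      proof -
        have cov: "\<exists>f\<in>F. ends T f = ends T e \<and> b (\<gamma> f) = b (\<gamma> e)" if "e \<in> arcs T" for e
          using double_tree_covered_by_tree[OF True g that] by metis
        have "real (\<Prod>f\<in>F. 2 * b (\<gamma> f) + 1 - card (verts T)) \<le> ?Z b"
          using card_shapes_ge[OF g, of "\<lambda>e. b (\<gamma> e)"] cov by (simp only: of_nat_le_iff)
        then have "(\<Prod>f\<in>F. 1 / (2 * real (b (\<gamma> f)) + 1)) * real (\<Prod>f\<in>F. 2 * b (\<gamma> f) + 1 - card (verts T)) \<le> ?q b"
          by (intro mult_left_mono prod_nonneg) auto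
        moreover have "(\<Prod>f\<in>F. max 0 (1 - ?N / (2 * real (b (\<gamma> f)) + 1))) \<le>
            (\<Prod>f\<in>F. 1 / (2 * real (b (\<gamma> f)) + 1)) * real (\<Prod>f\<in>F. 2 * b (\<gamma> f) + 1 - card (verts T))"
          unfolding of_nat_prod prod.distrib[symmetric]
        proof (intro prod_mono conjI)
          fix f
          let ?d = "2 * real (b (\<gamma> f)) + 1"
          have d: "0 < ?d" by simp
          \<comment> \<open>Truncation can only increase the difference, so the real difference is a
            lower bound in all cases.\<close>
          have "?d - ?N \<le> real (2 * b (\<gamma> f) + 1 - card (verts T))" by linarith
          from divide_right_mono[OF this, of ?d] d
          have "1 - ?N / ?d \<le> real (2 * b (\<gamma> f) + 1 - card (verts T)) / ?d"
            by (simp add: diff_divide_distrib)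
          then show "max 0 (1 - ?N / ?d) \<le> 1 / ?d * real (2 * b (\<gamma> f) + 1 - card (verts T))"
            using d by simp
        qed simp
        ultimately show ?thesis by linarith
      qed
      then show "\<forall>\<^sub>F b in ?Fl. (\<Prod>f\<in>F. max 0 (1 - ?N / (2 * real (b (\<gamma> f)) + 1))) \<le> ?q b"
        by (intro always_eventually allI)
      have "((\<lambda>b. \<Prod>f\<in>F. max 0 (1 - ?N / (2 * real (b (\<gamma> f)) + 1))) \<longlongrightarrow> (\<Prod>f\<in>F. max 0 (1 - 0))) ?Fl"
        using bas by (intro tendsto_prod tendsto_max tendsto_diff tendsto_const
            tendsto_divide_0[OF tendsto_const] filterlim_at_top_imp_at_infinity width_top) auto
      then show "((\<lambda>b. \<Prod>f\<in>F. max 0 (1 - ?N / (2 * real (b (\<gamma> f)) + 1))) \<longlongrightarrow> 1) ?Fl" by simp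
    qed simp
    then have "((\<lambda>b. of_real (?q b) * \<sigma> \<beta> T \<gamma>) \<longlongrightarrow> of_real 1 * \<sigma> \<beta> T \<gamma>) ?Fl"
      by (intro tendsto_mult tendsto_of_real tendsto_const)
    then show ?thesis unfolding L[abs_def, symmetric] by (simp add: L[abs_def])
  next
    case False
    then have \<sigma>0: "\<sigma> \<beta> T \<gamma> = 0" by (simp add: \<sigma>_def)
    from T g False show ?thesis
    proof (cases rule: non_double_tree_cases)
      case (single e)
      have "fixed_limit \<mu> \<nu> T r \<gamma> b = 0" for b
      proof (rule LIMSEQ_unique[OF lim])
        have "injective_traffic_state (P n) n (theta_fixed b (X n)) T \<gamma> = 0" for n
          unfolding theta_fixed_eq by (rule wigner_matrix.state_zero_if_single[OF W single(1,2)]) (rule single(3))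
        then show "(\<lambda>n. injective_traffic_state (P n) n (theta_fixed b (X n)) T \<gamma>) \<longlonglongrightarrow> 0" by simp
      qed
      then show ?thesis unfolding \<sigma>0 by (intro tendsto_eventually always_eventually allI)
    next
      case (leftover p)
      then obtain e\<^sub>0 where e\<^sub>0: "e\<^sub>0 \<in> arcs T" "e\<^sub>0 \<notin> F" "e\<^sub>0 \<notin> p ` F" by blast
      define C where "C = 1 + real (card (arcs T)) * K (card (arcs T))"
      have C: "0 \<le> C" using K(1) by (simp add: C_def)
      have s01: "0 \<le> ?s b i" "?s b i \<le> 1" for b :: "'c \<Rightarrow> nat" and i
        by (auto simp: powr_minus_divide ge_one_powr_ge_zero)
      \<comment> \<open>Together \<open>F\<close> and its twins give 1/(2b+1) per tree edge, the
        surplus arc \<open>e\<^sub>0\<close> keeps its factor, and the factors of all remaining arcs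
        are at most 1.\<close>
      have prods: "(\<Prod>e\<in>arcs T. ?s b (\<gamma> e)) \<le> (\<Prod>f\<in>F. 1 / (2 * real (b (\<gamma> f)) + 1)) * ?s b (\<gamma> e\<^sub>0)" for b
      proof -
        let ?G = "insert e\<^sub>0 (F \<union> p ` F)"
        have finF: "finite F" using bas by simp
        have G: "?G \<subseteq> arcs T" using leftover bas e\<^sub>0 by auto
        have "(\<Prod>e\<in>arcs T. ?s b (\<gamma> e)) = (\<Prod>e\<in>?G. ?s b (\<gamma> e)) * (\<Prod>e\<in>arcs T - ?G. ?s b (\<gamma> e))"
          using prod.subset_diff[OF G finite_arcs] by (simp add: mult.commute)
        also have "\<dots> \<le> (\<Prod>e\<in>?G. ?s b (\<gamma> e)) * 1"
          by (intro mult_left_mono prod_le_1 prod_nonneg) (auto simp only: s01)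
        also have "\<dots> = ?s b (\<gamma> e\<^sub>0) * ((\<Prod>e\<in>F. ?s b (\<gamma> e)) * (\<Prod>e\<in>p ` F. ?s b (\<gamma> e)))"
          using e\<^sub>0 finF leftover(2) by (simp add: prod.union_disjoint Int_commute)
        also have "(\<Prod>e\<in>p ` F. ?s b (\<gamma> e)) = (\<Prod>f\<in>F. ?s b (\<gamma> f))"
          unfolding prod.reindex[OF leftover(3)] using leftover(1) by (intro prod.cong refl) simp
        also have "(\<Prod>e\<in>F. ?s b (\<gamma> e)) * (\<Prod>f\<in>F. ?s b (\<gamma> f)) = (\<Prod>f\<in>F. 1 / (2 * real (b (\<gamma> f)) + 1))"
          unfolding prod.distrib[symmetric] by (simp only: s2 flip: power2_eq_square)
        finally show ?thesis by (simp add: mult.commute)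
      qed
      \<comment> \<open>The number of shapes is at most the product of the 2b+1 over
        \<open>F\<close>, which cancels the contribution of \<open>F\<close> and its twins. The
        constant \<open>C\<close> depends neither on \<open>n\<close> nor on
        \<open>b\<close>.\<close>
      have state: "cmod (injective_traffic_state (P n) n (theta_fixed b (X n)) T \<gamma>) \<le> ?s b (\<gamma> e\<^sub>0) * C"
        if n: "1 \<le> n" for n b
      proof -
        let ?B = "band_embs T (\<lambda>e. b (\<gamma> e)) n" and ?Z = "real (\<Prod>f\<in>F. 2 * b (\<gamma> f) + 1)"
        have "card ?B \<le> n * (\<Prod>f\<in>F. 2 * b (\<gamma> f) + 1)"
          using card_band_embs(1)[OF fin_digraph_axioms g, of "\<lambda>e. b (\<gamma> e)" n]
            finite_shapes(2)[OF g, of "\<lambda>e. b (\<gamma> e)"] by (meson mult_le_mono2 order_trans)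
        then have "real (card ?B) \<le> real n * ?Z" by (metis of_nat_le_iff of_nat_mult)
        then have B: "real (card ?B) / real n \<le> ?Z" using n by (simp add: field_simps)
        have one: "(\<Prod>f\<in>F. 1 / (2 * real (b (\<gamma> f)) + 1)) * ?Z = 1"
        proof -
          have "(\<Prod>f\<in>F. 1 / (2 * real (b (\<gamma> f)) + 1)) * ?Z = (\<Prod>f\<in>F. 1)"
            unfolding of_nat_prod prod.distrib[symmetric] by (intro prod.cong refl) (simp add: add_pos_nonneg)
          then show ?thesis by simp
        qed
        have "cmod (injective_traffic_state (P n) n (theta_fixed b (X n)) T \<gamma>) \<le>
          \<bar>\<Prod>e\<in>arcs T. ?s b (\<gamma> e)\<bar> * (real (card ?B) / real n) * C"
          unfolding theta_fixed_eq C_def by (rule wigner_matrix.norm_state_le[OF W])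
        also have "\<bar>\<Prod>e\<in>arcs T. ?s b (\<gamma> e)\<bar> = (\<Prod>e\<in>arcs T. ?s b (\<gamma> e))"
          by (intro abs_of_nonneg prod_nonneg ballI s01)
        also have "\<dots> * (real (card ?B) / real n) * C \<le>
            ((\<Prod>f\<in>F. 1 / (2 * real (b (\<gamma> f)) + 1)) * ?s b (\<gamma> e\<^sub>0)) * ?Z * C"
          by (intro mult_right_mono mult_mono prods B C mult_nonneg_nonneg prod_nonneg) auto
        also have "\<dots> = ((\<Prod>f\<in>F. 1 / (2 * real (b (\<gamma> f)) + 1)) * ?Z) * (?s b (\<gamma> e\<^sub>0) * C)"
          by (simp only: mult_ac)
        finally show ?thesis unfolding one by simp
      qed
      \<comment> \<open>The bound on the states is uniform in \<open>n\<close>, hence inherited by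
        their limit for each \<open>b\<close>.\<close>
      have bound: "cmod (fixed_limit \<mu> \<nu> T r \<gamma> b) \<le> ?s b (\<gamma> e\<^sub>0) * C" for b
        by (rule LIMSEQ_le_const2[OF tendsto_norm[OF lim]]) (use state in blast)
      have "((\<lambda>b. ?s b (\<gamma> e\<^sub>0) * C) \<longlongrightarrow> 0 * C) ?Fl"
        by (intro tendsto_mult tendsto_const tendsto_neg_powr width_top e\<^sub>0) simp
      then have "((\<lambda>b. ?s b (\<gamma> e\<^sub>0) * C) \<longlongrightarrow> 0) ?Fl" by simp
      then show ?thesis unfolding \<sigma>0
        by (rule Lim_null_comparison[rotated]) (intro always_eventually allI bound)
    qed
  qed
qed

theorem mainTheorem12:
  fixes \<beta> :: "'i \<Rightarrow> real"
    and T :: "('v, 'e) pre_digraph"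
    and \<gamma> :: "'e \<Rightarrow> 'i"
  assumes "test_graph T" and "arcs T \<noteq> {}"
  shows
    "(\<exists>L :: ('i \<Rightarrow> real) \<Rightarrow> complex.
        (\<forall>c b (P :: nat \<Rightarrow> 'w measure) X.
           (\<forall>i. 0 < c i \<and> c i < 1) \<longrightarrow>
           wigner \<beta> P X \<longrightarrow> uniformly_controlled_moments P X \<longrightarrow>
           (\<forall>i. (\<lambda>n. real (b n i) / real n) \<longlonglongrightarrow> c i) \<longrightarrow>
           (\<lambda>n. injective_traffic_state (P n) n (theta_proportional c (b n) n (X n)) T \<gamma>)
             \<longlonglongrightarrow> L c) \<and>
        (L \<longlongrightarrow> \<sigma> \<beta> T \<gamma>)
          (inf (filtercomap (\<lambda>c. Max ((\<lambda>e. c (\<gamma> e)) ` arcs T)) (at_right 0))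
               (principal {c. \<forall>i. 0 < c i \<and> c i < 1})) \<and>
        (L \<longlongrightarrow> \<sigma> \<beta> T \<gamma>)
          (inf (filtercomap (\<lambda>c. Min ((\<lambda>e. c (\<gamma> e)) ` arcs T)) (at_left 1))
               (principal {c. \<forall>i. 0 < c i \<and> c i < 1})))
     \<and>
     (\<forall>\<mu> \<nu>. (\<forall>i. finite_moments (\<mu> i) \<and> finite_moments (\<nu> i)) \<longrightarrow>
       (\<exists>L' :: ('i \<Rightarrow> nat) \<Rightarrow> complex.
          (\<forall>b (P :: nat \<Rightarrow> 'w measure) X.
             wigner \<beta> P X \<longrightarrow> entry_laws P X \<mu> \<nu> \<longrightarrow>
             (\<lambda>n. injective_traffic_state (P n) n (theta_fixed b (X n)) T \<gamma>)
               \<longlonglongrightarrow> L' b) \<and>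
          (L' \<longlongrightarrow> \<sigma> \<beta> T \<gamma>)
            (filtercomap (\<lambda>b. Min ((\<lambda>e. b (\<gamma> e)) ` arcs T)) at_top)))"
proof -
  have T: "fin_digraph T" and "strongly_connected (mk_symmetric T)"
    using assms(1) by (simp_all add: test_graph_def connected_def)
  then have "verts T \<noteq> {}" by (simp add: strongly_connected_def)
  then obtain r where "r \<in> verts T" by blast
  \<comment> \<open>Root and spanning tree depend on \<open>T\<close> alone, so limits built from
    them can be named before widths and models are quantified.\<close>
  with assms(1) obtain F where g: "grown_tree T r (verts T) F" by (rule spanning_grown_tree)
  show ?thesis
  proof (intro conjI allI impI)
    let ?L = "proportional_limit \<beta> T F \<gamma>"
    show "\<exists>L :: ('i \<Rightarrow> real) \<Rightarrow> complex.
        (\<forall>c b (P :: nat \<Rightarrow> 'w measure) X.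
           (\<forall>i. 0 < c i \<and> c i < 1) \<longrightarrow>
           wigner \<beta> P X \<longrightarrow> uniformly_controlled_moments P X \<longrightarrow>
           (\<forall>i. (\<lambda>n. real (b n i) / real n) \<longlonglongrightarrow> c i) \<longrightarrow>
           (\<lambda>n. injective_traffic_state (P n) n (theta_proportional c (b n) n (X n)) T \<gamma>)
             \<longlonglongrightarrow> L c) \<and>
        (L \<longlongrightarrow> \<sigma> \<beta> T \<gamma>)
          (inf (filtercomap (\<lambda>c. Max ((\<lambda>e. c (\<gamma> e)) ` arcs T)) (at_right 0))
               (principal {c. \<forall>i. 0 < c i \<and> c i < 1})) \<and>
        (L \<longlongrightarrow> \<sigma> \<beta> T \<gamma>)
          (inf (filtercomap (\<lambda>c. Min ((\<lambda>e. c (\<gamma> e)) ` arcs T)) (at_left 1))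
               (principal {c. \<forall>i. 0 < c i \<and> c i < 1}))"
    proof (intro exI[of _ ?L] conjI allI impI)
      fix c :: "'i \<Rightarrow> real" and b and P :: "nat \<Rightarrow> 'w measure" and X
      assume "\<forall>i. 0 < c i \<and> c i < 1" "wigner \<beta> P X" "uniformly_controlled_moments P X"
        "\<forall>i. (\<lambda>n. real (b n i) / real n) \<longlonglongrightarrow> c i"
      then show "(\<lambda>n. injective_traffic_state (P n) n (theta_proportional c (b n) n (X n)) T \<gamma>) \<longlonglongrightarrow> ?L c"
        by (intro tendsto_proportional_limit[OF assms(1) g]) auto
    qed (rule proportional_limit_at_0[OF assms(1) g] proportional_limit_at_1[OF assms g])+
  next
    fix \<mu> \<nu> :: "'i \<Rightarrow> complex measure"
    assume fm: "\<forall>i. finite_moments (\<mu> i) \<and> finite_moments (\<nu> i)"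
    let ?Fl = "filtercomap (\<lambda>b. Min ((\<lambda>e. b (\<gamma> e)) ` arcs T)) at_top"
    \<comment> \<open>If no model has these laws, \<open>fixed_limit\<close> need not converge (\<open>\<mu>\<close> may fail to be centred).\<close>
    show "\<exists>L' :: ('i \<Rightarrow> nat) \<Rightarrow> complex.
          (\<forall>b (P :: nat \<Rightarrow> 'w measure) X.
             wigner \<beta> P X \<longrightarrow> entry_laws P X \<mu> \<nu> \<longrightarrow>
             (\<lambda>n. injective_traffic_state (P n) n (theta_fixed b (X n)) T \<gamma>)
               \<longlonglongrightarrow> L' b) \<and>
          (L' \<longlongrightarrow> \<sigma> \<beta> T \<gamma>) ?Fl"
    proof (cases "\<exists>(P :: nat \<Rightarrow> 'w measure) X. wigner \<beta> P X \<and> entry_laws P X \<mu> \<nu>")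
      case True
      then obtain P :: "nat \<Rightarrow> 'w measure" and X where "wigner \<beta> P X" "entry_laws P X \<mu> \<nu>" by blast
      then have "(fixed_limit \<mu> \<nu> T r \<gamma> \<longlongrightarrow> \<sigma> \<beta> T \<gamma>) ?Fl"
        using fm by (intro fixed_limit_tendsto[OF assms g]) auto
      then show ?thesis
        using tendsto_fixed_limit[OF assms(1) g] fm by (intro exI[of _ "fixed_limit \<mu> \<nu> T r \<gamma>"]) blast
    next
      case False
      then show ?thesis by (intro exI[of _ "\<lambda>_. \<sigma> \<beta> T \<gamma>"]) auto
    qed
  qed
qed

end
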